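(* Let $k$ be a fixed positive integer. For each $n$, let $P_n$ be a positive integer and $p_n\in[0,1]$, and consider the binomial random intersection graph $G_b(n,P_n,p_n)$. Define the sequence $\alpha_n$ by $$p_n^2P_n=\frac{\ln n+(k-1)\ln\ln n+\alpha_n}{n}.$$ If $P_n=\omega\big(n(\ln n)^5\big)$, then $$\lim_{n\to\infty}\mathbb{P}[G_b(n,P_n,p_n)\text{ is }k\text{-connected}]=\begin{cases}0,&\text{if }\lim_{n\to\infty}\alpha_n=-\infty,\\ 1,&\text{if }\lim_{n\to\infty}\alpha_n=\infty,\\ e^{-\frac{e^{-\alpha^*}}{(k-1)!}},&\text{if }\lim_{n\to\infty}\alpha_n=\alpha^*\in(-\infty,\infty),\end{cases}$$ and $$\lim_{n\to\infty}\mathbb{P}[G_b(n,P_n,p_n)\text{ has minimum node degree at least }k]=\begin{cases}0,&\text{if }\lim_{n\to\infty}\alpha_n=-\infty,\\ 1,&\text{if }\lim_{n\to\infty}\alpha_n=\infty,\\ e^{-\frac{e^{-\alpha^*}}{(k-1)!}},&\text{if }\lim_{n\to\infty}\alpha_n=\alpha^*\in(-\infty,\infty).\end{cases}$$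
   Context: Binomial random intersection graph $G_b(n,P_n,p_n)$: node set $\{v_1,\dots,v_n\}$; there is a pool of $P_n$ distinct objects; independently for each node $v_i$, an object set $S_i$ is formed by including each object of the pool independently with probability $p_n$. Two distinct nodes $v_i,v_j$ are joined by an undirected edge iff $S_i\cap S_j\neq\emptyset$. A graph is $k$-connected if every pair of nodes is joined by at least $k$ internally node-disjoint paths (equivalently, it cannot be disconnected by deleting at most $k-1$ nodes or edges). All parameters are sequences indexed by $n$, limits are as $n\to\infty$, $k$ does not depend on $n$, and $o,\omega,O,\Omega$ are standard Landau notation. *)

theory Defs
  imports "HOL-Probability.Probability" "HOL-Library.Landau_Symbols"
begin

type_synonym 'v ugraph = "'v set \<times> 'v set set"

abbreviation nodes :: "'v ugraph \<Rightarrow> 'v set" where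
  "nodes G \<equiv> fst G"

abbreviation edges :: "'v ugraph \<Rightarrow> 'v set set" where
  "edges G \<equiv> snd G"

definition node_degree :: "'v ugraph \<Rightarrow> 'v \<Rightarrow> nat" where
  "node_degree G v = card {w \<in> nodes G. w \<noteq> v \<and> {v, w} \<in> edges G}"

text \<open>Meaningful only for a finite nonempty node set.\<close>

definition min_node_degree :: "'v ugraph \<Rightarrow> nat" where
  "min_node_degree G = Min (node_degree G ` nodes G)"

definition path_between :: "'v ugraph \<Rightarrow> 'v \<Rightarrow> 'v \<Rightarrow> 'v list \<Rightarrow> bool" where
  "path_between G u v xs \<longleftrightarrow>
     xs \<noteq> [] \<and> hd xs = u \<and> last xs = v \<and> distinct xs \<and> set xs \<subseteq> nodes G \<and>
     (\<forall>i. Suc i < length xs \<longrightarrow> {xs ! i, xs ! Suc i} \<in> edges G)"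

definition internally_disjoint :: "'v \<Rightarrow> 'v \<Rightarrow> 'v list \<Rightarrow> 'v list \<Rightarrow> bool" where
  "internally_disjoint u v xs ys \<longleftrightarrow> disjnt (set xs - {u, v}) (set ys - {u, v})"

text \<open>The paths form a set, so for adjacent nodes the edge joining them, which has no
  internal node, counts as exactly one path.\<close>

definition k_connected :: "nat \<Rightarrow> 'v ugraph \<Rightarrow> bool" where
  "k_connected k G \<longleftrightarrow>
     (\<forall>u \<in> nodes G. \<forall>v \<in> nodes G. u \<noteq> v \<longrightarrow>
        (\<exists>Q. finite Q \<and> k \<le> card Q \<and> (\<forall>xs \<in> Q. path_between G u v xs) \<and>
             pairwise (internally_disjoint u v) Q))"

definition binomial_subset_pmf :: "'o set \<Rightarrow> real \<Rightarrow> 'o set pmf" where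
  "binomial_subset_pmf A p =
     map_pmf (\<lambda>f. {x \<in> A. f x}) (Pi_pmf A False (\<lambda>_. bernoulli_pmf p))"

definition intersection_graph :: "'v set \<Rightarrow> ('v \<Rightarrow> 'o set) \<Rightarrow> 'v ugraph" where
  "intersection_graph V S =
     (V, {{u, v} | u v. u \<in> V \<and> v \<in> V \<and> u \<noteq> v \<and> S u \<inter> S v \<noteq> {}})"

text \<open>Node \<open>v\<^sub>i\<close> is represented by \<open>i\<close>, and the object pool by \<open>{1..P}\<close>.\<close>

definition binomial_intersection_graph :: "nat \<Rightarrow> nat \<Rightarrow> real \<Rightarrow> nat ugraph pmf" where
  "binomial_intersection_graph n P p =
     map_pmf (intersection_graph {1..n})
       (Pi_pmf {1..n} {} (\<lambda>_. binomial_subset_pmf {1..P} p))"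

end

theory Submission
  imports Defs "HOL-Real_Asymp.Real_Asymp"
begin

text \<open>
  Write \<open>S\<^sub>v\<close> for the object set of a node \<open>v\<close> and \<open>c = n p\<^sup>2 P\<close>. Everything rests on revealing
  the object sets of a set \<open>A\<close> of nodes first: given these, the remaining nodes meet the union of the
  \<open>S\<^sub>v\<close> independently of each other, with probability \<open>1 - (1 - p)\<^sup>w\<close> where \<open>w\<close> is the size of
  that union, and for disjoint \<open>S\<^sub>v\<close> the degrees of the nodes in \<open>A\<close> are independent. The growth
  condition on \<open>P\<close> makes \<open>w\<close> concentrate around \<open>\<bar>A\<bar> p P\<close> up to a relative error \<open>o(1 / ln n)\<close>,
  with an error probability that survives a union bound over all \<open>A\<close>.

  \<^item> Minimum degree: when \<open>\<alpha>\<^sub>n \<longlongrightarrow> a\<close>, the factorial moments of the number of nodes of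
    degree less than \<open>k\<close> converge to those of a Poisson variable with mean \<open>exp (- a) / (k - 1)!\<close>, and
    Bonferroni's inequalities give the limit.
  \<^item> Connectivity: by Menger's theorem, a graph that is not \<open>k\<close>-connected has a nonempty set \<open>A\<close> of at
    most half of the nodes with fewer than \<open>k\<close> outer neighbours. If all degrees are at least \<open>k\<close>, then
    \<open>A\<close> contains an edge, which costs a factor \<open>\<bar>A\<bar>\<^sup>2 c / n\<close>; this suffices to make the expected
    number of such sets vanish.
  \<^item> The cases \<open>\<alpha>\<^sub>n \<longlongrightarrow> \<plusminus>\<infinity>\<close> follow from the case of a finite limit since both properties are
    monotone in \<open>p\<close>.
\<close>

section \<open>Menger's theorem\<close>

text \<open>At the threshold \<open>n exp (- c)\<close> only stays bounded, so a plain first moment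
  over sets with few outer neighbours cannot vanish: for \<open>k = 1\<close> isolated nodes already
  have a positive limiting expectation. The edge inside \<open>A\<close> contributes
  \<open>c / n\<close>, which beats the powers of \<open>c\<close> that come from allowing a few
  outer neighbours. The obstacle is large sets: \<open>r\<close> nodes inside leave only
  \<open>n - r\<close> outside, which costs \<open>exp (c r\<^sup>2 / n)\<close>, about
  \<open>n powr (r / 2)\<close> at \<open>r = n / 2\<close>. The factor \<open>1 / r!\<close> of the
  union bound pays for it, as \<open>exp (c r / n)\<close> is at most of order
  \<open>r powr (3 / 4)\<close>. The estimate for sets containing an edge serves twice. If all
  degrees in \<open>A\<close> are at most \<open>m\<close>, then \<open>A\<close> has at most
  \<open>card A * m\<close> outer neighbours, so the same bound removes the dependent part of the
  factorial moments. All asymptotics are done for a finite limit of \<open>\<alpha>\<close>; an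
  infinite limit gives no two-sided control of \<open>n exp (- c)\<close> and is reached only by
  coupling with the critical sequences.\<close>

definition walk :: "('v \<times> 'v) set \<Rightarrow> 'v set \<Rightarrow> 'v set \<Rightarrow> 'v list \<Rightarrow> bool" where
  "walk E A B xs \<longleftrightarrow>
     xs \<noteq> [] \<and> hd xs \<in> A \<and> last xs \<in> B \<and> successively (\<lambda>x y. (x, y) \<in> E) xs"

text \<open>Separators are tested on walks with repeated vertices, so that pieces can be glued
  without shortcuts. A single vertex is a walk, hence every separator contains
  \<open>A \<inter> B\<close>.\<close>

definition separates :: "('v \<times> 'v) set \<Rightarrow> 'v set \<Rightarrow> 'v set \<Rightarrow> 'v set \<Rightarrow> bool" where
  "separates E A B X \<longleftrightarrow> (\<forall>xs. walk E A B xs \<longrightarrow> set xs \<inter> X \<noteq> {})"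

lemma walk_append:
  assumes "walk E A B xs" "walk E C D ys" "(last xs, hd ys) \<in> E"
  shows "walk E A D (xs @ ys)"
  using assms by (auto simp: walk_def successively_append_iff)

lemma walk_prefix:
  assumes "walk E A B (xs @ v # ys)" shows "walk E A {v} (xs @ [v])"
  using assms by (cases xs) (auto simp: walk_def successively_append_iff successively_Cons hd_append split: if_splits)

lemma walk_suffix:
  assumes "walk E A B (xs @ v # ys)" shows "walk E {v} B (v # ys)"
  using assms by (auto simp: walk_def successively_append_iff)

lemma walk_glue:
  assumes "walk E A {v} (xs @ [v])" "walk E {v} B (v # ys)"
  shows "walk E A B (xs @ v # ys)"
  using assms by (cases xs) (auto simp: walk_def successively_append_iff successively_Cons hd_append split: if_splits)

lemma walk_mono:
  assumes "walk E A B xs" "E \<subseteq> E'" shows "walk E' A B xs"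
  using assms unfolding walk_def by (auto elim!: successively_mono)

text \<open>An edge is left from its source, and every vertex but the last one is left. So a walk
  cut at its first visit to a set containing \<open>x\<close> survives the deletion of
  \<open>(x, y)\<close>, even if it ends in \<open>x\<close>.\<close>

lemma walk_avoid_edge_source:
  assumes "walk (insert (x, y) E) A B (xs @ [v])" "x \<notin> set xs"
  shows "walk E A B (xs @ [v])"
proof -
  have "successively (\<lambda>a b. (a, b) \<in> E) (xs @ [v])"
    if "successively (\<lambda>a b. (a, b) \<in> insert (x, y) E) (xs @ [v])" "x \<notin> set xs"
    using that
  proof (induction xs)
    case (Cons a xs) then show ?case by (cases xs) auto
  qed simp
  with assms show ?thesis by (simp add: walk_def)
qed

lemma walk_avoid_edge_target:
  assumes "walk (insert (x, y) E) A B (v # xs)" "y \<notin> set xs"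
  shows "walk E A B (v # xs)"
proof -
  have "successively (\<lambda>a b. (a, b) \<in> E) (v # xs)"
    if "successively (\<lambda>a b. (a, b) \<in> insert (x, y) E) (v # xs)" "y \<notin> set xs"
    using that
  proof (induction xs arbitrary: v)
    case (Cons a xs) then show ?case by (cases xs) auto
  qed simp
  with assms show ?thesis by (simp add: walk_def)
qed

lemma walk_insert_cases:
  assumes "walk (insert (x, y) E) A B xs"
  shows "walk E A B xs \<or> x \<in> set xs \<and> y \<in> set xs"
proof -
  have "successively (\<lambda>a b. (a, b) \<in> E) xs \<or> x \<in> set xs \<and> y \<in> set xs"
    if "successively (\<lambda>a b. (a, b) \<in> insert (x, y) E) xs"
    using that
  proof (induction xs)
    case (Cons a xs) then show ?case by (cases xs) auto
  qed simp
  with assms show ?thesis by (auto simp: walk_def)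
qed

text \<open>An injection between finite sets of equal size has an inverse; it indexes disjoint paths
  by the vertex of the separator where they end or start.\<close>

lemma card_imp_labelling:
  assumes "finite T" "card Q = card T" "l ` Q \<subseteq> T" "inj_on l Q"
  shows "\<exists>f. \<forall>t\<in>T. f t \<in> Q \<and> l (f t) = t"
proof -
  have "l ` Q = T"
    using assms by (intro card_subset_eq) (auto simp: card_image)
  then show ?thesis
    by (intro exI[of _ "inv_into Q l"]) (auto simp: inv_into_into f_inv_into_f)
qed

text \<open>
  Goring's induction on the edges. If deleting \<open>(x, y)\<close> creates a separator \<open>X\<close> with fewer than \<open>s\<close>
  elements, then \<open>insert x X\<close> and \<open>insert y X\<close> have exactly \<open>s\<close> elements, and \<open>s\<close> disjoint paths from
  \<open>A\<close> to the former and from the latter to \<open>B\<close> are glued along \<open>X\<close> and the edge \<open>(x, y)\<close>.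
\<close>

lemma menger_sets:
  fixes E :: "('v \<times> 'v) set"
  assumes "finite E" "finite A" "finite B"
    and "\<And>X. finite X \<Longrightarrow> separates E A B X \<Longrightarrow> s \<le> card X"
  shows "\<exists>Q. finite Q \<and> card Q = s \<and> (\<forall>xs\<in>Q. walk E A B xs \<and> distinct xs) \<and>
           pairwise (\<lambda>xs ys. disjnt (set xs) (set ys)) Q"
  using assms
proof (induction E arbitrary: A B rule: finite_induct)
  case empty
  have walk_empty: "walk {} A B xs \<longleftrightarrow> (\<exists>v\<in>A \<inter> B. xs = [v])" for xs :: "'v list"
    by (cases xs; cases "tl xs") (auto simp: walk_def)
  have "separates {} A B (A \<inter> B)"
    by (auto simp: separates_def walk_empty)
  then have "s \<le> card (A \<inter> B)" using empty by auto
  then obtain T where T: "T \<subseteq> A \<inter> B" "card T = s" "finite T"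
    by (meson obtain_subset_with_card_n)
  show ?case
  proof (intro exI conjI)
    show "finite ((\<lambda>v. [v]) ` T)" using T by simp
    show "card ((\<lambda>v. [v]) ` T) = s" using T by (simp add: card_image inj_on_def)
  qed (use T walk_empty in \<open>auto simp: pairwise_def\<close>)
next
  case (insert e E)
  obtain x y where e: "e = (x, y)" by (cases e)
  show ?case
  proof (cases "\<forall>X. finite X \<longrightarrow> separates E A B X \<longrightarrow> s \<le> card X")
    case True
    then obtain Q where "finite Q" "card Q = s" "\<forall>xs\<in>Q. walk E A B xs \<and> distinct xs"
        "pairwise (\<lambda>xs ys. disjnt (set xs) (set ys)) Q"
      using insert.IH[OF insert.prems(1,2)] by blast
    then show ?thesis using walk_mono[OF _ subset_insertI] by blast
  next
    case False
    then obtain X where X: "finite X" "separates E A B X" "card X < s" by force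
    have sepx: "separates (insert e E) A B (insert x X)" and sepy: "separates (insert e E) A B (insert y X)"
      using X(2) walk_insert_cases unfolding separates_def e by fast+
    have cx: "x \<notin> X" "card (insert x X) = s" and cy: "y \<notin> X" "card (insert y X) = s"
      using insert.prems(3)[OF _ sepx] insert.prems(3)[OF _ sepy] X
      by (auto simp: card_insert_if split: if_splits)
    \<comment> \<open>Cutting a walk at its first vertex in \<open>insert x X\<close> removes every
      use of \<open>(x, y)\<close>, so a set separating \<open>A\<close> from
      \<open>insert x X\<close> in \<open>E\<close> also separates \<open>A\<close> from
      \<open>B\<close> in the larger edge set.\<close>
    have 1: "s \<le> card T" if T: "finite T" "separates E A (insert x X) T" for T
    proof (rule insert.prems(3)[OF T(1)], unfold separates_def, intro allI impI)
      fix xs assume w: "walk (insert e E) A B xs"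
      then have "\<exists>v\<in>set xs. v \<in> insert x X" using sepx by (auto simp: separates_def)
      then obtain ys v zs where xs: "xs = ys @ v # zs" "v \<in> insert x X"
          "\<forall>z\<in>set ys. z \<notin> insert x X"
        by (rule split_list_first_propE) auto
      have "walk E A {v} (ys @ [v])"
        using walk_prefix w xs walk_avoid_edge_source unfolding e by fastforce
      then have "walk E A (insert x X) (ys @ [v])" using xs(2) by (auto simp: walk_def)
      then have "set (ys @ [v]) \<inter> T \<noteq> {}" using T(2) unfolding separates_def by blast
      then show "set xs \<inter> T \<noteq> {}" using xs(1) by auto
    qed
    have 2: "s \<le> card T" if T: "finite T" "separates E (insert y X) B T" for T
    proof (rule insert.prems(3)[OF T(1)], unfold separates_def, intro allI impI)
      fix xs assume w: "walk (insert e E) A B xs"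
      then have "\<exists>v\<in>set xs. v \<in> insert y X" using sepy by (auto simp: separates_def)
      then obtain ys v zs where xs: "xs = ys @ v # zs" "v \<in> insert y X"
          "\<forall>z\<in>set zs. z \<notin> insert y X"
        by (rule split_list_last_propE) auto
      have "walk E {v} B (v # zs)"
        using walk_suffix w xs walk_avoid_edge_target unfolding e by fastforce
      then have "walk E (insert y X) B (v # zs)" using xs(2) by (auto simp: walk_def)
      then have "set (v # zs) \<inter> T \<noteq> {}" using T(2) unfolding separates_def by blast
      then show "set xs \<inter> T \<noteq> {}" using xs(1) by auto
    qed
    obtain Q where Q: "finite Q" "card Q = s" "\<forall>xs\<in>Q. walk E A (insert x X) xs \<and> distinct xs"
        "pairwise (\<lambda>xs ys. disjnt (set xs) (set ys)) Q"
      using insert.IH[of A "insert x X"] insert.prems X(1) 1 by blast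
    obtain R where R: "finite R" "card R = s" "\<forall>xs\<in>R. walk E (insert y X) B xs \<and> distinct xs"
        "pairwise (\<lambda>xs ys. disjnt (set xs) (set ys)) R"
      using insert.IH[of "insert y X" B] insert.prems X(1) 2 by blast
    have "last ` Q \<subseteq> insert x X"
      using Q(3) by (auto simp: walk_def)
    moreover have "inj_on last Q"
      using Q(3,4) by (intro inj_onI) (metis disjnt_iff last_in_set pairwiseD walk_def)
    ultimately obtain f where f: "\<forall>t\<in>insert x X. f t \<in> Q \<and> last (f t) = t"
      using card_imp_labelling[of "insert x X" Q last] Q(2) cx(2) X(1) by auto
    have "hd ` R \<subseteq> insert y X"
      using R(3) by (auto simp: walk_def)
    moreover have "inj_on hd R"
      using R(3,4) by (intro inj_onI) (metis disjnt_iff hd_in_set pairwiseD walk_def)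
    ultimately obtain g where g: "\<forall>t\<in>insert y X. g t \<in> R \<and> hd (g t) = t"
      using card_imp_labelling[of "insert y X" R hd] R(2) cy(2) X(1) by auto
    have f_walk: "walk E A {t} (f t)" "distinct (f t)" "t \<in> set (f t)" "last (f t) = t"
      if "t \<in> insert x X" for t
    proof -
      have *: "f t \<in> Q" "last (f t) = t" using f that by auto
      then have "walk E A (insert x X) (f t)" "distinct (f t)" using Q(3) by auto
      then show "walk E A {t} (f t)" "distinct (f t)" "t \<in> set (f t)" "last (f t) = t"
        using * last_in_set[of "f t"] by (auto simp: walk_def)
    qed
    have g_walk: "walk E {t} B (g t)" "distinct (g t)" "t \<in> set (g t)" "hd (g t) = t"
      if "t \<in> insert y X" for t
    proof -
      have *: "g t \<in> R" "hd (g t) = t" using g that by auto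
      then have "walk E (insert y X) B (g t)" "distinct (g t)" using R(3) by auto
      then show "walk E {t} B (g t)" "distinct (g t)" "t \<in> set (g t)" "hd (g t) = t"
        using * hd_in_set[of "g t"] by (auto simp: walk_def)
    qed
    have f_disj: "disjnt (set (f t)) (set (f t'))" if "t \<in> insert x X" "t' \<in> insert x X" "t \<noteq> t'" for t t'
      using f that Q(4) f_walk(4)[of t] f_walk(4)[of t'] unfolding pairwise_def by metis
    have g_disj: "disjnt (set (g t)) (set (g t'))" if "t \<in> insert y X" "t' \<in> insert y X" "t \<noteq> t'" for t t'
      using g that R(4) g_walk(4)[of t] g_walk(4)[of t'] unfolding pairwise_def by metis
    \<comment> \<open>Switching from \<open>f t\<close> to \<open>g t'\<close> at a common vertex
      \<open>v\<close> gives a walk in \<open>E\<close> from \<open>A\<close> to \<open>B\<close>,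
      which must hit \<open>X\<close>. Each path meets \<open>X\<close> at most at its own label,
      and the pieces kept can contain that label only at \<open>v\<close>.\<close>
    have meet: "v = t \<and> v = t' \<and> v \<in> X"
      if t: "t \<in> insert x X" and t': "t' \<in> insert y X" and v: "v \<in> set (f t)" "v \<in> set (g t')" for t t' v
    proof -
      obtain as bs where as: "f t = as @ v # bs" using v(1) by (meson split_list)
      obtain cs ds where cs: "g t' = cs @ v # ds" using v(2) by (meson split_list)
      have "walk E A B (as @ v # ds)"
        using walk_glue walk_prefix walk_suffix f_walk(1)[OF t] g_walk(1)[OF t'] as cs by metis
      then obtain z where z: "z \<in> set (as @ v # ds)" "z \<in> X"
        using X(2) by (fastforce simp: separates_def)
      have "z = t" if "z \<in> set (f t)"
        using f_disj[of t z] f_walk(3)[of z] t z(2) that by (auto simp: disjnt_iff)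
      moreover have "z = t'" if "z \<in> set (g t')"
        using g_disj[of t' z] g_walk(3)[of z] t' z(2) that by (auto simp: disjnt_iff)
      moreover have "last (v # bs) = t" "hd (cs @ [v]) = t'"
        using f_walk(4)[OF t] g_walk(4)[OF t'] as cs by (auto simp: hd_append split: if_splits)
      moreover have "t \<in> set as \<Longrightarrow> False"
        using f_walk(2)[OF t] as calculation(3) by (metis disjoint_iff distinct_append last_in_set list.distinct(1))
      moreover have "t' \<in> set ds \<Longrightarrow> False"
        using g_walk(2)[OF t'] cs calculation(4) by (cases cs) auto
      ultimately have "z = v" using z(1) as cs by auto
      then have "v \<in> X" using z by simp
      then show ?thesis
        using \<open>z \<in> set (f t) \<Longrightarrow> z = t\<close> \<open>z \<in> set (g t') \<Longrightarrow> z = t'\<close> \<open>z = v\<close> v by auto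
    qed
    \<comment> \<open>The path ending in \<open>x\<close> continues over the edge
      \<open>(x, y)\<close>. For \<open>t \<in> X\<close> both halves contain \<open>t\<close>, and
      \<open>tl\<close> drops the second copy.\<close>
    define h where "h t = (if t = x then f x @ g y else f t @ tl (g t))" for t
    have g_Cons: "\<exists>ds. g t = t # ds" if "t \<in> insert y X" for t
      using g_walk(3,4)[OF that] by (cases "g t") auto
    have h_walk: "walk (insert e E) A B (h t)" if t: "t \<in> insert x X" for t
    proof (cases "t = x")
      case True
      have "walk (insert e E) A B (f x @ g y)"
        using walk_mono[OF f_walk(1)[of x]] walk_mono[OF g_walk(1)[of y]] f_walk(4)[of x] g_walk(4)[of y] e
        by (intro walk_append) blast+
      then show ?thesis using True by (simp add: h_def)
    next
      case False
      then have t: "t \<in> X" using t by auto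
      obtain as where as: "f t = as @ [t]"
        using f_walk(4)[of t] f_walk(3)[of t] t by (cases "f t" rule: rev_cases) auto
      obtain ds where ds: "g t = t # ds" using g_Cons[of t] t by auto
      have "walk E A B (as @ t # ds)"
        using walk_glue[of E A t as B ds] f_walk(1)[of t] g_walk(1)[of t] as ds t by simp
      moreover have "h t = as @ t # ds" using False as ds by (simp add: h_def)
      ultimately show ?thesis using walk_mono[OF _ subset_insertI] by simp
    qed
    have h_set: "set (h t) \<subseteq> set (f t) \<union> set (g (if t = x then y else t))" if "t \<in> insert x X" for t
      by (cases "g t") (auto simp: h_def)
    have h_distinct: "distinct (h t)" if t: "t \<in> insert x X" for t
    proof (cases "t = x")
      case True
      then show ?thesis
        using f_walk(2)[of x] g_walk(2)[of y] meet[of x y] cx by (auto simp: h_def)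
    next
      case False
      then have t': "t \<in> insert y X" using t by auto
      then obtain ds where ds: "g t = t # ds" using g_Cons by blast
      then have "v = t" if "v \<in> set (f t)" "v \<in> set ds" for v
        using meet[OF t t' that(1)] that(2) by simp
      then show ?thesis using False f_walk(2)[OF t] g_walk(2)[OF t'] ds by (auto simp: h_def)
    qed
    have h_disj: "disjnt (set (h t)) (set (h t'))" if t: "t \<in> insert x X" "t' \<in> insert x X" "t \<noteq> t'" for t t'
    proof -
      let ?m = "\<lambda>t. if t = x then y else t"
      have m: "?m t \<in> insert y X" "?m t' \<in> insert y X" "?m t \<noteq> ?m t'" using t cy by auto
      have "v \<notin> set (f t) \<or> v \<notin> set (g (?m t'))" for v
        using meet[OF t(1) m(2), of v] t(3) cy(1) by (cases "t' = x") auto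
      moreover have "v \<notin> set (f t') \<or> v \<notin> set (g (?m t))" for v
        using meet[OF t(2) m(1), of v] t(3) cy(1) by (cases "t = x") auto
      ultimately show ?thesis
        using h_set[OF t(1)] h_set[OF t(2)] f_disj[OF t] g_disj[OF m] unfolding disjnt_iff by blast
    qed
    have "inj_on h (insert x X)"
      using h_disj h_walk by (intro inj_onI) (metis disjnt_self_iff_empty set_empty walk_def)
    then show ?thesis
      using X(1) cx h_walk h_distinct h_disj
      by (intro exI[of _ "h ` insert x X"]) (auto simp: card_image pairwise_def)
  qed
qed

section \<open>From vertex expansion to \<open>k\<close>-connectivity, and from
  \<open>k\<close>-connectivity to minimum degree\<close>

definition neighbourhood :: "'v ugraph \<Rightarrow> 'v set \<Rightarrow> 'v set" where
  "neighbourhood G C = {w \<in> nodes G - C. \<exists>v\<in>C. {v, w} \<in> edges G}"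

lemma walk_subset:
  assumes "walk E A B xs" "A \<subseteq> W" "E \<subseteq> W \<times> W" shows "set xs \<subseteq> W"
proof -
  have "set xs \<subseteq> W" if "successively (\<lambda>x y. (x, y) \<in> E) xs" "xs \<noteq> []" "hd xs \<in> W"
    using that
  proof (induction xs)
    case (Cons a xs) then show ?case using assms(3) by (cases xs) auto
  qed simp
  with assms show ?thesis by (auto simp: walk_def)
qed

text \<open>Apply \<open>menger_sets\<close> to the neighbours of \<open>u\<close> and of
  \<open>v\<close> in the graph without these two nodes. A separator that is too small yields two
  disjoint sets, one around \<open>u\<close> and one around \<open>v\<close>, both with fewer than
  \<open>k\<close> neighbours; one of them has at most half of the nodes.\<close>

lemma expansion_imp_k_connected:
  fixes G :: "'v ugraph"
  assumes fin: "finite (nodes G)"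
    and expand: "\<And>C. C \<subseteq> nodes G \<Longrightarrow> C \<noteq> {} \<Longrightarrow> 2 * card C \<le> card (nodes G) \<Longrightarrow> k \<le> card (neighbourhood G C)"
  shows "k_connected k G"
  unfolding k_connected_def
proof (intro ballI impI)
  fix u v assume uv: "u \<in> nodes G" "v \<in> nodes G" "u \<noteq> v"
  define W where "W = nodes G - {u, v}"
  define E where "E = {(a, b). a \<in> W \<and> b \<in> W \<and> {a, b} \<in> edges G}"
  define A where "A = {w \<in> W. {u, w} \<in> edges G}"
  define B where "B = {w \<in> W. {v, w} \<in> edges G}"
  \<comment> \<open>The edge between \<open>u\<close> and \<open>v\<close>, if present, is a path of
    its own, so only \<open>k - d\<close> paths are required from Menger's theorem.\<close>
  define d where "d = (if {u, v} \<in> edges G then 1 else 0 :: nat)"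
  have sub: "A \<subseteq> W" "B \<subseteq> W" "E \<subseteq> W \<times> W" and finW: "finite W"
    using fin by (auto simp: A_def B_def E_def W_def)
  then have finAB: "finite A" "finite B" "finite E"
    by (meson finite_SigmaI finite_subset)+
  have sep: "k - d \<le> card X" if X: "finite X" "separates E A B X" for X
  proof (rule ccontr)
    assume "\<not> k - d \<le> card X"
    define T where "T = X \<inter> W"
    have cardT: "card T + d < k" "finite T"
      using \<open>\<not> k - d \<le> card X\<close> card_mono[OF X(1), of T] X(1) by (auto simp: T_def)
    have sepT: "set xs \<inter> T \<noteq> {}" if "walk E A B xs" for xs
      using X(2) that walk_subset[OF that sub(1,3)] by (auto simp: separates_def T_def)
    define R where "R = insert u {w. \<exists>xs. walk E A {w} xs \<and> set xs \<inter> T = {}}"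
    define R' where "R' = nodes G - R - T"
    have "w \<in> W" if "walk E A {w} xs" for w xs
      using walk_subset[OF that sub(1,3)] that last_in_set[of xs] by (auto simp: walk_def)
    then have R_sub: "R \<subseteq> insert u W" by (auto simp: R_def)
    \<comment> \<open>Outside \<open>T\<close>, no edge leaves \<open>R\<close> except possibly
      \<open>{u, v}\<close>. Hence \<open>R\<close> and its complement \<open>R'\<close> both have
      at most \<open>card T + d\<close> neighbours.\<close>
    have R_step: "b = v \<and> a = u" if a: "a \<in> R" and b: "b \<in> nodes G" "b \<notin> R" "b \<notin> T" "{a, b} \<in> edges G" for a b
    proof (cases "a = u")
      case True
      have "b \<in> R" if "b \<in> A"
        using b(3) that by (auto simp: R_def walk_def intro!: exI[of _ "[b]"])
      then have "b \<notin> A" using b by blast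
      moreover have "b \<noteq> u" using b by (auto simp: R_def)
      ultimately have "b = v" using b True by (auto simp: A_def W_def)
      with True show ?thesis by simp
    next
      case False
      then obtain xs where xs: "walk E A {a} xs" "set xs \<inter> T = {}" using a by (auto simp: R_def)
      have "a \<in> W" using R_sub a False by auto
      have "a \<notin> B" using sepT[of xs] xs by (auto simp: walk_def)
      then have "b \<noteq> v" using b \<open>a \<in> W\<close> by (auto simp: B_def insert_commute)
      moreover have "b \<noteq> u" using b by (auto simp: R_def)
      ultimately have "(a, b) \<in> E" using b \<open>a \<in> W\<close> by (auto simp: E_def W_def)
      then have "walk E A {b} (xs @ [b])" using xs by (auto simp: walk_def successively_append_iff)
      then have "b \<in> R" using xs b by (auto simp: R_def intro!: exI[of _ "xs @ [b]"])
      then show ?thesis using b by blast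
    qed
    have "neighbourhood G R \<subseteq> T \<union> (if {u, v} \<in> edges G then {v} else {})"
    proof
      fix b assume "b \<in> neighbourhood G R"
      then obtain a where "a \<in> R" "b \<in> nodes G" "b \<notin> R" "{a, b} \<in> edges G"
        by (auto simp: neighbourhood_def)
      then show "b \<in> T \<union> (if {u, v} \<in> edges G then {v} else {})"
        using R_step[of a b] by auto
    qed
    then have "card (neighbourhood G R) \<le> card (T \<union> (if {u, v} \<in> edges G then {v} else {}))"
      using cardT(2) by (intro card_mono) auto
    also have "\<dots> \<le> card T + d"
      by (rule order.trans[OF card_Un_le]) (auto simp: d_def)
    finally have small: "card (neighbourhood G R) < k" using cardT by simp
    have "neighbourhood G R' \<subseteq> T \<union> (if {u, v} \<in> edges G then {u} else {})"
    proof
      fix b assume "b \<in> neighbourhood G R'"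
      then obtain a where "a \<in> R'" "b \<in> nodes G" "b \<notin> R'" "{a, b} \<in> edges G"
        by (auto simp: neighbourhood_def)
      then show "b \<in> T \<union> (if {u, v} \<in> edges G then {u} else {})"
        using R_step[of b a] by (auto simp: R'_def insert_commute)
    qed
    then have "card (neighbourhood G R') \<le> card (T \<union> (if {u, v} \<in> edges G then {u} else {}))"
      using cardT(2) by (intro card_mono) auto
    also have "\<dots> \<le> card T + d"
      by (rule order.trans[OF card_Un_le]) (auto simp: d_def)
    finally have small': "card (neighbourhood G R') < k" using cardT by simp
    have "u \<in> R" "v \<in> R'" "R \<subseteq> nodes G" "R' \<subseteq> nodes G"
      using R_sub uv by (auto simp: R_def R'_def T_def W_def)
    moreover have "card R + card R' \<le> card (nodes G)"
      using \<open>R \<subseteq> nodes G\<close> \<open>R' \<subseteq> nodes G\<close> fin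
      by (subst card_Un_disjoint[symmetric]) (auto simp: R'_def intro: finite_subset intro!: card_mono)
    ultimately show False
      using expand[of R] expand[of R'] small small' by (cases "2 * card R \<le> card (nodes G)") auto
  qed
  obtain Q where Q: "finite Q" "card Q = k - d" "\<forall>xs\<in>Q. walk E A B xs \<and> distinct xs"
      "pairwise (\<lambda>xs ys. disjnt (set xs) (set ys)) Q"
    using menger_sets[OF finAB(3,1,2) sep] by blast
  define Q1 where "Q1 = (\<lambda>xs. u # xs @ [v]) ` Q"
  define Q2 where "Q2 = (if {u, v} \<in> edges G then {[u, v]} else {})"
  have QW: "set xs \<subseteq> W" if "xs \<in> Q" for xs
    using walk_subset[OF _ sub(1,3)] Q(3) that by blast
  have path1: "path_between G u v (u # xs @ [v])" if "xs \<in> Q" for xs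
  proof -
    have w: "walk E A B xs" "distinct xs" using Q(3) that by auto
    have "successively (\<lambda>a b. {a, b} \<in> edges G) (u # xs @ [v])"
      using w(1) by (auto simp: walk_def successively_Cons successively_append_iff A_def B_def E_def
          insert_commute elim: successively_mono)
    then show ?thesis
      using w(2) QW[OF that] uv
      unfolding path_between_def successively_conv_nth by (auto simp: W_def)
  qed
  have "pairwise (internally_disjoint u v) (Q1 \<union> Q2)"
    using Q(4) QW by (fastforce simp: pairwise_def internally_disjoint_def Q1_def Q2_def disjnt_iff W_def)
  moreover have "path_between G u v xs" if "xs \<in> Q1 \<union> Q2" for xs
  proof (cases "xs \<in> Q1")
    case True
    then show ?thesis using path1 by (auto simp: Q1_def)
  next
    case False
    then show ?thesis using that uv by (auto simp: Q2_def path_between_def split: if_splits)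
  qed
  moreover have "k \<le> card (Q1 \<union> Q2)"
  proof -
    have "Q1 \<inter> Q2 = {}" using Q(3) by (auto simp: Q1_def Q2_def walk_def split: if_splits)
    then have "card (Q1 \<union> Q2) = card Q1 + card Q2"
      using Q(1) by (intro card_Un_disjoint) (auto simp: Q1_def Q2_def)
    also have "card Q1 = k - d" using Q(2) by (auto simp: Q1_def card_image inj_on_def)
    also have "card Q2 = d" by (simp add: Q2_def d_def)
    finally show ?thesis by simp
  qed
  moreover have "finite (Q1 \<union> Q2)" using Q(1) by (simp add: Q1_def Q2_def)
  ultimately show "\<exists>Q. finite Q \<and> k \<le> card Q \<and> (\<forall>xs\<in>Q. path_between G u v xs) \<and>
      pairwise (internally_disjoint u v) Q" by blast
qed

text \<open>Internally disjoint paths leave \<open>u\<close> through different second vertices. At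
  least two nodes are needed for some path to start at \<open>u\<close>.\<close>

lemma k_connected_imp_min_node_degree:
  assumes fin: "finite (nodes G)" and two: "2 \<le> card (nodes G)" and con: "k_connected k G"
  shows "k \<le> min_node_degree G"
proof -
  have "k \<le> node_degree G u" if u: "u \<in> nodes G" for u
  proof -
    have "nodes G \<noteq> {u}" using two by auto
    then obtain v where v: "v \<in> nodes G" "u \<noteq> v" using u by auto
    then obtain Q where Q: "finite Q" "k \<le> card Q" "\<forall>xs\<in>Q. path_between G u v xs"
        "pairwise (internally_disjoint u v) Q"
      using con u unfolding k_connected_def by meson
    \<comment> \<open>The last conjunct handles the second vertex \<open>v\<close>, which
      disjointness ignores: two paths that go directly to \<open>v\<close> are the same
      path.\<close>
    have shape: "\<exists>w xs'. xs = u # w # xs' \<and> w \<in> nodes G \<and> w \<noteq> u \<and> {u, w} \<in> edges G \<and> (w = v \<longrightarrow> xs' = [])"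
      if "xs \<in> Q" for xs
    proof -
      have p: "path_between G u v xs" using Q(3) that by auto
      then obtain xs1 where 1: "xs = u # xs1" by (cases xs) (auto simp: path_between_def)
      obtain w xs' where 2: "xs1 = w # xs'" using p v 1 by (cases xs1) (auto simp: path_between_def)
      have "{xs ! 0, xs ! Suc 0} \<in> edges G" using p 1 2 unfolding path_between_def by auto
      then have "{u, w} \<in> edges G" using 1 2 by simp
      then show ?thesis using p v 1 2 last_in_set[of xs']
        by (intro exI[of _ w] exI[of _ xs']) (auto simp: path_between_def split: if_splits)
    qed
    have "inj_on (\<lambda>xs. xs ! 1) Q"
    proof (rule inj_onI, rule ccontr)
      fix xs ys assume xy: "xs \<in> Q" "ys \<in> Q" "xs ! 1 = ys ! 1" "xs \<noteq> ys"
      then have "disjnt (set xs - {u, v}) (set ys - {u, v})"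
        using Q(4) by (auto simp: pairwise_def internally_disjoint_def)
      then show False using shape[OF xy(1)] shape[OF xy(2)] xy(3,4) by (auto simp: disjnt_iff)
    qed
    then have "card Q = card ((\<lambda>xs. xs ! 1) ` Q)" by (simp add: card_image)
    also have "\<dots> \<le> node_degree G u"
      unfolding node_degree_def
    proof (intro card_mono)
      show "(\<lambda>xs. xs ! 1) ` Q \<subseteq> {w \<in> nodes G. w \<noteq> u \<and> {u, w} \<in> edges G}"
        by (auto dest!: shape)
    qed (use fin in simp)
    finally show ?thesis using Q(2) by simp
  qed
  then show ?thesis
    using fin two unfolding min_node_degree_def by (subst Min_ge_iff) auto
qed

section \<open>Products of Bernoulli variables\<close>

lemma measure_pmf_prob_cong:
  assumes "\<And>x. x \<in> set_pmf M \<Longrightarrow> P x \<longleftrightarrow> Q x"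
  shows "measure_pmf.prob M {x. P x} = measure_pmf.prob M {x. Q x}"
  by (rule measure_eq_AE) (use assms in \<open>auto simp: AE_measure_pmf_iff\<close>)

lemma measure_pmf_prob_mono:
  assumes "\<And>x. x \<in> set_pmf M \<Longrightarrow> P x \<Longrightarrow> Q x"
  shows "measure_pmf.prob M {x. P x} \<le> measure_pmf.prob M {x. Q x}"
  by (rule measure_pmf.finite_measure_mono_AE) (use assms in \<open>auto simp: AE_measure_pmf_iff\<close>)

lemma measure_pmf_prob_le_sum:
  assumes "finite I" "\<And>x. x \<in> set_pmf M \<Longrightarrow> P x \<Longrightarrow> \<exists>i\<in>I. Q i x"
  shows "measure_pmf.prob M {x. P x} \<le> (\<Sum>i\<in>I. measure_pmf.prob M {x. Q i x})"
proof -
  have "measure_pmf.prob M {x. P x} \<le> measure_pmf.prob M {x. \<exists>i\<in>I. Q i x}"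
    by (rule measure_pmf_prob_mono) (use assms in auto)
  also have "{x. \<exists>i\<in>I. Q i x} = (\<Union>i\<in>I. {x. Q i x})" by auto
  also have "measure_pmf.prob M \<dots> \<le> (\<Sum>i\<in>I. measure_pmf.prob M {x. Q i x})"
    by (rule measure_pmf.finite_measure_subadditive_finite) (use assms in auto)
  finally show ?thesis .
qed

lemma measure_pmf_prob_le_add:
  assumes "\<And>x. x \<in> set_pmf M \<Longrightarrow> P x \<Longrightarrow> Q x \<or> R x"
  shows "measure_pmf.prob M {x. P x} \<le> measure_pmf.prob M {x. Q x} + measure_pmf.prob M {x. R x}"
proof -
  have "measure_pmf.prob M {x. P x} \<le> measure_pmf.prob M {x. Q x \<or> R x}"
    by (rule measure_pmf_prob_mono) (use assms in auto)
  also have "{x. Q x \<or> R x} = {x. Q x} \<union> {x. R x}" by auto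
  also have "measure_pmf.prob M \<dots> \<le> measure_pmf.prob M {x. Q x} + measure_pmf.prob M {x. R x}"
    by (rule measure_Un_le) auto
  finally show ?thesis .
qed

text \<open>A pointwise substitute for measurability with respect to the coordinates in
  \<open>I\<close>.\<close>

definition depends_on :: "'a set \<Rightarrow> (('a \<Rightarrow> 'b) \<Rightarrow> bool) \<Rightarrow> bool" where
  "depends_on I P \<longleftrightarrow> (\<forall>f g. (\<forall>x\<in>I. f x = g x) \<longrightarrow> P f = P g)"

lemma depends_on_conj: "depends_on I P \<Longrightarrow> depends_on I Q \<Longrightarrow> depends_on I (\<lambda>f. P f \<and> Q f)"
  and depends_on_not: "depends_on I P \<Longrightarrow> depends_on I (\<lambda>f. \<not> P f)"
  unfolding depends_on_def by blast+

lemma prob_Pi_pmf_subset: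
  assumes "finite J" "I \<subseteq> J" "depends_on I P"
  shows "measure_pmf.prob (Pi_pmf I d q) {f. P f} = measure_pmf.prob (Pi_pmf J d q) {f. P f}"
proof -
  have "P (\<lambda>x. if x \<in> I then f x else d) = P f" for f
    using assms(3) unfolding depends_on_def by simp
  then show ?thesis
    by (subst Pi_pmf_subset[OF assms(1,2)]) (simp add: vimage_def)
qed

lemma emeasure_Pi_pmf_Un:
  assumes "finite I" "finite J" "I \<inter> J = {}"
  shows "emeasure (Pi_pmf (I \<union> J) d q) {h. P h} =
    (\<integral>\<^sup>+f. emeasure (Pi_pmf J d q) {g. P (\<lambda>x. if x \<in> I then f x else g x)} \<partial>Pi_pmf I d q)"
proof -
  have "emeasure (Pi_pmf (I \<union> J) d q) {h. P h} = (\<integral>\<^sup>+h. indicator {h. P h} h \<partial>Pi_pmf (I \<union> J) d q)"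
    by simp
  also have "\<dots> = (\<integral>\<^sup>+f. \<integral>\<^sup>+g. indicator {g. P (\<lambda>x. if x \<in> I then f x else g x)} g
      \<partial>Pi_pmf J d q \<partial>Pi_pmf I d q)"
    by (simp only: Pi_pmf_union[OF assms] nn_integral_map_pmf nn_integral_pair_pmf') (simp add: indicator_def)
  finally show ?thesis by simp
qed

text \<open>Fubini as a conditional estimate: reveal the coordinates in \<open>I\<close> and bound
  the probability of \<open>R\<close> uniformly over the outcomes that satisfy \<open>Q\<close>. The
  revealing arguments below use this bound or its counterpart
  \<open>prob_Pi_pmf_Un_ge\<close>.\<close>

lemma prob_Pi_pmf_Un_le:
  assumes "finite I" "finite J" "I \<inter> J = {}" "depends_on I Q" "0 \<le> c"
    and "\<And>f. f \<in> set_pmf (Pi_pmf I d q) \<Longrightarrow> Q f \<Longrightarrow>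
      measure_pmf.prob (Pi_pmf J d q) {g. R (\<lambda>x. if x \<in> I then f x else g x)} \<le> c"
  shows "measure_pmf.prob (Pi_pmf (I \<union> J) d q) {h. Q h \<and> R h} \<le>
    measure_pmf.prob (Pi_pmf (I \<union> J) d q) {h. Q h} * c"
proof -
  have Q: "Q (\<lambda>x. if x \<in> I then f x else g x) = Q f" for f g
    using assms(4) unfolding depends_on_def by simp
  have "emeasure (Pi_pmf (I \<union> J) d q) {h. Q h \<and> R h} \<le> (\<integral>\<^sup>+f. ennreal c * indicator {f. Q f} f \<partial>Pi_pmf I d q)"
    unfolding emeasure_Pi_pmf_Un[OF assms(1-3)] Q
    by (intro nn_integral_mono_AE AE_pmfI)
       (use assms(5,6) in \<open>auto simp: measure_pmf.emeasure_eq_measure indicator_def\<close>)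
  also have "\<dots> = ennreal (c * measure_pmf.prob (Pi_pmf I d q) {f. Q f})"
    using assms(5) by (simp add: nn_integral_cmult measure_pmf.emeasure_eq_measure ennreal_mult)
  finally show ?thesis
    using assms(5) prob_Pi_pmf_subset[OF _ _ assms(4), of "I \<union> J" d q] assms(1,2)
    by (simp add: measure_pmf.emeasure_eq_measure mult.commute)
qed

lemma prob_Pi_pmf_Un_ge:
  assumes "finite I" "finite J" "I \<inter> J = {}" "depends_on I Q" "0 \<le> c"
    and "\<And>f. f \<in> set_pmf (Pi_pmf I d q) \<Longrightarrow> Q f \<Longrightarrow>
      c \<le> measure_pmf.prob (Pi_pmf J d q) {g. R (\<lambda>x. if x \<in> I then f x else g x)}"
  shows "measure_pmf.prob (Pi_pmf (I \<union> J) d q) {h. Q h} * c \<le>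
    measure_pmf.prob (Pi_pmf (I \<union> J) d q) {h. Q h \<and> R h}"
proof -
  have Q: "Q (\<lambda>x. if x \<in> I then f x else g x) = Q f" for f g
    using assms(4) unfolding depends_on_def by simp
  have "ennreal (c * measure_pmf.prob (Pi_pmf I d q) {f. Q f}) = (\<integral>\<^sup>+f. ennreal c * indicator {f. Q f} f \<partial>Pi_pmf I d q)"
    using assms(5) by (simp add: nn_integral_cmult measure_pmf.emeasure_eq_measure ennreal_mult)
  also have "\<dots> \<le> emeasure (Pi_pmf (I \<union> J) d q) {h. Q h \<and> R h}"
    unfolding emeasure_Pi_pmf_Un[OF assms(1-3)] Q
    by (intro nn_integral_mono_AE AE_pmfI)
       (use assms(5,6) in \<open>auto simp: measure_pmf.emeasure_eq_measure indicator_def\<close>)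
  finally show ?thesis
    using assms(5) prob_Pi_pmf_subset[OF _ _ assms(4), of "I \<union> J" d q] assms(1,2)
    by (simp add: measure_pmf.emeasure_eq_measure mult.commute)
qed

text \<open>The conditional probability of \<open>R\<close> is the same for every revealed outcome,
  so the upper and the lower conditional estimate meet.\<close>

lemma prob_Pi_pmf_conj:
  assumes "finite I" "finite J" "I \<inter> J = {}" "depends_on I Q" "depends_on J R"
  shows "measure_pmf.prob (Pi_pmf (I \<union> J) d q) {h. Q h \<and> R h} =
    measure_pmf.prob (Pi_pmf (I \<union> J) d q) {h. Q h} * measure_pmf.prob (Pi_pmf (I \<union> J) d q) {h. R h}"
proof -
  have "R (\<lambda>x. if x \<in> I then f x else g x) = R g" for f g
    using assms(3) by (intro assms(5)[unfolded depends_on_def, rule_format]) auto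
  then have "measure_pmf.prob (Pi_pmf J d q) {g. R (\<lambda>x. if x \<in> I then f x else g x)} =
      measure_pmf.prob (Pi_pmf (I \<union> J) d q) {h. R h}" for f
    using prob_Pi_pmf_subset[OF _ _ assms(5), of "I \<union> J" d q] assms(1,2) by simp
  then show ?thesis
    using prob_Pi_pmf_Un_le[OF assms(1-4), of "measure_pmf.prob (Pi_pmf (I \<union> J) d q) {h. R h}" d q R]
      prob_Pi_pmf_Un_ge[OF assms(1-4), of "measure_pmf.prob (Pi_pmf (I \<union> J) d q) {h. R h}" d q R]
    by (intro antisym) auto
qed

lemma prob_Pi_pmf_blocks:
  assumes "finite I" "finite A" "disjoint_family_on B A" "\<And>i. i \<in> A \<Longrightarrow> B i \<subseteq> I"
    and "\<And>i. i \<in> A \<Longrightarrow> depends_on (B i) (Q i)"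
  shows "measure_pmf.prob (Pi_pmf I d q) {h. \<forall>i\<in>A. Q i h} =
    (\<Prod>i\<in>A. measure_pmf.prob (Pi_pmf I d q) {h. Q i h})"
  using assms(2-)
proof (induction A rule: finite_induct)
  case (insert i A)
  have "disjoint_family_on B A" using insert.prems(1) by (auto simp: disjoint_family_on_def)
  have "depends_on (I - B i) (\<lambda>h. \<forall>j\<in>A. Q j h)"
    unfolding depends_on_def
  proof (intro allI impI ball_cong refl)
    fix f g :: "'a \<Rightarrow> 'c" and j assume fg: "\<forall>x\<in>I - B i. f x = g x" "j \<in> A"
    have "B j \<subseteq> I - B i" using insert fg(2) by (fastforce simp: disjoint_family_on_def)
    then show "Q j f = Q j g" using fg insert.prems(3)[of j] unfolding depends_on_def by blast
  qed
  moreover have "B i \<union> (I - B i) = I" "finite (B i)" using insert.prems(2)[of i] assms(1) finite_subset by auto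
  ultimately have "measure_pmf.prob (Pi_pmf I d q) {h. Q i h \<and> (\<forall>j\<in>A. Q j h)} =
      measure_pmf.prob (Pi_pmf I d q) {h. Q i h} * measure_pmf.prob (Pi_pmf I d q) {h. \<forall>j\<in>A. Q j h}"
    using prob_Pi_pmf_conj[of "B i" "I - B i" "Q i" "\<lambda>h. \<forall>j\<in>A. Q j h" d q] insert.prems(3)[of i] assms(1) by auto
  then show ?case
    using insert \<open>disjoint_family_on B A\<close> by simp
qed simp

text \<open>Links the sampling of one object set per node with a single product over all node-object
  pairs.\<close>

lemma map_curry_Pi_pmf:
  assumes "finite U" "finite W"
  shows "map_pmf curry (Pi_pmf (U \<times> W) d q) = Pi_pmf U (\<lambda>_. d) (\<lambda>u. Pi_pmf W d (\<lambda>w. q (u, w)))"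
proof (rule pmf_eqI)
  fix h :: "'a \<Rightarrow> 'b \<Rightarrow> 'c"
  have "inj (curry :: ('a \<times> 'b \<Rightarrow> 'c) \<Rightarrow> _)" by (rule inj_on_inverseI[of _ case_prod]) simp
  from pmf_map_inj'[OF this, of _ "case_prod h"]
  have "pmf (map_pmf curry (Pi_pmf (U \<times> W) d q)) h = pmf (Pi_pmf (U \<times> W) d q) (case_prod h)"
    by simp
  also have "\<dots> = pmf (Pi_pmf U (\<lambda>_. d) (\<lambda>u. Pi_pmf W d (\<lambda>w. q (u, w)))) h"
  proof (cases "\<forall>u w. (u, w) \<notin> U \<times> W \<longrightarrow> h u w = d")
    case True
    then show ?thesis using assms
      by (subst (1 2) pmf_Pi') (auto simp: fun_eq_iff pmf_Pi' prod.cartesian_product intro!: prod.cong)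
  next
    case False
    then obtain u w where uw: "(u, w) \<notin> U \<times> W" "h u w \<noteq> d" by auto
    then have "pmf (Pi_pmf (U \<times> W) d q) (case_prod h) = 0"
      using assms by (intro pmf_Pi_outside) (auto intro!: exI[of _ u] exI[of _ w])
    moreover have "pmf (Pi_pmf U (\<lambda>_. d) (\<lambda>u. Pi_pmf W d (\<lambda>w. q (u, w)))) h = 0"
    proof (cases "u \<in> U")
      case True
      then have "pmf (Pi_pmf W d (\<lambda>w. q (u, w))) (h u) = 0"
        using uw assms by (intro pmf_Pi_outside) auto
      then have "(\<Prod>u\<in>U. pmf (Pi_pmf W d (\<lambda>w. q (u, w))) (h u)) = 0"
        using True assms(1) by (intro prod_zero) auto
      then show ?thesis using assms(1) by (subst pmf_Pi) auto
    next
      case False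
      then show ?thesis using uw assms by (intro pmf_Pi_outside) (auto simp: fun_eq_iff intro!: exI[of _ u])
    qed
    ultimately show ?thesis by simp
  qed
  finally show "pmf (map_pmf curry (Pi_pmf (U \<times> W) d q)) h =
    pmf (Pi_pmf U (\<lambda>_. d) (\<lambda>u. Pi_pmf W d (\<lambda>w. q (u, w)))) h" .
qed

lemma map_Bex_Pi_pmf_bernoulli:
  assumes "finite W" "p \<in> {0..1}"
  shows "map_pmf (\<lambda>r. \<exists>w\<in>W. r w) (Pi_pmf W False (\<lambda>_. bernoulli_pmf p)) =
    bernoulli_pmf (1 - (1 - p) ^ card W)"
proof -
  let ?M = "map_pmf (\<lambda>r. \<exists>w\<in>W. r w) (Pi_pmf W False (\<lambda>_. bernoulli_pmf p))"
  have "pmf ?M False = measure_pmf.prob (Pi_pmf W False (\<lambda>_. bernoulli_pmf p)) (Pi W (\<lambda>_. {False}))"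
    by (auto simp: pmf_map vimage_def Pi_def intro!: arg_cong[of _ _ "measure_pmf.prob _"])
  also have "\<dots> = (1 - p) ^ card W"
    using assms by (subst measure_Pi_pmf_Pi) (auto simp: measure_pmf_single)
  finally have F: "pmf ?M False = (1 - p) ^ card W" .
  have "sum (pmf ?M) UNIV = 1"
    by (rule sum_pmf_eq_1) auto
  then have "pmf ?M True + pmf ?M False = 1"
    by (simp add: UNIV_bool add.commute)
  moreover have "0 \<le> (1 - p) ^ card W" "(1 - p) ^ card W \<le> 1"
    using assms by (auto intro: power_le_one)
  ultimately show ?thesis
    using F by (intro pmf_eqI) (case_tac i; simp)
qed

text \<open>By \<open>map_curry_Pi_pmf\<close> the rows are independent, and each meets
  \<open>W\<close> with the probability given by \<open>map_Bex_Pi_pmf_bernoulli\<close>.\<close>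

lemma binomial_eq_count_rows:
  assumes "finite I" "U \<times> W \<subseteq> I" "finite U" "finite W" "p \<in> {0..1}"
  shows "map_pmf (\<lambda>f. card {u \<in> U. \<exists>w\<in>W. f (u, w)}) (Pi_pmf I False (\<lambda>_. bernoulli_pmf p)) =
    binomial_pmf (card U) (1 - (1 - p) ^ card W)"
proof -
  have *: "1 - (1 - p) ^ card W \<in> {0..1}" using assms(5) by (auto intro: power_le_one)
  have "binomial_pmf (card U) (1 - (1 - p) ^ card W) =
      map_pmf (\<lambda>f. card {u \<in> U. f u}) (Pi_pmf U False (\<lambda>_. bernoulli_pmf (1 - (1 - p) ^ card W)))"
    by (rule binomial_pmf_altdef') (use assms * in auto)
  also have "Pi_pmf U False (\<lambda>_. bernoulli_pmf (1 - (1 - p) ^ card W)) =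
      map_pmf (\<lambda>h. (\<lambda>r. \<exists>w\<in>W. r w) \<circ> h) (Pi_pmf U (\<lambda>_. False) (\<lambda>_. Pi_pmf W False (\<lambda>_. bernoulli_pmf p)))"
    unfolding map_Bex_Pi_pmf_bernoulli[OF assms(4,5), symmetric]
    using assms(3) by (subst Pi_pmf_map[where dflt = "\<lambda>_. False"]) auto
  also have "Pi_pmf U (\<lambda>_. False) (\<lambda>_. Pi_pmf W False (\<lambda>_. bernoulli_pmf p)) =
      map_pmf curry (Pi_pmf (U \<times> W) False (\<lambda>_. bernoulli_pmf p))"
    by (subst map_curry_Pi_pmf) (use assms in auto)
  also have "Pi_pmf (U \<times> W) False (\<lambda>_. bernoulli_pmf p) =
      map_pmf (\<lambda>f x. if x \<in> U \<times> W then f x else False) (Pi_pmf I False (\<lambda>_. bernoulli_pmf p))"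
    by (rule Pi_pmf_subset) (use assms in auto)
  finally show ?thesis
    by (simp add: map_pmf_comp o_def) (auto intro!: map_pmf_cong arg_cong[of _ _ card])
qed

text \<open>Transposition reduces this to rows. Rows will count the outer neighbours of a set,
  columns the size of a union of object sets.\<close>

lemma binomial_eq_count_columns:
  assumes "finite I" "U \<times> W \<subseteq> I" "finite U" "finite W" "p \<in> {0..1}"
  shows "map_pmf (\<lambda>f. card {w \<in> W. \<exists>u\<in>U. f (u, w)}) (Pi_pmf I False (\<lambda>_. bernoulli_pmf p)) =
    binomial_pmf (card W) (1 - (1 - p) ^ card U)"
proof -
  have "Pi_pmf (prod.swap ` I) False (\<lambda>_. bernoulli_pmf p) =
      map_pmf (\<lambda>g. g \<circ> prod.swap) (Pi_pmf I False (\<lambda>_. bernoulli_pmf p))"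
    by (rule Pi_pmf_bij_betw) (use assms in \<open>auto intro!: bij_betwI[of _ _ _ prod.swap]\<close>)
  moreover have "map_pmf (\<lambda>f. card {w \<in> W. \<exists>u\<in>U. f (w, u)}) (Pi_pmf (prod.swap ` I) False (\<lambda>_. bernoulli_pmf p)) =
      binomial_pmf (card W) (1 - (1 - p) ^ card U)"
  proof (rule binomial_eq_count_rows)
    show "W \<times> U \<subseteq> prod.swap ` I"
      unfolding product_swap[of U W, symmetric] using assms(2) by (rule image_mono)
  qed (use assms in auto)
  ultimately show ?thesis by (simp add: map_pmf_comp)
qed

text \<open>The probability that at most \<open>m\<close> out of \<open>N\<close> nodes meet a given set of \<open>w\<close> objects.\<close>

definition low_count :: "nat \<Rightarrow> real \<Rightarrow> nat \<Rightarrow> nat \<Rightarrow> real" where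
  "low_count N p w m = measure_pmf.prob (binomial_pmf N (1 - (1 - p) ^ w)) {..m}"

lemma low_count_eq:
  assumes "finite I" "U \<times> W \<subseteq> I" "finite U" "finite W" "p \<in> {0..1}"
  shows "measure_pmf.prob (Pi_pmf I False (\<lambda>_. bernoulli_pmf p)) {f. card {u \<in> U. \<exists>w\<in>W. f (u, w)} \<le> m} =
    low_count (card U) p (card W) m"
  unfolding low_count_def binomial_eq_count_rows[OF assms, symmetric]
  by (simp add: vimage_def)

text \<open>Coupling: both counts are read off the same \<open>N\<close> by \<open>w'\<close>
  matrix, one of them from the first \<open>w\<close> columns only.\<close>

lemma low_count_antimono:
  assumes "w \<le> w'" "p \<in> {0..1}"
  shows "low_count N p w' m \<le> low_count N p w m"
proof -
  have "low_count N p v m = measure_pmf.prob (Pi_pmf ({..<N} \<times> {..<w'}) False (\<lambda>_. bernoulli_pmf p))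
      {f. card {u \<in> {..<N}. \<exists>w\<in>{..<v}. f (u, w)} \<le> m}" if "v \<le> w'" for v
    using that assms by (subst low_count_eq) auto
  note * = this[OF assms(1)] this[OF order.refl]
  have "card {u \<in> {..<N}. \<exists>x\<in>{..<w}. f (u, x)} \<le> card {u \<in> {..<N}. \<exists>x\<in>{..<w'}. f (u, x)}" for f
    using assms(1) by (intro card_mono) auto
  then show ?thesis
    unfolding * by (intro measure_pmf_prob_mono) (meson order.trans)
qed

lemma low_count_nonneg: "0 \<le> low_count N p w m"
  by (simp add: low_count_def)

section \<open>Binomial tails\<close>

lemma exp_minus_le: "exp (- x) \<le> 1 - x + x\<^sup>2" if "0 \<le> x" for x :: real
proof -
  have "exp (- x) \<le> 1 / (1 + x)"
    using exp_ge_add_one_self[of x] that by (simp add: exp_minus field_simps)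
  also have "\<dots> \<le> 1 - x + x\<^sup>2"
    using that by (simp add: field_simps power2_eq_square)
  finally show ?thesis .
qed

lemma one_minus_power_le_exp: "(1 - p) ^ r \<le> exp (- (real r * p))" if "p \<in> {0..1}" for p :: real
proof -
  have "(1 - p) ^ r \<le> exp (- p) ^ r"
    using that exp_ge_add_one_self[of "- p"] by (intro power_mono) auto
  then show ?thesis by (simp add: exp_of_nat_mult[symmetric])
qed

text \<open>Markov's inequality for \<open>exp (s x)\<close>. The event keeps the factor
  \<open>s\<close> on both sides, so that positive \<open>s\<close> gives the upper and negative
  \<open>s\<close> the lower tail.\<close>

lemma binomial_chernoff:
  assumes "\<rho> \<in> {0..1}"
  shows "measure_pmf.prob (binomial_pmf n \<rho>) {x. s * y \<le> s * real x} \<le>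
    exp (real n * \<rho> * (exp s - 1) - s * y)"
proof -
  have "measure_pmf.prob (binomial_pmf n \<rho>) {x. s * y \<le> s * real x} =
      measure_pmf.expectation (binomial_pmf n \<rho>) (indicator {x. s * y \<le> s * real x})"
    by simp
  also have "\<dots> \<le> measure_pmf.expectation (binomial_pmf n \<rho>) (\<lambda>x. exp s ^ x * exp (- (s * y)))"
    using assms by (intro integral_mono)
      (auto simp: indicator_def exp_of_nat_mult[symmetric] exp_add[symmetric] mult.commute)
  also have "\<dots> = (\<Sum>k\<le>n. (real (n choose k) * (\<rho> * exp s) ^ k * (1 - \<rho>) ^ (n - k))) * exp (- (s * y))"
    using assms by (simp add: expectation_binomial_pmf' sum_distrib_right power_mult_distrib ac_simps)
  also have "(\<Sum>k\<le>n. (real (n choose k) * (\<rho> * exp s) ^ k * (1 - \<rho>) ^ (n - k))) = (\<rho> * exp s + (1 - \<rho>)) ^ n"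
    by (rule binomial_ring[symmetric])
  also have "\<dots> \<le> exp (\<rho> * (exp s - 1)) ^ n"
  proof (intro power_mono)
    show "\<rho> * exp s + (1 - \<rho>) \<le> exp (\<rho> * (exp s - 1))"
      using exp_ge_add_one_self[of "\<rho> * (exp s - 1)"] by (simp add: algebra_simps)
  qed (use assms in auto)
  also have "\<dots> = exp (real n * \<rho> * (exp s - 1))"
    by (simp add: exp_of_nat_mult[symmetric] mult.assoc)
  finally have "measure_pmf.prob (binomial_pmf n \<rho>) {x. s * y \<le> s * real x} \<le>
      exp (real n * \<rho> * (exp s - 1)) * exp (- (s * y))"
    by simp
  then show ?thesis
    by (simp only: diff_conv_add_uminus exp_add)
qed

text \<open>The success probability is that of an object being held by one of \<open>r\<close>
  nodes. Of the three multiples of \<open>\<epsilon>\<close>, one pays for overlaps among the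
  \<open>r\<close> object sets, one for the quadratic term of \<open>exp (- \<epsilon>)\<close>, and
  one remains as the gain in the exponent.\<close>

lemma binomial_lower_tail:
  assumes p: "p \<in> {0..1}" and e: "0 < \<epsilon>" "\<epsilon> \<le> 1" and r: "real r * p \<le> \<epsilon>"
  shows "measure_pmf.prob (binomial_pmf n (1 - (1 - p) ^ r)) {x. real x < (1 - 3 * \<epsilon>) * (real r * p * real n)} \<le>
    exp (- (\<epsilon>\<^sup>2 * (real r * p * real n)))"
proof -
  define \<rho> where "\<rho> = 1 - (1 - p) ^ r"
  define x where "x = real r * p"
  have \<rho>: "\<rho> \<in> {0..1}" using p by (auto simp: \<rho>_def power_le_one)
  have x: "0 \<le> x" "x \<le> \<epsilon>" using p r by (auto simp: x_def)
  have "\<rho> \<ge> x - x\<^sup>2"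
    using one_minus_power_le_exp[OF p, of r] exp_minus_le[of x] x by (simp add: \<rho>_def x_def)
  moreover have "x * x \<le> x * \<epsilon>" using x by (intro mult_left_mono) auto
  ultimately have \<rho>_ge: "x * (1 - \<epsilon>) \<le> \<rho>" by (simp add: algebra_simps power2_eq_square)
  have "measure_pmf.prob (binomial_pmf n \<rho>) {k. real k < (1 - 3 * \<epsilon>) * (x * real n)} \<le>
      measure_pmf.prob (binomial_pmf n \<rho>) {k. - \<epsilon> * ((1 - 3 * \<epsilon>) * (x * real n)) \<le> - \<epsilon> * real k}"
    using e by (intro measure_pmf_prob_mono) auto
  also have "\<dots> \<le> exp (real n * \<rho> * (exp (- \<epsilon>) - 1) - (- \<epsilon>) * ((1 - 3 * \<epsilon>) * (x * real n)))"
    by (rule binomial_chernoff) (fact \<rho>)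
  also have "\<dots> \<le> exp (- (\<epsilon>\<^sup>2 * (x * real n)))"
  proof (subst exp_le_cancel_iff)
    have "x * (1 - \<epsilon>) * (\<epsilon> - \<epsilon>\<^sup>2) \<le> \<rho> * (1 - exp (- \<epsilon>))"
      using \<rho>_ge x e exp_minus_le[of \<epsilon>] \<rho> by (intro mult_mono) (auto simp: power2_eq_square mult_left_le)
    then have "real n * (x * (1 - \<epsilon>) * (\<epsilon> - \<epsilon>\<^sup>2)) \<le> real n * (\<rho> * (1 - exp (- \<epsilon>)))"
      by (intro mult_left_mono) auto
    moreover have "0 \<le> \<epsilon> ^ 3 * (x * real n)" using e x by simp
    ultimately show "real n * \<rho> * (exp (- \<epsilon>) - 1) - - \<epsilon> * ((1 - 3 * \<epsilon>) * (x * real n)) \<le> - (\<epsilon>\<^sup>2 * (x * real n))"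
      by (simp add: algebra_simps power2_eq_square power3_eq_cube)
  qed
  finally show ?thesis by (simp add: \<rho>_def x_def)
qed

lemma binomial_upper_tail:
  assumes p: "p \<in> {0..1}" and e: "0 \<le> \<epsilon>" "\<epsilon> \<le> 1"
  shows "measure_pmf.prob (binomial_pmf n p) {x. (1 + 2 * \<epsilon>) * (p * real n) < real x} \<le>
    exp (- (\<epsilon>\<^sup>2 * (p * real n)))"
proof -
  have "measure_pmf.prob (binomial_pmf n p) {k. (1 + 2 * \<epsilon>) * (p * real n) < real k} \<le>
      measure_pmf.prob (binomial_pmf n p) {k. \<epsilon> * ((1 + 2 * \<epsilon>) * (p * real n)) \<le> \<epsilon> * real k}"
    using e by (intro measure_pmf_prob_mono mult_left_mono) auto
  also have "\<dots> \<le> exp (real n * p * (exp \<epsilon> - 1) - \<epsilon> * ((1 + 2 * \<epsilon>) * (p * real n)))"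
    by (rule binomial_chernoff) (fact p)
  also have "\<dots> \<le> exp (- (\<epsilon>\<^sup>2 * (p * real n)))"
  proof (subst exp_le_cancel_iff)
    have "real n * p * (exp \<epsilon> - 1) \<le> real n * p * (\<epsilon> + \<epsilon>\<^sup>2)"
      using exp_bound[of \<epsilon>] e p by (intro mult_left_mono) auto
    then show "real n * p * (exp \<epsilon> - 1) - \<epsilon> * ((1 + 2 * \<epsilon>) * (p * real n)) \<le> - (\<epsilon>\<^sup>2 * (p * real n))"
      by (simp add: algebra_simps power2_eq_square)
  qed
  finally show ?thesis .
qed

text \<open>Each of the \<open>m + 1\<close> point probabilities is bounded separately. The success
  probability is at most \<open>p w\<close> by Bernoulli's inequality, and the failure probability
  at most \<open>exp (- p w)\<close>; the \<open>1 +\<close> makes the polynomial factor increasing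
  in the number of successes.\<close>

lemma low_count_le:
  assumes p: "p \<in> {0..1}" and m: "m \<le> N"
  shows "low_count N p w m \<le> (real m + 1) * (1 + real N * (p * real w)) ^ m * exp (- (p * real w * real (N - m)))"
proof -
  define \<pi> where "\<pi> = 1 - (1 - p) ^ w"
  have \<pi>: "\<pi> \<in> {0..1}" using p by (auto simp: \<pi>_def power_le_one)
  have "1 + real w * (- p) \<le> (1 + (- p)) ^ w" using p by (intro Bernoulli_inequality) auto
  then have \<pi>_le: "\<pi> \<le> p * real w" by (simp add: \<pi>_def mult.commute)
  have "low_count N p w m = (\<Sum>s\<le>m. pmf (binomial_pmf N \<pi>) s)"
    unfolding low_count_def \<pi>_def by (simp add: measure_measure_pmf_finite)
  also have "\<dots> \<le> (\<Sum>s\<le>m. (1 + real N * (p * real w)) ^ m * exp (- (p * real w * real (N - m))))"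
  proof (intro sum_mono)
    fix s assume s: "s \<in> {..m}"
    have "pmf (binomial_pmf N \<pi>) s = (real (N choose s) * \<pi> ^ s) * (1 - \<pi>) ^ (N - s)"
      using \<pi> by simp
    also have "\<dots> \<le> ((1 + real N * (p * real w)) ^ m) * exp (- (p * real w * real (N - m)))"
    proof (intro mult_mono)
      have "real (N choose s) * \<pi> ^ s \<le> real N ^ s * (p * real w) ^ s"
        using \<pi>_le \<pi> s m binomial_le_pow[of s N] by (intro mult_mono power_mono)
          (auto simp flip: of_nat_power)
      also have "\<dots> \<le> (1 + real N * (p * real w)) ^ s"
        using p by (subst power_mult_distrib[symmetric]) (intro power_mono; auto)
      also have "\<dots> \<le> (1 + real N * (p * real w)) ^ m"
        using p s by (intro power_increasing) auto
      finally show "real (N choose s) * \<pi> ^ s \<le> (1 + real N * (p * real w)) ^ m" .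
      have "(1 - \<pi>) ^ (N - s) \<le> (1 - \<pi>) ^ (N - m)"
        using \<pi> s m by (intro power_decreasing) auto
      also have "\<dots> \<le> exp (- (real w * p)) ^ (N - m)"
        using one_minus_power_le_exp[OF p, of w] \<pi> by (intro power_mono) (auto simp: \<pi>_def)
      also have "\<dots> = exp (- (p * real w * real (N - m)))"
        by (simp add: exp_of_nat_mult[symmetric] mult.commute)
      finally show "(1 - \<pi>) ^ (N - s) \<le> exp (- (p * real w * real (N - m)))" .
    qed (use \<pi> p in auto)
    finally show "pmf (binomial_pmf N \<pi>) s \<le> (1 + real N * (p * real w)) ^ m * exp (- (p * real w * real (N - m)))" .
  qed
  finally show ?thesis by (simp add: algebra_simps)
qed

section \<open>The node-object incidence matrix\<close>

text \<open>A matrix \<open>f\<close> has \<open>f (v, x)\<close> iff the object \<open>x\<close> belongs to the object set of the node \<open>v\<close>.\<close>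

locale incidence =
  fixes V :: "'v set" and pool :: "'o set" and p :: real
  assumes finite_V: "finite V" and finite_pool: "finite pool" and p: "p \<in> {0..1}"
begin

abbreviation M :: "('v \<times> 'o \<Rightarrow> bool) pmf" where
  "M \<equiv> Pi_pmf (V \<times> pool) False (\<lambda>_. bernoulli_pmf p)"

abbreviation prob :: "(('v \<times> 'o \<Rightarrow> bool) \<Rightarrow> bool) \<Rightarrow> real" where
  "prob P \<equiv> measure_pmf.prob M {f. P f}"

text \<open>Membership is not restricted to \<open>pool\<close>, so that the map factors through
  \<open>curry\<close> in \<open>map_graph_M\<close>; entries outside are false on the support of
  \<open>M\<close>.\<close>

definition graph :: "('v \<times> 'o \<Rightarrow> bool) \<Rightarrow> 'v ugraph" where
  "graph f = intersection_graph V (\<lambda>v. Collect (curry f v))"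

definition objects :: "('v \<times> 'o \<Rightarrow> bool) \<Rightarrow> 'v set \<Rightarrow> 'o set" where
  "objects f A = {x \<in> pool. \<exists>v\<in>A. f (v, x)}"

definition adjacent :: "('v \<times> 'o \<Rightarrow> bool) \<Rightarrow> 'v \<Rightarrow> 'v \<Rightarrow> bool" where
  "adjacent f u v \<longleftrightarrow> (\<exists>x\<in>pool. f (u, x) \<and> f (v, x))"

definition stable :: "('v \<times> 'o \<Rightarrow> bool) \<Rightarrow> 'v set \<Rightarrow> bool" where
  "stable f A \<longleftrightarrow> (\<forall>u\<in>A. \<forall>v\<in>A. u \<noteq> v \<longrightarrow> \<not> adjacent f u v)"

definition boundary :: "('v \<times> 'o \<Rightarrow> bool) \<Rightarrow> 'v set \<Rightarrow> 'v set" where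
  "boundary f A = {u \<in> V - A. \<exists>x\<in>objects f A. f (u, x)}"

definition degree :: "('v \<times> 'o \<Rightarrow> bool) \<Rightarrow> 'v \<Rightarrow> nat" where
  "degree f v = card {u \<in> V - {v}. adjacent f u v}"

lemma map_graph_M:
  "map_pmf graph M = map_pmf (intersection_graph V) (Pi_pmf V {} (\<lambda>_. binomial_subset_pmf pool p))"
proof -
  have "binomial_subset_pmf pool p = map_pmf Collect (Pi_pmf pool False (\<lambda>_. bernoulli_pmf p))"
    unfolding binomial_subset_pmf_def using set_Pi_pmf_subset[OF finite_pool, of False]
    by (intro map_pmf_cong) auto
  then have "Pi_pmf V {} (\<lambda>_. binomial_subset_pmf pool p) =
      map_pmf (\<lambda>h. Collect \<circ> h) (Pi_pmf V (\<lambda>_. False) (\<lambda>_. Pi_pmf pool False (\<lambda>_. bernoulli_pmf p)))"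
    using finite_V by (simp add: Pi_pmf_map[where dflt = "\<lambda>_. False"])
  also have "\<dots> = map_pmf (\<lambda>h. Collect \<circ> h) (map_pmf curry M)"
    using finite_V finite_pool by (simp add: map_curry_Pi_pmf)
  finally show ?thesis
    by (simp add: map_pmf_comp graph_def[abs_def] o_def)
qed

lemma support_M: "f \<in> set_pmf M \<Longrightarrow> f (v, x) \<Longrightarrow> x \<in> pool"
  using set_Pi_pmf_subset[of "V \<times> pool" False "\<lambda>_. bernoulli_pmf p"] finite_V finite_pool by auto

lemma adjacent_commute: "adjacent f u v = adjacent f v u"
  by (auto simp: adjacent_def)

lemma nodes_graph [simp]: "nodes (graph f) = V"
  by (simp add: graph_def intersection_graph_def)

lemma edge_graph:
  assumes "f \<in> set_pmf M"
  shows "{u, v} \<in> edges (graph f) \<longleftrightarrow> u \<in> V \<and> v \<in> V \<and> u \<noteq> v \<and> adjacent f u v"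
  using support_M[OF assms]
  by (auto simp: graph_def intersection_graph_def adjacent_def doubleton_eq_iff)

lemma node_degree_graph:
  assumes "f \<in> set_pmf M" "v \<in> V"
  shows "node_degree (graph f) v = degree f v"
  using assms by (auto simp: node_degree_def degree_def edge_graph adjacent_commute intro!: arg_cong[of _ _ card])

lemma min_node_degree_graph:
  assumes "f \<in> set_pmf M" "V \<noteq> {}"
  shows "k \<le> min_node_degree (graph f) \<longleftrightarrow> (\<forall>v\<in>V. k \<le> degree f v)"
  using assms finite_V by (simp add: min_node_degree_def node_degree_graph)

lemma neighbourhood_graph:
  assumes "f \<in> set_pmf M" "A \<subseteq> V"
  shows "neighbourhood (graph f) A = boundary f A"
  using assms by (auto simp: neighbourhood_def boundary_def objects_def edge_graph adjacent_def)

lemma degree_le_boundary: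
  assumes "stable f A" "v \<in> A"
  shows "degree f v \<le> card (boundary f A)"
  unfolding degree_def boundary_def using assms finite_V
  by (intro card_mono) (auto simp: stable_def adjacent_def objects_def)

text \<open>In a stable set all neighbours of a node lie on the boundary, which would then have at
  least \<open>k\<close> elements. So the set violating expansion contains an edge, hence two
  nodes.\<close>

lemma not_k_connected_imp_sparse_boundary:
  assumes f: "f \<in> set_pmf M" and deg: "\<forall>v\<in>V. k \<le> degree f v" and "\<not> k_connected k (graph f)"
  shows "\<exists>A\<subseteq>V. 2 \<le> card A \<and> 2 * card A \<le> card V \<and> \<not> stable f A \<and> card (boundary f A) < k"
proof -
  obtain A where A: "A \<subseteq> V" "A \<noteq> {}" "2 * card A \<le> card V" "card (boundary f A) < k"
    using expansion_imp_k_connected[of "graph f" k] assms(3) finite_V neighbourhood_graph[OF f]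
    by (metis nodes_graph not_le)
  then obtain v where "v \<in> A" by blast
  then have "\<not> stable f A"
    using degree_le_boundary[of f A v] deg A by fastforce
  moreover from this obtain u v where "u \<in> A" "v \<in> A" "u \<noteq> v"
    by (auto simp: stable_def)
  then have "card {u, v} \<le> card A"
    using A(1) finite_V by (intro card_mono) (auto intro: finite_subset)
  ultimately show ?thesis using A \<open>u \<noteq> v\<close> by auto
qed

lemma card_objects_binomial:
  assumes "A \<subseteq> V"
  shows "prob (\<lambda>f. P (card (objects f A))) = measure_pmf.prob (binomial_pmf (card pool) (1 - (1 - p) ^ card A)) {x. P x}"
proof -
  have "map_pmf (\<lambda>f. card (objects f A)) M = binomial_pmf (card pool) (1 - (1 - p) ^ card A)"
    unfolding objects_def
    by (rule binomial_eq_count_columns) (use assms finite_V finite_pool p finite_subset in auto)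
  from this[symmetric] show ?thesis by (simp add: vimage_def)
qed

lemma prob_adjacent_le:
  assumes "u \<in> V" "v \<in> V" "u \<noteq> v"
  shows "prob (\<lambda>f. adjacent f u v) \<le> real (card pool) * p\<^sup>2"
proof -
  have "prob (\<lambda>f. adjacent f u v) \<le> (\<Sum>x\<in>pool. prob (\<lambda>f. f (u, x) \<and> f (v, x)))"
    using finite_pool by (intro measure_pmf_prob_le_sum) (auto simp: adjacent_def)
  also have "\<dots> = (\<Sum>x\<in>pool. p\<^sup>2)"
  proof (intro sum.cong refl)
    fix x assume "x \<in> pool"
    have "prob (\<lambda>f. \<forall>y\<in>{(u, x), (v, x)}. f y) = (\<Prod>y\<in>{(u, x), (v, x)}. prob (\<lambda>f. f y))"
      using assms finite_V finite_pool \<open>x \<in> pool\<close>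
      by (intro prob_Pi_pmf_blocks[where B = "\<lambda>y. {y}"]) (auto simp: disjoint_family_on_def depends_on_def)
    also have "\<dots> = (\<Prod>y\<in>{(u, x), (v, x)}. p)"
    proof (intro prod.cong refl)
      fix y assume "y \<in> {(u, x), (v, x)}"
      then have "map_pmf (\<lambda>f. f y) M = bernoulli_pmf p"
        using assms finite_V finite_pool \<open>x \<in> pool\<close> by (subst Pi_pmf_component) auto
      then have "measure_pmf.prob (map_pmf (\<lambda>f. f y) M) {True} = p"
        using p by (simp add: measure_pmf_single)
      then show "prob (\<lambda>f. f y) = p" by (simp add: vimage_def)
    qed
    also have "\<dots> = p\<^sup>2" using assms by (simp add: power2_eq_square)
    finally show "prob (\<lambda>f. f (u, x) \<and> f (v, x)) = p\<^sup>2" by simp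
  qed
  finally show ?thesis by simp
qed

lemma prob_not_stable_le:
  assumes "A \<subseteq> V"
  shows "prob (\<lambda>f. \<not> stable f A) \<le> (real (card A))\<^sup>2 * (real (card pool) * p\<^sup>2)"
proof -
  have fin: "finite A" using assms finite_V finite_subset by blast
  have "prob (\<lambda>f. \<not> stable f A) \<le>
      (\<Sum>(u, v)\<in>A \<times> A. prob (\<lambda>f. u \<noteq> v \<and> adjacent f u v))"
    unfolding case_prod_beta using fin by (intro measure_pmf_prob_le_sum) (force simp: stable_def)+
  also have "\<dots> \<le> (\<Sum>(u, v)\<in>A \<times> A. real (card pool) * p\<^sup>2)"
  proof (intro sum_mono, clarify)
    fix u v assume "u \<in> A" "v \<in> A"
    then show "prob (\<lambda>f. u \<noteq> v \<and> adjacent f u v) \<le> real (card pool) * p\<^sup>2"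
      using prob_adjacent_le[of u v] assms by (cases "u = v") auto
  qed
  also have "\<dots> = (real (card A))\<^sup>2 * (real (card pool) * p\<^sup>2)"
    by (simp add: case_prod_beta power2_eq_square card_cartesian_product)
  finally show ?thesis .
qed

lemma depends_on_rows:
  shows "depends_on (A \<times> pool) (\<lambda>f. stable f A)"
    and "depends_on (A \<times> pool) (\<lambda>f. P (objects f A))"
    and "depends_on (A \<times> pool) (\<lambda>f. \<forall>v\<in>A. Q (objects f {v}))"
proof -
  have *: "objects f B = objects g B" if "\<forall>x\<in>A \<times> pool. f x = g x" "B \<subseteq> A" for f g B
    using that by (fastforce simp: objects_def)
  show "depends_on (A \<times> pool) (\<lambda>f. stable f A)"
    unfolding depends_on_def stable_def adjacent_def by auto
  show "depends_on (A \<times> pool) (\<lambda>f. P (objects f A))"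
    unfolding depends_on_def using * by (metis order.refl)
  show "depends_on (A \<times> pool) (\<lambda>f. \<forall>v\<in>A. Q (objects f {v}))"
    unfolding depends_on_def using *[of _ _ "{_}"] by (metis empty_subsetI insert_subset)
qed

lemma split_rows:
  assumes "A \<subseteq> V"
  shows "V \<times> pool = A \<times> pool \<union> (V - A) \<times> pool" "finite (A \<times> pool)" "finite ((V - A) \<times> pool)"
    "A \<times> pool \<inter> (V - A) \<times> pool = {}"
  using assms finite_V finite_pool finite_subset by auto

text \<open>An edge inside \<open>A\<close> and the size of the union of object sets are decided by
  the rows in \<open>A\<close>; given these, the boundary is decided by the remaining rows. This is
  why the cost of the edge multiplies \<open>low_count\<close>.\<close>

lemma prob_unstable_sparse_boundary_le:
  assumes A: "A \<subseteq> V"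
  shows "prob (\<lambda>f. \<not> stable f A \<and> card (boundary f A) \<le> m) \<le>
    prob (\<lambda>f. card (objects f A) < w) +
    (real (card A))\<^sup>2 * (real (card pool) * p\<^sup>2) * low_count (card V - card A) p w m"
proof -
  let ?Q = "\<lambda>f. \<not> stable f A \<and> w \<le> card (objects f A)"
  have "prob (\<lambda>f. \<not> stable f A \<and> card (boundary f A) \<le> m) \<le>
      prob (\<lambda>f. card (objects f A) < w) + prob (\<lambda>f. ?Q f \<and> card (boundary f A) \<le> m)"
    by (rule measure_pmf_prob_le_add) auto
  also have "prob (\<lambda>f. ?Q f \<and> card (boundary f A) \<le> m) \<le> prob ?Q * low_count (card V - card A) p w m"
    unfolding split_rows(1)[OF A]
  proof (rule prob_Pi_pmf_Un_le)
    show "depends_on (A \<times> pool) ?Q"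
      by (intro depends_on_conj depends_on_not depends_on_rows(1) depends_on_rows(2)[where P = "\<lambda>X. w \<le> card X"])
    fix f assume "?Q f"
    let ?h = "\<lambda>g x. if x \<in> A \<times> pool then f x else g x"
    have "boundary (?h g) A = {u \<in> V - A. \<exists>x\<in>objects f A. g (u, x)}" for g
      by (auto simp: boundary_def objects_def)
    then have "measure_pmf.prob (Pi_pmf ((V - A) \<times> pool) False (\<lambda>_. bernoulli_pmf p)) {g. card (boundary (?h g) A) \<le> m} =
        low_count (card (V - A)) p (card (objects f A)) m"
      using finite_V finite_pool p by (simp only:) (rule low_count_eq; auto simp: objects_def)
    also have "\<dots> \<le> low_count (card (V - A)) p w m"
      using \<open>?Q f\<close> p by (intro low_count_antimono) auto
    also have "card (V - A) = card V - card A"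
      using A finite_V by (intro card_Diff_subset) (auto intro: finite_subset)
    finally show "measure_pmf.prob (Pi_pmf ((V - A) \<times> pool) False (\<lambda>_. bernoulli_pmf p)) {g. card (boundary (?h g) A) \<le> m} \<le>
        low_count (card V - card A) p w m" .
  qed (use split_rows[OF A] low_count_nonneg in auto)
  also have "prob ?Q \<le> prob (\<lambda>f. \<not> stable f A)"
    by (rule measure_pmf_prob_mono) auto
  also have "\<dots> \<le> (real (card A))\<^sup>2 * (real (card pool) * p\<^sup>2)"
    by (rule prob_not_stable_le[OF A])
  finally show ?thesis using low_count_nonneg by (simp add: mult_right_mono)
qed

text \<open>Stability makes the object sets of the nodes in \<open>A\<close> disjoint, so the outer
  degrees read disjoint blocks of columns.\<close>

lemma prob_outer_degrees:
  assumes A: "A \<subseteq> V" and f: "stable f A"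
  shows "measure_pmf.prob (Pi_pmf ((V - A) \<times> pool) False (\<lambda>_. bernoulli_pmf p))
      {g. \<forall>v\<in>A. card {u \<in> V - A. \<exists>x\<in>objects f {v}. g (u, x)} \<le> m} =
    (\<Prod>v\<in>A. low_count (card V - card A) p (card (objects f {v})) m)"
proof -
  have fin: "finite A" using A finite_V finite_subset by blast
  have "measure_pmf.prob (Pi_pmf ((V - A) \<times> pool) False (\<lambda>_. bernoulli_pmf p))
      {g. \<forall>v\<in>A. card {u \<in> V - A. \<exists>x\<in>objects f {v}. g (u, x)} \<le> m} =
    (\<Prod>v\<in>A. measure_pmf.prob (Pi_pmf ((V - A) \<times> pool) False (\<lambda>_. bernoulli_pmf p))
      {g. card {u \<in> V - A. \<exists>x\<in>objects f {v}. g (u, x)} \<le> m})"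
  proof (rule prob_Pi_pmf_blocks[where B = "\<lambda>v. (V - A) \<times> objects f {v}"])
    show "disjoint_family_on (\<lambda>v. (V - A) \<times> objects f {v}) A"
      using f by (auto simp: disjoint_family_on_def stable_def adjacent_def objects_def)
    fix v
    show "depends_on ((V - A) \<times> objects f {v}) (\<lambda>g. card {u \<in> V - A. \<exists>x\<in>objects f {v}. g (u, x)} \<le> m)"
      unfolding depends_on_def
    proof (intro allI impI)
      fix g h :: "'v \<times> 'o \<Rightarrow> bool" assume "\<forall>x\<in>(V - A) \<times> objects f {v}. g x = h x"
      then have "{u \<in> V - A. \<exists>x\<in>objects f {v}. g (u, x)} = {u \<in> V - A. \<exists>x\<in>objects f {v}. h (u, x)}" by auto
      then show "(card {u \<in> V - A. \<exists>x\<in>objects f {v}. g (u, x)} \<le> m) =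
        (card {u \<in> V - A. \<exists>x\<in>objects f {v}. h (u, x)} \<le> m)" by simp
    qed
  qed (use fin finite_V finite_pool in \<open>auto simp: objects_def\<close>)
  also have "\<dots> = (\<Prod>v\<in>A. low_count (card (V - A)) p (card (objects f {v})) m)"
    using finite_V finite_pool p by (intro prod.cong refl low_count_eq) (auto simp: objects_def)
  also have "card (V - A) = card V - card A"
    using A finite_V by (intro card_Diff_subset) (auto intro: finite_subset)
  finally show ?thesis .
qed

text \<open>For stable \<open>A\<close> a degree does not exceed the outer degree, and smaller
  object sets only make low degrees more likely.\<close>

lemma prob_all_degrees_ge:
  assumes A: "A \<subseteq> V"
  shows "prob (\<lambda>f. stable f A \<and> (\<forall>v\<in>A. card (objects f {v}) \<le> w)) *
      low_count (card V - card A) p w m ^ card A \<le> prob (\<lambda>f. \<forall>v\<in>A. degree f v \<le> m)"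
proof -
  let ?Q = "\<lambda>f. stable f A \<and> (\<forall>v\<in>A. card (objects f {v}) \<le> w)"
  have "prob ?Q * low_count (card V - card A) p w m ^ card A \<le> prob (\<lambda>f. ?Q f \<and> (\<forall>v\<in>A. degree f v \<le> m))"
    unfolding split_rows(1)[OF A]
  proof (rule prob_Pi_pmf_Un_ge)
    show "depends_on (A \<times> pool) ?Q"
      by (intro depends_on_conj depends_on_rows(1) depends_on_rows(3)[where Q = "\<lambda>X. card X \<le> w"])
    fix f assume Q: "?Q f"
    let ?h = "\<lambda>g x. if x \<in> A \<times> pool then f x else g x"
    have "low_count (card V - card A) p w m ^ card A \<le> (\<Prod>v\<in>A. low_count (card V - card A) p (card (objects f {v})) m)"
      unfolding prod_constant[symmetric] using Q p
      by (intro prod_mono) (auto intro: low_count_antimono low_count_nonneg)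
    also have "\<dots> = measure_pmf.prob (Pi_pmf ((V - A) \<times> pool) False (\<lambda>_. bernoulli_pmf p))
      {g. \<forall>v\<in>A. card {u \<in> V - A. \<exists>x\<in>objects f {v}. g (u, x)} \<le> m}"
      using prob_outer_degrees[OF A, of f m] Q by simp
    also have "\<dots> \<le> measure_pmf.prob (Pi_pmf ((V - A) \<times> pool) False (\<lambda>_. bernoulli_pmf p))
      {g. \<forall>v\<in>A. degree (?h g) v \<le> m}"
    proof (rule measure_pmf_prob_mono, intro ballI)
      fix g v assume g: "\<forall>v\<in>A. card {u \<in> V - A. \<exists>x\<in>objects f {v}. g (u, x)} \<le> m" and v: "v \<in> A"
      have "degree (?h g) v \<le> card {u \<in> V - A. \<exists>x\<in>objects f {v}. g (u, x)}"
        unfolding degree_def using Q v finite_V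
        by (intro card_mono) (auto simp: stable_def adjacent_def objects_def split: if_splits)
      also have "\<dots> \<le> m" using g v by simp
      finally show "degree (?h g) v \<le> m" .
    qed
    finally show "low_count (card V - card A) p w m ^ card A \<le>
      measure_pmf.prob (Pi_pmf ((V - A) \<times> pool) False (\<lambda>_. bernoulli_pmf p)) {g. \<forall>v\<in>A. degree (?h g) v \<le> m}" .
  qed (use split_rows[OF A] low_count_nonneg in auto)
  also have "\<dots> \<le> prob (\<lambda>f. \<forall>v\<in>A. degree f v \<le> m)"
    by (rule measure_pmf_prob_mono) auto
  finally show ?thesis .
qed

text \<open>Without stability the degrees do not factorize. That part is absorbed into the event of
  an edge inside \<open>A\<close> together with a sparse boundary, which is bounded
  elsewhere.\<close>

lemma prob_all_degrees_le:
  assumes A: "A \<subseteq> V"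
  shows "prob (\<lambda>f. \<forall>v\<in>A. degree f v \<le> m) \<le>
    prob (\<lambda>f. \<exists>v\<in>A. card (objects f {v}) < w) + low_count (card V - card A) p w m ^ card A +
    prob (\<lambda>f. \<not> stable f A \<and> card (boundary f A) \<le> card A * m)"
proof -
  have fin: "finite A" using A finite_V finite_subset by blast
  let ?Q = "\<lambda>f. stable f A \<and> (\<forall>v\<in>A. w \<le> card (objects f {v}))"
  have bd: "card (boundary f A) \<le> card A * m" if "\<forall>v\<in>A. degree f v \<le> m" for f
  proof -
    have "card (boundary f A) \<le> card (\<Union>v\<in>A. {u \<in> V - {v}. adjacent f u v})"
      using fin finite_V by (intro card_mono) (auto simp: boundary_def objects_def adjacent_def)
    also have "\<dots> \<le> (\<Sum>v\<in>A. degree f v)"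
      unfolding degree_def by (rule card_UN_le[OF fin])
    also have "\<dots> \<le> card A * m" using that sum_bounded_above[of A "degree f" m] by simp
    finally show ?thesis .
  qed
  have "prob (\<lambda>f. \<forall>v\<in>A. degree f v \<le> m) \<le> prob (\<lambda>f. (\<exists>v\<in>A. card (objects f {v}) < w) \<or> (?Q f \<and> (\<forall>v\<in>A. degree f v \<le> m))) +
      prob (\<lambda>f. \<not> stable f A \<and> card (boundary f A) \<le> card A * m)"
    using bd by (intro measure_pmf_prob_le_add) (auto simp: not_less)
  also have "prob (\<lambda>f. (\<exists>v\<in>A. card (objects f {v}) < w) \<or> (?Q f \<and> (\<forall>v\<in>A. degree f v \<le> m))) \<le>
      prob (\<lambda>f. \<exists>v\<in>A. card (objects f {v}) < w) + prob (\<lambda>f. ?Q f \<and> (\<forall>v\<in>A. degree f v \<le> m))"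
    by (rule measure_pmf_prob_le_add) auto
  also have "prob (\<lambda>f. ?Q f \<and> (\<forall>v\<in>A. degree f v \<le> m)) \<le> prob ?Q * low_count (card V - card A) p w m ^ card A"
    unfolding split_rows(1)[OF A]
  proof (rule prob_Pi_pmf_Un_le)
    show "depends_on (A \<times> pool) ?Q"
      by (intro depends_on_conj depends_on_rows(1) depends_on_rows(3)[where Q = "\<lambda>X. w \<le> card X"])
    fix f assume Q: "?Q f"
    let ?h = "\<lambda>g x. if x \<in> A \<times> pool then f x else g x"
    have "measure_pmf.prob (Pi_pmf ((V - A) \<times> pool) False (\<lambda>_. bernoulli_pmf p)) {g. \<forall>v\<in>A. degree (?h g) v \<le> m} \<le>
      measure_pmf.prob (Pi_pmf ((V - A) \<times> pool) False (\<lambda>_. bernoulli_pmf p))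
      {g. \<forall>v\<in>A. card {u \<in> V - A. \<exists>x\<in>objects f {v}. g (u, x)} \<le> m}"
    proof (rule measure_pmf_prob_mono, intro ballI)
      fix g v assume g: "\<forall>v\<in>A. degree (?h g) v \<le> m" and v: "v \<in> A"
      have "card {u \<in> V - A. \<exists>x\<in>objects f {v}. g (u, x)} \<le> degree (?h g) v"
        unfolding degree_def using v finite_V
        by (intro card_mono) (auto simp: adjacent_def objects_def split: if_splits)
      also have "\<dots> \<le> m" using g v by simp
      finally show "card {u \<in> V - A. \<exists>x\<in>objects f {v}. g (u, x)} \<le> m" .
    qed
    also have "\<dots> = (\<Prod>v\<in>A. low_count (card V - card A) p (card (objects f {v})) m)"
      using prob_outer_degrees[OF A, of f m] Q by simp
    also have "\<dots> \<le> low_count (card V - card A) p w m ^ card A"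
      unfolding prod_constant[symmetric] using Q p
      by (intro prod_mono) (auto intro: low_count_antimono low_count_nonneg)
    finally show "measure_pmf.prob (Pi_pmf ((V - A) \<times> pool) False (\<lambda>_. bernoulli_pmf p)) {g. \<forall>v\<in>A. degree (?h g) v \<le> m} \<le>
      low_count (card V - card A) p w m ^ card A" .
  qed (use split_rows[OF A] low_count_nonneg in auto)
  also have "\<dots> \<le> 1 * low_count (card V - card A) p w m ^ card A"
    by (intro mult_right_mono) (auto simp: low_count_nonneg)
  finally show ?thesis by simp
qed

end

section \<open>Factorial moments\<close>

text \<open>Telescoping by Pascal's rule. The sign of the nonzero case decides on which side of the
  indicator of \<open>x = 0\<close> the partial sum lies.\<close>

lemma alternating_binomial_partial_sum:
  "(\<Sum>j\<le>m. (- 1) ^ j * real (x choose j)) = (if x = 0 then 1 else (- 1) ^ m * real ((x - 1) choose m))"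
proof (cases x)
  case 0
  then show ?thesis by (induction m) auto
next
  case (Suc y)
  have "(\<Sum>j\<le>m. (- 1) ^ j * real (Suc y choose j)) = (- 1) ^ m * real (y choose m)"
    by (induction m) (auto simp: algebra_simps)
  with Suc show ?thesis by simp
qed

lemma bonferroni:
  fixes X :: "'a \<Rightarrow> nat"
  assumes fin: "finite (set_pmf M)"
  defines "B \<equiv> \<lambda>j. measure_pmf.expectation M (\<lambda>\<omega>. real (X \<omega> choose j))"
  shows "even m \<Longrightarrow> measure_pmf.prob M {\<omega>. X \<omega> = 0} \<le> (\<Sum>j\<le>m. (- 1) ^ j * B j)"
    and "odd m \<Longrightarrow> (\<Sum>j\<le>m. (- 1) ^ j * B j) \<le> measure_pmf.prob M {\<omega>. X \<omega> = 0}"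
proof -
  note int = integrable_measure_pmf_finite[OF fin]
  have S: "(\<Sum>j\<le>m. (- 1) ^ j * B j) = measure_pmf.expectation M (\<lambda>\<omega>. \<Sum>j\<le>m. (- 1) ^ j * real (X \<omega> choose j))"
    unfolding B_def by (subst Bochner_Integration.integral_sum) (auto intro: int)
  have P: "measure_pmf.prob M {\<omega>. X \<omega> = 0} = measure_pmf.expectation M (indicator {\<omega>. X \<omega> = 0})"
    by simp
  show "measure_pmf.prob M {\<omega>. X \<omega> = 0} \<le> (\<Sum>j\<le>m. (- 1) ^ j * B j)" if "even m"
    unfolding S P alternating_binomial_partial_sum using that
    by (intro integral_mono int) (auto simp: indicator_def)
  show "(\<Sum>j\<le>m. (- 1) ^ j * B j) \<le> measure_pmf.prob M {\<omega>. X \<omega> = 0}" if "odd m"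
    unfolding S P alternating_binomial_partial_sum using that
    by (intro integral_mono int) (auto simp: indicator_def)
qed

text \<open>For a fixed number of terms, Bonferroni's inequalities survive the limit in
  \<open>n\<close> and enclose the limit points between consecutive partial sums of the series of
  \<open>exp (- l)\<close>; the number of terms grows afterwards.\<close>

lemma poisson_limit_of_factorial_moments:
  fixes X :: "nat \<Rightarrow> 'a \<Rightarrow> nat" and l :: real
  assumes fin: "\<And>n. finite (set_pmf (M n))"
    and mom: "\<And>j. (\<lambda>n. measure_pmf.expectation (M n) (\<lambda>\<omega>. real (X n \<omega> choose j))) \<longlonglongrightarrow> l ^ j / fact j"
  shows "(\<lambda>n. measure_pmf.prob (M n) {\<omega>. X n \<omega> = 0}) \<longlonglongrightarrow> exp (- l)"
proof -
  define s where "s m = (\<Sum>j\<le>m. (- 1) ^ j * (l ^ j / fact j))" for m :: nat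
  have s_eq: "s m = (\<Sum>j\<le>m. (- l) ^ j /\<^sub>R fact j)" for m
    unfolding s_def by (intro sum.cong refl) (auto simp: power_minus[of l] field_simps)
  have "s \<longlonglongrightarrow> exp (- l)"
    unfolding s_eq[abs_def] using exp_converges[of "- l"] unfolding sums_def_le .
  then have even: "(\<lambda>m. s (2 * m)) \<longlonglongrightarrow> exp (- l)" and odd: "(\<lambda>m. s (2 * m + 1)) \<longlonglongrightarrow> exp (- l)"
    by (auto intro!: LIMSEQ_subseq_LIMSEQ[of s, unfolded o_def] simp: strict_mono_def)
  have conv: "(\<lambda>n. \<Sum>j\<le>m. (- 1) ^ j * measure_pmf.expectation (M n) (\<lambda>\<omega>. real (X n \<omega> choose j))) \<longlonglongrightarrow> s m" for m
    unfolding s_def by (intro tendsto_sum tendsto_mult tendsto_const mom)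
  show ?thesis
  proof (rule order_tendstoI)
    fix b assume "b < exp (- l)"
    then have "\<forall>\<^sub>F m in sequentially. b < s (2 * m + 1)"
      by (rule order_tendstoD[OF odd])
    then obtain m where "b < s (2 * m + 1)" by (auto dest: eventually_happens)
    from order_tendstoD(1)[OF conv this]
    show "\<forall>\<^sub>F n in sequentially. b < measure_pmf.prob (M n) {\<omega>. X n \<omega> = 0}"
      by eventually_elim (erule less_le_trans, rule bonferroni(2)[OF fin], simp)
  next
    fix b assume "exp (- l) < b"
    then have "\<forall>\<^sub>F m in sequentially. s (2 * m) < b"
      by (rule order_tendstoD[OF even])
    then obtain m where "s (2 * m) < b" by (auto dest: eventually_happens)
    from order_tendstoD(2)[OF conv this]
    show "\<forall>\<^sub>F n in sequentially. measure_pmf.prob (M n) {\<omega>. X n \<omega> = 0} < b"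
      by eventually_elim (rule le_less_trans[OF bonferroni(1)[OF fin, of "2 * m"]], simp)
  qed
qed

context incidence
begin

lemma finite_set_M: "finite (set_pmf M)"
  using finite_V finite_pool by (subst set_Pi_pmf) (auto intro!: finite_PiE_dflt)

text \<open>The binomial coefficient counts the sets of \<open>j\<close> low-degree nodes, so its
  expectation is a sum over fixed sets.\<close>

lemma expectation_choose_low_degrees:
  "measure_pmf.expectation M (\<lambda>f. real (card {v \<in> V. degree f v \<le> m} choose j)) =
    (\<Sum>A | A \<subseteq> V \<and> card A = j. prob (\<lambda>f. \<forall>v\<in>A. degree f v \<le> m))"
proof -
  have "real (card {v \<in> V. degree f v \<le> m} choose j) =
      (\<Sum>A | A \<subseteq> V \<and> card A = j. indicator {f. \<forall>v\<in>A. degree f v \<le> m} f)" for f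
  proof -
    have "card {v \<in> V. degree f v \<le> m} choose j = card {A. A \<subseteq> {v \<in> V. degree f v \<le> m} \<and> card A = j}"
      using finite_V by (intro n_subsets[symmetric]) auto
    also have "{A. A \<subseteq> {v \<in> V. degree f v \<le> m} \<and> card A = j} =
        {A \<in> {A. A \<subseteq> V \<and> card A = j}. \<forall>v\<in>A. degree f v \<le> m}" by auto
    also have "real (card \<dots>) = (\<Sum>A | A \<subseteq> V \<and> card A = j. indicator {f. \<forall>v\<in>A. degree f v \<le> m} f)"
      using finite_V by (subst card_eq_sum) (simp add: sum.inter_filter[symmetric] indicator_def sum.If_cases Int_def)
    finally show ?thesis .
  qed
  then show ?thesis
    by (simp add: integrable_measure_pmf_finite[OF finite_set_M])
qed

end

section \<open>Asymptotics at the threshold\<close>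

lemma ln_power_over_tendsto_0: "(\<lambda>n. ln (real n) ^ i / real n) \<longlonglongrightarrow> 0"
proof (cases "i = 0")
  case False
  then have "(\<lambda>n. ln (real n) / real n powr (1 / real i)) \<longlonglongrightarrow> 0"
    by real_asymp
  then have "(\<lambda>n. (ln (real n) / real n powr (1 / real i)) ^ i) \<longlonglongrightarrow> 0 ^ i"
    by (rule tendsto_power)
  moreover have "\<forall>\<^sub>F n in sequentially. (ln (real n) / real n powr (1 / real i)) ^ i = ln (real n) ^ i / real n"
    using eventually_gt_at_top[of 0]
    by eventually_elim (use False in \<open>simp add: power_divide powr_power\<close>)
  ultimately show ?thesis using False by (simp add: tendsto_cong power_0_left)
qed (simp, real_asymp)

text \<open>One term of the exponential series. For \<open>i = r\<close> and \<open>x = r\<close> it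
  is the Stirling-type bound \<open>r! \<ge> (r / e) ^ r\<close>.\<close>

lemma power_le_fact_exp: "x ^ i \<le> fact i * exp x" if "0 \<le> x" for x :: real
proof -
  have "x ^ i /\<^sub>R fact i \<le> (\<Sum>j. x ^ j /\<^sub>R fact j)"
    using sum_le_suminf[OF summable_exp_generic[of x], of "{i}"] that by simp
  then show ?thesis by (simp add: exp_def field_simps)
qed

lemma binomial_over_power_tendsto: "(\<lambda>n. real ((n - j) choose s) / real n ^ s) \<longlonglongrightarrow> 1 / fact s"
proof -
  have "(\<lambda>n. (\<Prod>i=0..<s. (real n - real j - real i) / real n) / fact s) \<longlonglongrightarrow> (\<Prod>i=0..<s. 1) / fact s"
  proof (intro tendsto_divide tendsto_prod tendsto_const)
    fix i show "(\<lambda>n. (real n - real j - real i) / real n) \<longlonglongrightarrow> 1" by real_asymp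
  qed simp
  moreover have "\<forall>\<^sub>F n in sequentially. (\<Prod>i=0..<s. (real n - real j - real i) / real n) / fact s =
      real ((n - j) choose s) / real n ^ s"
    using eventually_ge_at_top[of j]
    by eventually_elim (simp add: binomial_gbinomial gbinomial_prod_rev prod_dividef of_nat_diff)
  ultimately show ?thesis by (simp add: tendsto_cong)
qed

text \<open>Dominates the union bound over all set sizes, uniformly in \<open>n\<close>.\<close>

lemma summable_const_over_root_power: "summable (\<lambda>r. (D / real r powr (1 / 4)) ^ r)" if "0 \<le> D" for D :: real
proof (rule summable_comparison_test_ev)
  have "(\<lambda>r. D / real r powr (1 / 4)) \<longlonglongrightarrow> 0" by real_asymp
  then have "\<forall>\<^sub>F r in sequentially. D / real r powr (1 / 4) < 1 / 2" by (rule order_tendstoD) simp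
  then show "\<forall>\<^sub>F r in sequentially. norm ((D / real r powr (1 / 4)) ^ r) \<le> (1 / 2) ^ r"
    by eventually_elim (use that in \<open>auto simp: norm_power intro!: power_mono\<close>)
qed (auto intro: summable_geometric)

text \<open>The case where \<open>\<alpha>\<close> has a finite limit. It is expressed through
  \<open>p\<close> and \<open>P\<close> alone, so that the critical sequences are instances as
  well.\<close>

locale threshold =
  fixes k :: nat and P :: "nat \<Rightarrow> nat" and p :: "nat \<Rightarrow> real" and a :: real
  assumes k_pos: "1 \<le> k"
    and p: "\<And>n. p n \<in> {0..1}"
    and P_growth: "(\<lambda>n. real (P n)) \<in> \<omega>(\<lambda>n. real n * ln (real n) ^ 5)"
    and excess: "(\<lambda>n. real n * ((p n)\<^sup>2 * real (P n)) - ln (real n) - (real k - 1) * ln (ln (real n))) \<longlonglongrightarrow> a"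
begin

abbreviation L :: "nat \<Rightarrow> real" where "L n \<equiv> ln (real n)"

definition c :: "nat \<Rightarrow> real" where "c n = real n * ((p n)\<^sup>2 * real (P n))"

text \<open>The mean size of one object set. Its square is \<open>c P / n\<close>, which is how the
  growth of \<open>P\<close> enters.\<close>

definition \<mu> :: "nat \<Rightarrow> real" where "\<mu> n = p n * real (P n)"

definition y :: "nat \<Rightarrow> real" where "y n = \<mu> n / L n ^ 3"

text \<open>
  The relative error of the concentration estimates: \<open>\<epsilon> L\<close> tends to \<open>0\<close>, so that \<open>n exp (- (1 - \<epsilon>) c)\<close>
  has the order of \<open>n exp (- c)\<close>, while \<open>\<epsilon>\<^sup>2 \<mu> / L\<close> tends to infinity, so that the deviation probability
  \<open>exp (- \<epsilon>\<^sup>2 \<mu>)\<close> beats every power of \<open>n\<close>. Both are possible since \<open>y\<close> tends to infinity, which is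
  where the exponent \<open>5\<close> of the growth condition enters.
\<close>

definition \<epsilon> :: "nat \<Rightarrow> real" where "\<epsilon> n = 1 / (L n * sqrt (sqrt (y n)))"

lemma L_gt: "\<forall>\<^sub>F n in sequentially. x < L n"
  by real_asymp

lemma c_nonneg: "0 \<le> c n" and \<mu>_nonneg: "0 \<le> \<mu> n"
  using p[of n] by (auto simp: c_def \<mu>_def)

lemma c_over_L: "(\<lambda>n. c n / L n) \<longlonglongrightarrow> 1"
proof -
  let ?d = "\<lambda>n. c n - L n - (real k - 1) * ln (L n)"
  have "(\<lambda>n. 1 + (real k - 1) * (ln (L n) / L n) + ?d n * (1 / L n)) \<longlonglongrightarrow> 1 + (real k - 1) * 0 + a * 0"
    by (intro tendsto_add tendsto_mult tendsto_const excess[folded c_def]) real_asymp+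
  moreover have "\<forall>\<^sub>F n in sequentially. 1 + (real k - 1) * (ln (L n) / L n) + ?d n * (1 / L n) = c n / L n"
    using L_gt[of 0] by eventually_elim (simp add: field_simps)
  ultimately show ?thesis by (simp add: tendsto_cong)
qed

lemma c_power_over: "(\<lambda>n. c n ^ i / real n) \<longlonglongrightarrow> 0"
proof -
  have "(\<lambda>n. (c n / L n) ^ i * (L n ^ i / real n)) \<longlonglongrightarrow> 1 ^ i * 0"
    by (intro tendsto_mult tendsto_power c_over_L ln_power_over_tendsto_0)
  moreover have "\<forall>\<^sub>F n in sequentially. (c n / L n) ^ i * (L n ^ i / real n) = c n ^ i / real n"
    using L_gt[of 0] by eventually_elim (simp add: power_divide)
  ultimately have "(\<lambda>n. c n ^ i / real n) \<longlonglongrightarrow> 1 ^ i * 0" by (rule Lim_transform_eventually)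
  then show ?thesis by simp
qed

lemma filterlim_c: "filterlim c at_top sequentially"
proof -
  have "filterlim (\<lambda>n. c n / L n * L n) at_top sequentially"
    by (rule filterlim_tendsto_pos_mult_at_top[OF c_over_L]) (simp, real_asymp)
  moreover have "\<forall>\<^sub>F n in sequentially. c n / L n * L n = c n"
    using L_gt[of 0] by eventually_elim simp
  ultimately show ?thesis by (simp add: filterlim_cong)
qed

lemma n_exp_minus_c: "(\<lambda>n. real n * exp (- c n) * L n ^ (k - 1)) \<longlonglongrightarrow> exp (- a)"
proof -
  let ?d = "\<lambda>n. c n - L n - (real k - 1) * ln (L n)"
  have "(\<lambda>n. exp (- ?d n)) \<longlonglongrightarrow> exp (- a)"
    by (intro tendsto_exp tendsto_minus excess[folded c_def])
  moreover have "\<forall>\<^sub>F n in sequentially. exp (- ?d n) = real n * exp (- c n) * L n ^ (k - 1)"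
    using L_gt[of 0] eventually_gt_at_top[of 0]
  proof eventually_elim
    case (elim n)
    have "L n ^ (k - 1) = exp (real (k - 1) * ln (L n))"
      using elim by (simp add: exp_of_nat_mult)
    moreover have "real n = exp (L n)" using elim by simp
    ultimately have "real n * exp (- c n) * L n ^ (k - 1) = exp (L n) * exp (- c n) * exp (real (k - 1) * ln (L n))"
      by simp
    also have "\<dots> = exp (- ?d n)"
      using k_pos by (simp only: exp_add[symmetric]) (simp add: of_nat_diff)
    finally show ?case by simp
  qed
  ultimately show ?thesis by (simp add: tendsto_cong)
qed

text \<open>\<open>y\<^sup>2\<close> is the product of \<open>c / L\<close>, which tends to 1, and
  \<open>P / (n L ^ 5)\<close>, which tends to infinity by the growth condition.\<close>

lemma filterlim_y: "filterlim y at_top sequentially"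
proof -
  have "filterlim (\<lambda>n. real (P n) / (real n * L n ^ 5)) at_top sequentially"
  proof -
    have "\<forall>\<^sub>F n in sequentially. real n * L n ^ 5 \<noteq> 0"
      using L_gt[of 0] eventually_gt_at_top[of 0] by eventually_elim simp
    then have "filterlim (\<lambda>n. norm (real (P n) / (real n * L n ^ 5))) at_top sequentially"
      using P_growth by (intro smallomegaD_filterlim_at_top_norm) auto
    moreover have "\<forall>\<^sub>F n in sequentially. norm (real (P n) / (real n * L n ^ 5)) = real (P n) / (real n * L n ^ 5)"
      using L_gt[of 0] by eventually_elim simp
    ultimately show ?thesis by (rule filterlim_mono_eventually[OF _ order.refl order.refl])
  qed
  then have "filterlim (\<lambda>n. sqrt (c n / L n * (real (P n) / (real n * L n ^ 5)))) at_top sequentially"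
    by (intro filterlim_compose[OF sqrt_at_top] filterlim_tendsto_pos_mult_at_top[OF c_over_L]) simp
  moreover have "\<forall>\<^sub>F n in sequentially. sqrt (c n / L n * (real (P n) / (real n * L n ^ 5))) = y n"
    using L_gt[of 0] eventually_gt_at_top[of 0]
  proof eventually_elim
    case (elim n)
    have "c n / L n * (real (P n) / (real n * L n ^ 5)) = (y n)\<^sup>2"
      using elim by (simp add: c_def y_def \<mu>_def field_simps eval_nat_numeral)
    moreover have "0 \<le> y n" using \<mu>_nonneg[of n] elim by (simp add: y_def)
    ultimately show ?case by simp
  qed
  ultimately show ?thesis by (simp add: filterlim_cong)
qed

lemma y_gt: "\<forall>\<^sub>F n in sequentially. x < y n"
  using filterlim_y by (simp add: filterlim_at_top_dense)

lemma \<epsilon>_pos: "\<forall>\<^sub>F n in sequentially. 0 < \<epsilon> n"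
  using L_gt[of 0] y_gt[of 0] by eventually_elim (simp add: \<epsilon>_def)

lemma filterlim_sqrt_sqrt_y: "filterlim (\<lambda>n. sqrt (sqrt (y n))) at_top sequentially"
  by (intro filterlim_compose[OF sqrt_at_top] filterlim_y)

lemma \<epsilon>_L: "(\<lambda>n. \<epsilon> n * L n) \<longlonglongrightarrow> 0"
proof -
  have "(\<lambda>n. 1 / sqrt (sqrt (y n))) \<longlonglongrightarrow> 0"
    using tendsto_inverse_0_at_top[OF filterlim_sqrt_sqrt_y] by (simp add: field_simps)
  moreover have "\<forall>\<^sub>F n in sequentially. 1 / sqrt (sqrt (y n)) = \<epsilon> n * L n"
    using L_gt[of 0] by eventually_elim (simp add: \<epsilon>_def)
  ultimately show ?thesis by (simp add: tendsto_cong)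
qed

lemma \<epsilon>_c: "(\<lambda>n. \<epsilon> n * c n) \<longlonglongrightarrow> 0"
proof -
  have "(\<lambda>n. (\<epsilon> n * L n) * (c n / L n)) \<longlonglongrightarrow> 0 * 1"
    by (intro tendsto_mult \<epsilon>_L c_over_L)
  moreover have "\<forall>\<^sub>F n in sequentially. (\<epsilon> n * L n) * (c n / L n) = \<epsilon> n * c n"
    using L_gt[of 0] by eventually_elim simp
  ultimately show ?thesis by (simp add: tendsto_cong)
qed

lemma \<epsilon>_tendsto_0: "\<epsilon> \<longlonglongrightarrow> 0"
proof -
  have "(\<lambda>n. (\<epsilon> n * L n) * (1 / L n)) \<longlonglongrightarrow> 0 * 0"
    by (intro tendsto_mult \<epsilon>_L) real_asymp
  moreover have "\<forall>\<^sub>F n in sequentially. (\<epsilon> n * L n) * (1 / L n) = \<epsilon> n"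
    using L_gt[of 0] by eventually_elim simp
  ultimately show ?thesis by (simp add: tendsto_cong)
qed

lemma \<epsilon>_\<mu>: "\<forall>\<^sub>F n in sequentially. (\<epsilon> n)\<^sup>2 * \<mu> n = L n * sqrt (y n)"
  using L_gt[of 0] y_gt[of 0]
proof eventually_elim
  case (elim n)
  define z where "z = sqrt (y n)"
  have "0 < z" "\<mu> n = z * z * L n ^ 3" using elim \<mu>_nonneg[of n] by (simp_all add: z_def y_def)
  moreover have "(\<epsilon> n)\<^sup>2 = 1 / ((L n)\<^sup>2 * z)"
    using elim by (simp add: \<epsilon>_def z_def power_divide power_mult_distrib)
  ultimately show ?case using elim unfolding z_def[symmetric] by (simp add: field_simps eval_nat_numeral)
qed

text \<open>\<open>n p = c / \<mu>\<close> is about \<open>1 / (L\<^sup>2 y)\<close>, which is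
  smaller than \<open>\<epsilon>\<close>. This provides the hypothesis
  \<open>real r * p \<le> \<epsilon>\<close> of \<open>binomial_lower_tail\<close> for all
  \<open>r \<le> n\<close> at once.\<close>

lemma n_p_le_\<epsilon>: "\<forall>\<^sub>F n in sequentially. real n * p n \<le> \<epsilon> n"
proof -
  have "\<forall>\<^sub>F n in sequentially. c n / L n < 2"
    by (rule order_tendstoD[OF c_over_L]) simp
  then show ?thesis
    using y_gt[of 4] L_gt[of 1] 
  proof eventually_elim
    case (elim n)
    \<comment> \<open>In terms of \<open>z\<close> the claim \<open>c \<le> \<epsilon> \<mu>\<close>
      reads \<open>c \<le> z ^ 3 * L\<^sup>2\<close>. From \<open>y > 4\<close> one gets
      \<open>z ^ 3 \<ge> 2\<close>, which matches \<open>c < 2 L\<close>.\<close>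
    define z where "z = sqrt (sqrt (y n))"
    have "z\<^sup>2 = sqrt (y n)" using elim by (simp add: z_def)
    then have "(z\<^sup>2)\<^sup>2 = y n" using elim by simp
    moreover have "1 \<le> z" using elim by (simp add: z_def)
    ultimately have z: "z ^ 4 = y n" "1 \<le> z" by simp_all
    have "4 < z ^ 4" using z elim by simp
    have \<mu>: "\<mu> n = z ^ 4 * L n ^ 3" using elim z by (simp add: y_def field_simps)
    then have "0 < \<mu> n" using elim z by simp
    have "real n * p n * \<mu> n = c n" by (simp add: \<mu>_def c_def power2_eq_square)
    also have "\<dots> \<le> 2 * L n" using elim by (simp add: field_simps)
    also have "\<dots> \<le> z ^ 3 * (L n)\<^sup>2"
    proof -
      have "2 \<le> z ^ 3"
      proof (rule ccontr)
        assume "\<not> 2 \<le> z ^ 3"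
        then have "(z ^ 3) ^ 2 < 2 ^ 2" using z by (intro power_strict_mono) auto
        moreover have "z ^ 4 \<le> z ^ 6" using z by (intro power_increasing) auto
        ultimately show False using \<open>4 < z ^ 4\<close> by (simp add: power_mult[symmetric])
      qed
      then show ?thesis using elim z by (intro mult_mono) (auto simp: power2_eq_square)
    qed
    also have "\<dots> = \<epsilon> n * \<mu> n"
      using elim z unfolding \<mu> \<epsilon>_def z_def[symmetric] by (simp add: field_simps eval_nat_numeral)
    finally show ?case using \<open>0 < \<mu> n\<close> by simp
  qed
qed

lemma n_p: "(\<lambda>n. real n * p n) \<longlonglongrightarrow> 0"
  by (rule tendsto_sandwich[OF _ n_p_le_\<epsilon> tendsto_const \<epsilon>_tendsto_0]) (use p in simp)

end

section \<open>Union bound over the sets with an inner edge and few outer neighbours\<close>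

context threshold
begin

text \<open>Rounded up, so that a natural number is below \<open>lo n r\<close> exactly if it is
  below the real bound, which the union of \<open>r\<close> object sets rarely fails to
  reach.\<close>

definition lo :: "nat \<Rightarrow> nat \<Rightarrow> nat" where
  "lo n r = nat \<lceil>(1 - 3 * \<epsilon> n) * (real r * \<mu> n)\<rceil>"

lemma \<epsilon>_le: "\<forall>\<^sub>F n in sequentially. \<epsilon> n \<le> x" if "0 < x"
  using order_tendstoD(2)[OF \<epsilon>_tendsto_0 that] by eventually_elim simp

lemma \<epsilon>_\<mu>_ge_1: "\<forall>\<^sub>F n in sequentially. 1 \<le> \<epsilon> n * \<mu> n"
  using \<epsilon>_\<mu> \<epsilon>_pos \<epsilon>_le[of 1, simplified] L_gt[of 1] y_gt[of 1]
proof eventually_elim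
  case (elim n)
  have "1 * 1 \<le> L n * sqrt (y n)" using elim by (intro mult_mono) auto
  also have "\<dots> = \<epsilon> n * (\<epsilon> n * \<mu> n)" using elim by (simp add: power2_eq_square)
  also have "\<dots> \<le> 1 * (\<epsilon> n * \<mu> n)" using elim \<mu>_nonneg[of n] by (intro mult_right_mono) auto
  finally show ?case by simp
qed

lemma lo_ge: "(1 - 3 * \<epsilon> n) * (real r * \<mu> n) \<le> real (lo n r)"
  by (simp add: lo_def of_nat_ceiling)

lemma lo_le: "\<forall>\<^sub>F n in sequentially. \<forall>r\<ge>1. real (lo n r) \<le> real r * \<mu> n"
  using \<epsilon>_\<mu>_ge_1 \<epsilon>_le[of "1 / 3", simplified]
proof eventually_elim
  case (elim n)
  show ?case
  proof (intro allI impI)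
    fix r :: nat assume "1 \<le> r"
    have "1 * 1 \<le> real r * (\<epsilon> n * \<mu> n)" using elim \<open>1 \<le> r\<close> by (intro mult_mono) auto
    then have "(1 - 3 * \<epsilon> n) * (real r * \<mu> n) + 1 \<le> real r * \<mu> n" by (simp add: algebra_simps)
    moreover have "0 \<le> (1 - 3 * \<epsilon> n) * (real r * \<mu> n)" using elim \<mu>_nonneg[of n] by simp
    ultimately show "real (lo n r) \<le> real r * \<mu> n" unfolding lo_def by linarith
  qed
qed

lemma p_\<mu>: "0 < n \<Longrightarrow> p n * \<mu> n = c n / real n"
  by (simp add: \<mu>_def c_def power2_eq_square)

lemma low_count_lo_le:
  "\<forall>\<^sub>F n in sequentially. \<forall>r. 1 \<le> r \<and> 2 * r \<le> n \<longrightarrow>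
    low_count (n - r) (p n) (lo n r) m \<le>
      (real m + 1) * (real r * (1 + c n)) ^ m * exp (- (real r * c n) + real r + c n * (real r)\<^sup>2 / real n)"
proof -
  \<comment> \<open>Per node of the set, the errors caused by \<open>lo\<close> and by the
    \<open>m\<close> excepted outer nodes vanish; bounding them by 1 produces the summand
    \<open>real r\<close> in the exponent. The loss \<open>c r\<^sup>2 / n\<close> is due to the
    \<open>r\<close> nodes inside and stays, since it is large for \<open>r\<close> of order
    \<open>n\<close>.\<close>
  have "(\<lambda>n. 3 * (\<epsilon> n * c n) + real m * (c n ^ 1 / real n)) \<longlonglongrightarrow> 3 * 0 + real m * 0"
    by (intro tendsto_intros \<epsilon>_c c_power_over)
  then have "\<forall>\<^sub>F n in sequentially. 3 * (\<epsilon> n * c n) + real m * (c n ^ 1 / real n) < 1"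
    by (rule order_tendstoD) simp
  then show ?thesis
    using lo_le \<epsilon>_pos \<epsilon>_le[of "1 / 3", simplified] eventually_ge_at_top[of "2 * m + 2"]
  proof eventually_elim
    case (elim n)
    show ?case
    proof (intro allI impI)
      fix r assume r: "1 \<le> r \<and> 2 * r \<le> n"
      have n: "0 < n" "m \<le> n - r" using r elim by auto
      let ?w = "real (lo n r)"
      have "low_count (n - r) (p n) (lo n r) m \<le>
          (real m + 1) * (1 + real (n - r) * (p n * ?w)) ^ m * exp (- (p n * ?w * real (n - r - m)))"
        using n p by (intro low_count_le) auto
      also have "\<dots> \<le> (real m + 1) * (real r * (1 + c n)) ^ m * exp (- (real r * c n) + real r + c n * (real r)\<^sup>2 / real n)"
      proof (intro mult_mono power_mono)
        have "real (n - r) * (p n * ?w) \<le> real n * (p n * (real r * \<mu> n))"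
          using elim r p[of n] by (intro mult_mono) auto
        also have "\<dots> = real r * c n" using p_\<mu>[of n] n by (simp add: field_simps)
        also have "1 + real r * c n \<le> real r * (1 + c n)" using r by (simp add: algebra_simps)
        finally show "1 + real (n - r) * (p n * ?w) \<le> real r * (1 + c n)" by simp
        define x where "x = real r * c n"
        have x: "0 \<le> x" using c_nonneg by (simp add: x_def)
        have "(1 - 3 * \<epsilon> n) * (real r * (c n / real n)) \<le> p n * ?w"
        proof -
          have "(1 - 3 * \<epsilon> n) * (real r * (c n / real n)) = p n * ((1 - 3 * \<epsilon> n) * (real r * \<mu> n))"
            unfolding p_\<mu>[OF n(1), symmetric] by (simp only: ac_simps)
          then show ?thesis using mult_left_mono[OF lo_ge[of n r], of "p n"] p[of n] by simp
        qed
        then have "(1 - 3 * \<epsilon> n) * (real r * (c n / real n)) * (real n - real r - real m) \<le> p n * ?w * real (n - r - m)"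
        proof -
          have "real (n - r - m) = real n - real r - real m" using n r by linarith
          then show ?thesis
            using mult_right_mono[OF \<open>(1 - 3 * \<epsilon> n) * (real r * (c n / real n)) \<le> p n * ?w\<close>, of "real (n - r - m)"] by simp
        qed
        moreover have "(1 - 3 * \<epsilon> n) * (real r * (c n / real n)) * (real n - real r - real m) =
            x * ((1 - 3 * \<epsilon> n) * (1 - (real r + real m) / real n))"
          using n by (simp add: x_def field_simps)
        moreover have "x * (1 - 3 * \<epsilon> n - (real r + real m) / real n) \<le> x * ((1 - 3 * \<epsilon> n) * (1 - (real r + real m) / real n))"
          using x elim by (intro mult_left_mono) (auto simp: algebra_simps)
        moreover have "x * (1 - 3 * \<epsilon> n - (real r + real m) / real n) =
            x - real r * (3 * (\<epsilon> n * c n) + real m * (c n ^ 1 / real n)) - c n * (real r)\<^sup>2 / real n"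
          using n by (simp add: x_def field_simps power2_eq_square)
        moreover have "real r * (3 * (\<epsilon> n * c n) + real m * (c n ^ 1 / real n)) \<le> real r * 1"
          using elim by (intro mult_left_mono) auto
        ultimately have "x - real r - c n * (real r)\<^sup>2 / real n \<le> p n * ?w * real (n - r - m)"
          by linarith
        then show "exp (- (p n * ?w * real (n - r - m))) \<le> exp (- (real r * c n) + real r + c n * (real r)\<^sup>2 / real n)"
          by (simp add: x_def)
      qed (use p[of n] c_nonneg[of n] in auto)
      finally show "low_count (n - r) (p n) (lo n r) m \<le>
        (real m + 1) * (real r * (1 + c n)) ^ m * exp (- (real r * c n) + real r + c n * (real r)\<^sup>2 / real n)" .
    qed
  qed
qed

lemma polylog_over: "(\<lambda>n. c n / real n * (1 + c n) ^ m) \<longlonglongrightarrow> 0"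
proof (rule tendsto_sandwich[OF _ _ tendsto_const])
  show "\<forall>\<^sub>F n in sequentially. 0 \<le> c n / real n * (1 + c n) ^ m"
    using c_nonneg by (auto intro!: always_eventually)
  have "\<forall>\<^sub>F n in sequentially. 1 \<le> c n" using filterlim_c by (simp add: filterlim_at_top)
  then show "\<forall>\<^sub>F n in sequentially. c n / real n * (1 + c n) ^ m \<le> 2 ^ m * (c n ^ Suc m / real n)"
  proof eventually_elim
    case (elim n)
    have "(1 + c n) ^ m \<le> (2 * c n) ^ m" using elim by (intro power_mono) auto
    then have "c n / real n * (1 + c n) ^ m \<le> c n / real n * (2 * c n) ^ m"
      using elim by (intro mult_left_mono) auto
    then show ?case by (simp add: power_mult_distrib field_simps)
  qed
  show "(\<lambda>n. 2 ^ m * (c n ^ Suc m / real n)) \<longlonglongrightarrow> 0"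
    by (rule tendsto_mult_right_zero[OF c_power_over])
qed

lemma n_exp_minus_c_le: "\<forall>\<^sub>F n in sequentially. real n * exp (- c n) \<le> exp (- a) + 1"
proof -
  have "\<forall>\<^sub>F n in sequentially. real n * exp (- c n) * L n ^ (k - 1) < exp (- a) + 1"
    by (rule order_tendstoD[OF n_exp_minus_c]) simp
  then show ?thesis
    using L_gt[of 1]
  proof eventually_elim
    case (elim n)
    have "real n * exp (- c n) * 1 \<le> real n * exp (- c n) * L n ^ (k - 1)"
      using elim by (intro mult_left_mono one_le_power) auto
    then show ?case using elim by simp
  qed
qed

text \<open>Hence \<open>exp (c r\<^sup>2 / n) / r!\<close> decays superexponentially in \<open>r\<close>, uniformly up to \<open>r = n / 2\<close>.\<close>

lemma exp_c_r_le:
  "\<forall>\<^sub>F n in sequentially. \<forall>r. 1 \<le> r \<and> 2 * r \<le> n \<longrightarrow> exp (c n * real r / real n) \<le> exp 1 * real r powr (3 / 4)"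
proof -
  \<comment> \<open>Monotonicity of \<open>ln x / x\<close> gives
    \<open>c r / n \<le> c / (2 ln (n / 2)) * ln r\<close> for \<open>r \<le> n / 2\<close>. The
    coefficient tends to 1/2; the value 3/4 lies strictly between this limit and 1, the exponent
    that \<open>1 / r!\<close> can absorb.\<close>
  have "(\<lambda>n. c n / L n * (L n / (2 * ln (real n / 2)))) \<longlonglongrightarrow> 1 * (1 / 2)"
    by (intro tendsto_mult c_over_L) real_asymp
  then have "\<forall>\<^sub>F n in sequentially. c n / L n * (L n / (2 * ln (real n / 2))) < 3 / 4"
    by (rule order_tendstoD) simp
  moreover have "(\<lambda>n. c n ^ 1 / real n) \<longlonglongrightarrow> 0" by (rule c_power_over)
  then have "\<forall>\<^sub>F n in sequentially. c n ^ 1 / real n < 1 / 2"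
    by (rule order_tendstoD) simp
  moreover have "\<forall>\<^sub>F n in sequentially. 0 < ln (real n / 2)" by real_asymp
  ultimately show ?thesis
    using L_gt[of 0]
  proof eventually_elim
    case (elim n)
    show ?case
    proof (intro allI impI)
      fix r assume r: "1 \<le> r \<and> 2 * r \<le> n"
      have "c n * real r / real n \<le> 1 + 3 / 4 * ln (real r)"
      \<comment> \<open>\<open>ln x / x\<close> decreases only from \<open>exp 1\<close> on. The
        small \<open>r\<close> are covered by the additive constant 1.\<close>
      proof (cases "r \<le> 2")
        case True
        have "c n / real n * real r \<le> 1 / 2 * 2" using elim True c_nonneg[of n] by (intro mult_mono) auto
        moreover have "0 \<le> ln (real r)" using r by simp
        ultimately show ?thesis by simp
      next
        case False
        have "ln (real n / 2) / (real n / 2) \<le> ln (real r) / real r"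
          using r False exp_le by (intro ln_x_over_x_mono) auto
        then have "real r / real n \<le> ln (real r) / (2 * ln (real n / 2))"
          using elim r by (simp add: field_simps)
        then have "c n * (real r / real n) \<le> c n * (ln (real r) / (2 * ln (real n / 2)))"
          using c_nonneg by (intro mult_left_mono) auto
        also have "\<dots> = c n / L n * (L n / (2 * ln (real n / 2))) * ln (real r)"
          using elim by simp
        also have "\<dots> \<le> 3 / 4 * ln (real r)"
          using elim r by (intro mult_right_mono) auto
        finally show ?thesis unfolding times_divide_eq_right by linarith
      qed
      then have "exp (c n * real r / real n) \<le> exp (1 + 3 / 4 * ln (real r))" by simp
      also have "\<dots> = exp 1 * real r powr (3 / 4)" using r by (simp add: exp_add powr_def)
      finally show "exp (c n * real r / real n) \<le> exp 1 * real r powr (3 / 4)" .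
    qed
  qed
qed

text \<open>Union bound for one set of \<open>r\<close> nodes: either it has too few objects, or one
  of the pairs of its nodes is adjacent, at cost \<open>c / n\<close>, and independently few outer
  nodes meet its objects.\<close>

definition unstable_bound :: "nat \<Rightarrow> nat \<Rightarrow> nat \<Rightarrow> real" where
  "unstable_bound n r m = exp (- ((\<epsilon> n)\<^sup>2 * (real r * \<mu> n))) +
     (real r)\<^sup>2 * (c n / real n) * low_count (n - r) (p n) (lo n r) m"

text \<open>By \<open>\<epsilon>_\<mu>\<close> the left side is \<open>n\<close> to the power
  \<open>- sqrt (y n)\<close>, and \<open>sqrt (y n)\<close> eventually exceeds every
  \<open>j\<close>.\<close>

lemma n_exp_\<epsilon>: "\<forall>\<^sub>F n in sequentially. exp (- ((\<epsilon> n)\<^sup>2 * \<mu> n)) \<le> (1 / real n) ^ j"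
  using \<epsilon>_\<mu> y_gt[of "(real j)\<^sup>2"] L_gt[of 0] eventually_gt_at_top[of 0]
proof eventually_elim
  case (elim n)
  have "real j \<le> sqrt (y n)" using elim by (intro real_le_rsqrt) simp
  then have "exp (- (L n * sqrt (y n))) \<le> exp (- (L n * real j))" using elim by simp
  also have "\<dots> = exp (- L n) ^ j" by (simp add: exp_of_nat_mult[symmetric] mult.commute)
  also have "\<dots> = (1 / real n) ^ j" using elim by (simp add: exp_minus field_simps)
  finally show ?case using elim by simp
qed

text \<open>\<open>(n exp (- c)) ^ r\<close> is at most \<open>B ^ r\<close>, and
  \<open>1 / r!\<close> outweighs \<open>exp (c r\<^sup>2 / n)\<close>, leaving the summable
  \<open>(D / r powr (1 / 4)) ^ r\<close>. The common factor \<open>c / n * (1 + c) ^ m\<close>, due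
  to the inner edge, makes the sum vanish.\<close>

lemma sum_unstable_bound: "(\<lambda>n. \<Sum>r\<in>{2..n div 2}. real (n choose r) * unstable_bound n r m) \<longlonglongrightarrow> 0"
proof -
  define B where "B = exp (- a) + 1"
  \<comment> \<open>The four factors \<open>exp 1\<close> per node come from
    \<open>r! \<ge> (r / e) ^ r\<close>, from the summand \<open>real r\<close> in
    \<open>low_count_lo_le\<close>, from \<open>exp_c_r_le\<close>, and from
    \<open>r ^ (m + 2) \<le> (m + 2)! * exp r\<close>.\<close>
  define D where "D = B * exp 4"
  define S where "S = (\<Sum>r. (D / real r powr (1 / 4)) ^ r)"
  define C where "C = (real m + 1) * fact (m + 2) * S"
  have B: "0 < B" by (simp add: B_def add_pos_pos)
  have D: "0 \<le> D" using B by (simp add: D_def)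
  show ?thesis
  proof (rule tendsto_sandwich[OF _ _ tendsto_const])
    show "\<forall>\<^sub>F n in sequentially. 0 \<le> (\<Sum>r\<in>{2..n div 2}. real (n choose r) * unstable_bound n r m)"
      by (intro always_eventually allI sum_nonneg)
        (auto simp: unstable_bound_def low_count_nonneg c_nonneg)
    have "(\<lambda>n. 1 / real n + C * (c n / real n * (1 + c n) ^ m)) \<longlonglongrightarrow> 0 + C * 0"
      by (intro tendsto_add tendsto_mult tendsto_const polylog_over) real_asymp
    then show "(\<lambda>n. 1 / real n + C * (c n / real n * (1 + c n) ^ m)) \<longlonglongrightarrow> 0" by simp
    show "\<forall>\<^sub>F n in sequentially. (\<Sum>r\<in>{2..n div 2}. real (n choose r) * unstable_bound n r m) \<le>
        1 / real n + C * (c n / real n * (1 + c n) ^ m)"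
      \<comment> \<open>The exponent 3 makes the contribution of too few objects at most
        \<open>1 / n\<^sup>2\<close> for each size \<open>r\<close>; there are at most
        \<open>n\<close> sizes.\<close>
      using low_count_lo_le[of m] n_exp_minus_c_le exp_c_r_le n_exp_\<epsilon>[of 3] eventually_gt_at_top[of 1]
    proof eventually_elim
      case (elim n)
      define Z where "Z = c n / real n * (1 + c n) ^ m"
      have Z: "0 \<le> Z" using c_nonneg by (simp add: Z_def)
      have term_le: "real (n choose r) * unstable_bound n r m \<le>
          1 / (real n)\<^sup>2 + Z * ((real m + 1) * fact (m + 2)) * (D / real r powr (1 / 4)) ^ r"
        if r: "r \<in> {2..n div 2}" for r
      proof -
        have r': "1 \<le> r \<and> 2 * r \<le> n" "0 < real r" using r by auto
        have choose: "real (n choose r) \<le> real n ^ r / fact r"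
        proof -
          have "real ((n choose r) * fact r) \<le> real (n ^ r)"
            by (rule of_nat_mono[OF binomial_fact_pow])
          then show ?thesis by (simp add: pos_le_divide_eq)
        qed
        have fct: "1 / fact r \<le> exp (real r) / real r ^ r"
          using power_le_fact_exp[of "real r" r] r' by (simp add: divide_simps mult.commute)
        have "(real n * exp (- ((\<epsilon> n)\<^sup>2 * \<mu> n))) \<le> real n * (1 / real n) ^ 3"
          using elim by (intro mult_left_mono) auto
        also have "\<dots> = 1 / (real n)\<^sup>2" using elim by (simp add: eval_nat_numeral)
        finally have z: "real n * exp (- ((\<epsilon> n)\<^sup>2 * \<mu> n)) \<le> 1 / (real n)\<^sup>2" .
        have "real (n choose r) * exp (- ((\<epsilon> n)\<^sup>2 * (real r * \<mu> n))) \<le> real n ^ r * exp (- ((\<epsilon> n)\<^sup>2 * (real r * \<mu> n)))"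
        proof (intro mult_right_mono)
          have "n choose r \<le> n ^ r" using r by (intro binomial_le_pow) auto
          then have "real (n choose r) \<le> real (n ^ r)" by (rule of_nat_mono)
          then show "real (n choose r) \<le> real n ^ r" by (simp only: of_nat_power)
        qed simp
        also have "\<dots> = (real n * exp (- ((\<epsilon> n)\<^sup>2 * \<mu> n))) ^ r"
          by (simp add: power_mult_distrib exp_of_nat_mult[symmetric] ac_simps)
        also have "\<dots> \<le> (1 / (real n)\<^sup>2) ^ r" using z by (intro power_mono) auto
        also have "\<dots> \<le> (1 / (real n)\<^sup>2) ^ 1" using r elim by (intro power_decreasing) auto
        finally have 1: "real (n choose r) * exp (- ((\<epsilon> n)\<^sup>2 * (real r * \<mu> n))) \<le> 1 / (real n)\<^sup>2" by simp
        have "real (n choose r) * ((real r)\<^sup>2 * (c n / real n) * low_count (n - r) (p n) (lo n r) m) \<le>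
            (real n ^ r * (exp (real r) / real r ^ r)) * ((real r)\<^sup>2 * (c n / real n) * ((real m + 1) * (real r * (1 + c n)) ^ m *
              exp (- (real r * c n) + real r + c n * (real r)\<^sup>2 / real n)))"
        proof (intro mult_mono)
          show "real (n choose r) \<le> real n ^ r * (exp (real r) / real r ^ r)"
            using choose mult_left_mono[OF fct, of "real n ^ r"] by simp
        qed (use elim r' c_nonneg[of n] low_count_nonneg in auto)
        also have "\<dots> = Z * (real m + 1) * real r ^ (m + 2) *
            ((real n * exp (- c n)) ^ r * exp (c n * real r / real n) ^ r * exp (2 * real r) / real r ^ r)"
        proof -
          have e1: "exp (- (real r * c n) + real r + c n * (real r)\<^sup>2 / real n) =
              exp (- c n) ^ r * exp (real r) * exp (c n * real r / real n) ^ r"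
            by (simp add: exp_of_nat_mult[symmetric] exp_add[symmetric] power2_eq_square algebra_simps)
          have e2: "exp (2 * real r) = exp (real r) * exp (real r)" by (simp add: exp_add[symmetric])
          show ?thesis
            unfolding e1 e2 Z_def power_mult_distrib power_add by (simp add: ac_simps del: exp_of_nat_mult)
        qed
        also have "\<dots> \<le> Z * (real m + 1) * (fact (m + 2) * exp (real r)) *
            (B ^ r * (exp 1 * real r powr (3 / 4)) ^ r * exp (2 * real r) / real r ^ r)"
          using elim r' Z B power_le_fact_exp[of "real r" "m + 2"]
          by (intro mult_mono divide_right_mono power_mono) (auto simp: B_def)
        also have "\<dots> = Z * ((real m + 1) * fact (m + 2)) *
           (exp (real r) * B ^ r * exp 1 ^ r * exp (2 * real r) * (real r powr (3 / 4) / real r) ^ r)"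
          by (simp add: power_mult_distrib power_divide)
        also have "exp (real r) * B ^ r * exp 1 ^ r * exp (2 * real r) = D ^ r"
          unfolding D_def by (simp add: power_mult_distrib exp_of_nat_mult[symmetric] exp_add[symmetric] ac_simps)
        also have "real r powr (3 / 4) / real r = 1 / real r powr (1 / 4)"
        proof -
          have "real r powr (3 / 4) * real r powr (1 / 4) = real r"
            using r' by (simp add: powr_add[symmetric])
          then show ?thesis using r' by (simp add: field_simps)
        qed
        also have "D ^ r * (1 / real r powr (1 / 4)) ^ r = (D / real r powr (1 / 4)) ^ r"
          by (simp add: power_mult_distrib[symmetric])
        finally show ?thesis using 1 by (simp add: unstable_bound_def algebra_simps)
      qed
      have "(\<Sum>r\<in>{2..n div 2}. real (n choose r) * unstable_bound n r m) \<le>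
          (\<Sum>r\<in>{2..n div 2}. 1 / (real n)\<^sup>2 + Z * ((real m + 1) * fact (m + 2)) * (D / real r powr (1 / 4)) ^ r)"
        by (rule sum_mono) (rule term_le)
      also have "\<dots> = real (card {2..n div 2}) * (1 / (real n)\<^sup>2) + Z * ((real m + 1) * fact (m + 2)) * (\<Sum>r\<in>{2..n div 2}. (D / real r powr (1 / 4)) ^ r)"
        by (simp only: sum.distrib sum_distrib_left[symmetric] sum_constant)
      also have "\<dots> \<le> real n * (1 / (real n)\<^sup>2) + Z * ((real m + 1) * fact (m + 2)) * S"
        unfolding S_def using Z D summable_const_over_root_power[OF D]
        by (intro add_mono mult_right_mono mult_left_mono sum_le_suminf) auto
      also have "\<dots> = 1 / real n + C * (c n / real n * (1 + c n) ^ m)"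
        using elim by (simp add: C_def Z_def power2_eq_square)
      finally show ?case .
    qed
  qed
qed

end

section \<open>Limit of the expected number of low-degree nodes\<close>

context threshold
begin

lemma p_tendsto_0: "p \<longlonglongrightarrow> 0"
proof (rule tendsto_sandwich[OF _ _ tendsto_const n_p])
  show "\<forall>\<^sub>F n in sequentially. p n \<le> real n * p n"
    using eventually_ge_at_top[of 1]
  proof eventually_elim
    case (elim n)
    then show ?case using mult_right_mono[of 1 "real n" "p n"] p[of n] by simp
  qed
qed (use p in auto)

text \<open>Up to constants, the term of \<open>s\<close> successes has order
  \<open>L ^ s * n exp (- c)\<close>, and \<open>n exp (- c)\<close> has order
  \<open>1 / L ^ (k - 1)\<close>; so only \<open>s = k - 1\<close> survives. The error allowed for
  \<open>w\<close> is absolute on the scale of \<open>c\<close>, since \<open>c\<close> sits in an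
  exponent.\<close>

lemma n_low_count_tendsto:
  fixes w :: "nat \<Rightarrow> nat"
  assumes w: "(\<lambda>n. real n * p n * real (w n) - c n) \<longlonglongrightarrow> 0"
  shows "(\<lambda>n. real n * low_count (n - j) (p n) (w n) (k - 1)) \<longlonglongrightarrow> exp (- a) / fact (k - 1)"
proof -
  define x where "x n = real n * p n * real (w n)" for n
  define \<pi> where "\<pi> n = 1 - (1 - p n) ^ w n" for n
  have x0: "0 \<le> x n" for n using p[of n] by (simp add: x_def)
  have \<pi>: "\<pi> n \<in> {0..1}" for n using p[of n] by (auto simp: \<pi>_def power_le_one)
  have "(\<lambda>n. c n / L n + (x n - c n) * (1 / L n)) \<longlonglongrightarrow> 1 + 0 * 0"
    unfolding x_def by (intro tendsto_intros c_over_L w) real_asymp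
  then have x_L: "(\<lambda>n. x n / L n) \<longlonglongrightarrow> 1"
    by (simp add: diff_divide_distrib)
  have "(\<lambda>n. c n ^ 1 / real n + (x n - c n) * (1 / real n)) \<longlonglongrightarrow> 0 + 0 * 0"
    unfolding x_def by (intro tendsto_add tendsto_mult c_power_over w) real_asymp
  then have x_n: "(\<lambda>n. x n / real n) \<longlonglongrightarrow> 0"
    by (simp add: diff_divide_distrib)
  have \<pi>_L: "(\<lambda>n. real n * \<pi> n / L n) \<longlonglongrightarrow> 1"
  proof (rule tendsto_sandwich)
    show "\<forall>\<^sub>F n in sequentially. x n / L n - x n / L n * (x n / real n) \<le> real n * \<pi> n / L n"
      using L_gt[of 0] eventually_gt_at_top[of 0]
    proof eventually_elim
      case (elim n)
      define t where "t = real (w n) * p n"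
      have "t - t\<^sup>2 \<le> \<pi> n"
        using one_minus_power_le_exp[OF p, where r = "w n"] exp_minus_le[of t] p[of n]
        by (simp add: \<pi>_def t_def) (smt (verit) p)
      then have "real n * (t - t\<^sup>2) / L n \<le> real n * \<pi> n / L n"
        using elim by (intro divide_right_mono mult_left_mono) auto
      moreover have "real n * (t - t\<^sup>2) / L n = x n / L n - x n / L n * (x n / real n)"
        using elim by (simp add: x_def t_def field_simps power2_eq_square)
      ultimately show ?case by simp
    qed
    show "\<forall>\<^sub>F n in sequentially. real n * \<pi> n / L n \<le> x n / L n"
      using L_gt[of 0]
    proof eventually_elim
      case (elim n)
      have "1 + real (w n) * (- p n) \<le> (1 + (- p n)) ^ w n" using p[of n] by (intro Bernoulli_inequality) auto
      then have "\<pi> n \<le> p n * real (w n)" by (simp add: \<pi>_def mult.commute)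
      then have "real n * \<pi> n \<le> real n * (p n * real (w n))" by (intro mult_left_mono) auto
      then show ?case using elim by (intro divide_right_mono) (auto simp: x_def mult.assoc)
    qed
    have "(\<lambda>n. x n / L n - x n / L n * (x n / real n)) \<longlonglongrightarrow> 1 - 1 * 0"
      by (intro tendsto_intros x_L x_n)
    then show "(\<lambda>n. x n / L n - x n / L n * (x n / real n)) \<longlonglongrightarrow> 1" by simp
  qed (fact x_L)
  have q: "(\<lambda>n. real n * (1 - \<pi> n) ^ (n - j - s) * L n ^ (k - 1)) \<longlonglongrightarrow> exp (- a)" for s
  proof -
    let ?N = "\<lambda>n. real (w n) * (real n - real j - real s)"
    \<comment> \<open>\<open>e\<close> is the error of replacing the exponent by \<open>- c\<close>.
      It splits into the higher-order part of \<open>ln (1 - p)\<close>, the \<open>j + s\<close>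
      missing nodes, and the deviation of \<open>x\<close> from \<open>c\<close>.\<close>
    define e where "e n = ?N n * ln (1 - p n) + c n" for n
    have p_small: "\<forall>\<^sub>F n in sequentially. p n < 1 / 2"
      by (rule order_tendstoD[OF p_tendsto_0]) simp
    have "(\<lambda>n. ?N n * (ln (1 - p n) + p n)) \<longlonglongrightarrow> 0"
    proof (rule Lim_null_comparison)
      show "\<forall>\<^sub>F n in sequentially. norm (?N n * (ln (1 - p n) + p n)) \<le> 2 * (x n / real n * (real n * p n))"
        using p_small eventually_ge_at_top[of "j + s + 1"]
      proof eventually_elim
        case (elim n)
        have "\<bar>ln (1 + (- p n)) - (- p n)\<bar> \<le> 2 * (- p n)\<^sup>2"
          using elim p[of n] by (intro abs_ln_one_plus_x_minus_x_bound) auto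
        then have "\<bar>ln (1 - p n) + p n\<bar> \<le> 2 * (p n)\<^sup>2" by simp
        moreover have "\<bar>?N n\<bar> \<le> real (w n) * real n"
          using elim by (simp add: abs_mult mult_left_mono)
        ultimately have "\<bar>?N n\<bar> * \<bar>ln (1 - p n) + p n\<bar> \<le> (real (w n) * real n) * (2 * (p n)\<^sup>2)"
          by (intro mult_mono) auto
        also have "\<dots> = 2 * (x n / real n * (real n * p n))"
          using elim by (simp add: x_def power2_eq_square)
        finally show ?case by (simp add: abs_mult)
      qed
      have "(\<lambda>n. 2 * (x n / real n * (real n * p n))) \<longlonglongrightarrow> 2 * (0 * 0)"
        by (intro tendsto_intros x_n n_p)
      then show "(\<lambda>n. 2 * (x n / real n * (real n * p n))) \<longlonglongrightarrow> 0" by simp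
    qed
    then have "(\<lambda>n. ?N n * (ln (1 - p n) + p n) + (real j + real s) * (x n / real n) + - (x n - c n)) \<longlonglongrightarrow>
        0 + (real j + real s) * 0 + - 0"
      unfolding x_def using x_n[unfolded x_def] by (intro tendsto_intros w)
    moreover have "\<forall>\<^sub>F n in sequentially. ?N n * (ln (1 - p n) + p n) + (real j + real s) * (x n / real n) + - (x n - c n) = e n"
      using eventually_gt_at_top[of 0] by eventually_elim (simp add: e_def x_def field_simps)
    ultimately have "e \<longlonglongrightarrow> 0 + (real j + real s) * 0 + - 0" by (rule Lim_transform_eventually)
    then have "(\<lambda>n. real n * exp (- c n) * L n ^ (k - 1) * exp (e n)) \<longlonglongrightarrow> exp (- a) * exp 0"
      by (intro tendsto_mult n_exp_minus_c tendsto_exp) simp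
    moreover have "\<forall>\<^sub>F n in sequentially. real n * exp (- c n) * L n ^ (k - 1) * exp (e n) =
        real n * (1 - \<pi> n) ^ (n - j - s) * L n ^ (k - 1)"
      using p_small eventually_ge_at_top[of "j + s"]
    proof eventually_elim
      case (elim n)
      have "(1 - \<pi> n) ^ (n - j - s) = exp (ln (1 - p n)) ^ (w n * (n - j - s))"
        using elim by (simp add: \<pi>_def power_mult)
      also have "\<dots> = exp (real (w n * (n - j - s)) * ln (1 - p n))"
        by (rule exp_of_nat_mult[symmetric])
      also have "real (w n * (n - j - s)) = ?N n"
        using elim by (simp add: of_nat_diff)
      also have "exp (?N n * ln (1 - p n)) = exp (- c n) * exp (e n)"
        by (simp add: e_def exp_add[symmetric])
      finally show ?case by simp
    qed
    ultimately have "(\<lambda>n. real n * (1 - \<pi> n) ^ (n - j - s) * L n ^ (k - 1)) \<longlonglongrightarrow> exp (- a) * exp 0"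
      by (rule Lim_transform_eventually)
    then show ?thesis by simp
  qed
  have ratio: "(\<lambda>n. L n ^ s / L n ^ (k - 1)) \<longlonglongrightarrow> (if s = k - 1 then 1 else 0)" if "s \<le> k - 1" for s
  proof -
    have "(\<lambda>n. (1 / L n) ^ (k - 1 - s)) \<longlonglongrightarrow> 0 ^ (k - 1 - s)"
      by (intro tendsto_power) real_asymp
    moreover have "\<forall>\<^sub>F n in sequentially. (1 / L n) ^ (k - 1 - s) = L n ^ s / L n ^ (k - 1)"
      using L_gt[of 0]
    proof eventually_elim
      case (elim n)
      have "k - 1 = s + (k - 1 - s)" using that by simp
      then have "L n ^ (k - 1) = L n ^ s * L n ^ (k - 1 - s)" by (metis power_add)
      then show ?case using elim by (simp add: power_divide)
    qed
    ultimately have *: "(\<lambda>n. L n ^ s / L n ^ (k - 1)) \<longlonglongrightarrow> 0 ^ (k - 1 - s)" by (rule Lim_transform_eventually)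
    have "0 ^ (k - 1 - s) = (if s = k - 1 then 1 else 0 :: real)"
      using that by (auto simp: power_0_left)
    from *[unfolded this] show ?thesis .
  qed
  have "(\<lambda>n. \<Sum>s\<le>k - 1. real ((n - j) choose s) / real n ^ s * (real n * \<pi> n / L n) ^ s *
      (real n * (1 - \<pi> n) ^ (n - j - s) * L n ^ (k - 1)) * (L n ^ s / L n ^ (k - 1))) \<longlonglongrightarrow>
      (\<Sum>s\<le>k - 1. 1 / fact s * 1 ^ s * exp (- a) * (if s = k - 1 then 1 else 0))"
    by (intro tendsto_sum tendsto_mult binomial_over_power_tendsto tendsto_power \<pi>_L q ratio) auto
  also have "(\<Sum>s\<le>k - 1. 1 / fact s * 1 ^ s * exp (- a) * (if s = k - 1 then 1 else 0)) = exp (- a) / fact (k - 1)"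
    by (simp add: if_distrib[of "(*) _"] cong: if_cong)
  finally have *: "(\<lambda>n. \<Sum>s\<le>k - 1. real ((n - j) choose s) / real n ^ s * (real n * \<pi> n / L n) ^ s *
      (real n * (1 - \<pi> n) ^ (n - j - s) * L n ^ (k - 1)) * (L n ^ s / L n ^ (k - 1))) \<longlonglongrightarrow> exp (- a) / fact (k - 1)" .
  have "\<forall>\<^sub>F n in sequentially. (\<Sum>s\<le>k - 1. real ((n - j) choose s) / real n ^ s * (real n * \<pi> n / L n) ^ s *
      (real n * (1 - \<pi> n) ^ (n - j - s) * L n ^ (k - 1)) * (L n ^ s / L n ^ (k - 1))) =
      real n * low_count (n - j) (p n) (w n) (k - 1)"
    using L_gt[of 0] eventually_gt_at_top[of 0]
  proof eventually_elim
    case (elim n)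
    have "real n * low_count (n - j) (p n) (w n) (k - 1) = (\<Sum>s\<le>k - 1. real n * pmf (binomial_pmf (n - j) (\<pi> n)) s)"
      unfolding low_count_def \<pi>_def by (simp add: measure_measure_pmf_finite sum_distrib_left)
    also have "\<dots> = (\<Sum>s\<le>k - 1. real ((n - j) choose s) / real n ^ s * (real n * \<pi> n / L n) ^ s *
      (real n * (1 - \<pi> n) ^ (n - j - s) * L n ^ (k - 1)) * (L n ^ s / L n ^ (k - 1)))"
      using elim \<pi>[of n] by (intro sum.cong refl) (simp add: power_divide power_mult_distrib)
    finally show ?case by simp
  qed
  with * show ?thesis by (rule Lim_transform_eventually)
qed

text \<open>Only single object sets need an upper bound, so no set size occurs; the factor 2 is that
  of \<open>binomial_upper_tail\<close>.\<close>

definition hi :: "nat \<Rightarrow> nat" where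
  "hi n = nat \<lfloor>(1 + 2 * \<epsilon> n) * \<mu> n\<rfloor>"

lemma close_to_mean:
  fixes w :: "nat \<Rightarrow> nat"
  assumes "\<forall>\<^sub>F n in sequentially. \<bar>real (w n) - \<mu> n\<bar> \<le> 3 * \<epsilon> n * \<mu> n + 1"
  shows "(\<lambda>n. real n * p n * real (w n) - c n) \<longlonglongrightarrow> 0"
proof (rule Lim_null_comparison)
  show "\<forall>\<^sub>F n in sequentially. norm (real n * p n * real (w n) - c n) \<le> 3 * (\<epsilon> n * c n) + real n * p n"
    using assms
  proof eventually_elim
    case (elim n)
    have c: "c n = real n * p n * \<mu> n" by (simp add: c_def \<mu>_def power2_eq_square)
    have "norm (real n * p n * real (w n) - c n) = real n * p n * \<bar>real (w n) - \<mu> n\<bar>"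
      using p[of n] by (simp add: c abs_mult flip: right_diff_distrib)
    also have "\<dots> \<le> real n * p n * (3 * \<epsilon> n * \<mu> n + 1)"
      using p[of n] elim by (intro mult_left_mono) auto
    also have "\<dots> = 3 * (\<epsilon> n * c n) + real n * p n" by (simp add: c algebra_simps)
    finally show ?case .
  qed
  have "(\<lambda>n. 3 * (\<epsilon> n * c n) + real n * p n) \<longlonglongrightarrow> 3 * 0 + 0"
    by (intro tendsto_intros \<epsilon>_c n_p)
  then show "(\<lambda>n. 3 * (\<epsilon> n * c n) + real n * p n) \<longlonglongrightarrow> 0" by simp
qed

lemma n_low_count_lo: "(\<lambda>n. real n * low_count (n - j) (p n) (lo n 1) (k - 1)) \<longlonglongrightarrow> exp (- a) / fact (k - 1)"
proof (rule n_low_count_tendsto[OF close_to_mean])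
  show "\<forall>\<^sub>F n in sequentially. \<bar>real (lo n 1) - \<mu> n\<bar> \<le> 3 * \<epsilon> n * \<mu> n + 1"
    using lo_le \<epsilon>_pos
  proof eventually_elim
    case (elim n)
    have "real (lo n 1) \<le> \<mu> n" using elim by (auto dest: spec[of _ 1])
    moreover have "(1 - 3 * \<epsilon> n) * (real 1 * \<mu> n) \<le> real (lo n 1)" by (rule lo_ge)
    ultimately show ?case by (simp add: algebra_simps abs_le_iff)
  qed
qed

lemma n_low_count_hi: "(\<lambda>n. real n * low_count (n - j) (p n) (hi n) (k - 1)) \<longlonglongrightarrow> exp (- a) / fact (k - 1)"
proof (rule n_low_count_tendsto[OF close_to_mean])
  show "\<forall>\<^sub>F n in sequentially. \<bar>real (hi n) - \<mu> n\<bar> \<le> 3 * \<epsilon> n * \<mu> n + 1"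
    using \<epsilon>_pos
  proof eventually_elim
    case (elim n)
    have "0 \<le> \<epsilon> n * \<mu> n" using elim \<mu>_nonneg[of n] by simp
    moreover have "(1 + 2 * \<epsilon> n) * \<mu> n = \<mu> n + 2 * (\<epsilon> n * \<mu> n)" by (simp add: algebra_simps)
    ultimately show ?case using \<mu>_nonneg[of n] unfolding hi_def by (simp add: mult.assoc) linarith
  qed
qed

end

section \<open>The limits for the random graph at the threshold\<close>

context threshold
begin

sublocale rig: incidence "{1..n}" "{1..P n}" "p n" for n :: nat
  by unfold_locales (use p in auto)

lemma prob_few_objects_le:
  "\<forall>\<^sub>F n in sequentially. \<forall>A\<subseteq>{1..n}.
    rig.prob n (\<lambda>f. card (rig.objects n f A) < lo n (card A)) \<le> exp (- ((\<epsilon> n)\<^sup>2 * (real (card A) * \<mu> n)))"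
  using \<epsilon>_pos \<epsilon>_le[of 1, simplified] n_p_le_\<epsilon>
proof eventually_elim
  case (elim n)
  show ?case
  proof (intro allI impI)
    fix A assume A: "A \<subseteq> {1..n}"
    have "card A \<le> n" using card_mono[OF _ A] by simp
    then have "real (card A) * p n \<le> real n * p n" using p[of n] by (intro mult_right_mono) auto
    then have small: "real (card A) * p n \<le> \<epsilon> n" using elim by simp
    have "rig.prob n (\<lambda>f. card (rig.objects n f A) < lo n (card A)) =
        measure_pmf.prob (binomial_pmf (P n) (1 - (1 - p n) ^ card A)) {x. x < lo n (card A)}"
      using rig.card_objects_binomial[OF A, of "\<lambda>x. x < lo n (card A)"] by simp
    also have "\<dots> \<le> measure_pmf.prob (binomial_pmf (P n) (1 - (1 - p n) ^ card A))
        {x. real x < (1 - 3 * \<epsilon> n) * (real (card A) * p n * real (P n))}"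
      by (intro measure_pmf_prob_mono) (simp add: lo_def \<mu>_def mult.assoc, linarith)
    also have "\<dots> \<le> exp (- ((\<epsilon> n)\<^sup>2 * (real (card A) * p n * real (P n))))"
      using elim p small by (intro binomial_lower_tail) auto
    finally show "rig.prob n (\<lambda>f. card (rig.objects n f A) < lo n (card A)) \<le> exp (- ((\<epsilon> n)\<^sup>2 * (real (card A) * \<mu> n)))"
      by (simp add: \<mu>_def mult.assoc)
  qed
qed

lemma P_p_squared: "0 < n \<Longrightarrow> real (P n) * (p n)\<^sup>2 = c n / real n"
  by (simp add: c_def)

lemma prob_unstable_le:
  "\<forall>\<^sub>F n in sequentially. \<forall>A\<subseteq>{1..n}.
    rig.prob n (\<lambda>f. \<not> rig.stable n f A \<and> card (rig.boundary n f A) \<le> m) \<le> unstable_bound n (card A) m"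
  using prob_few_objects_le eventually_gt_at_top[of 0]
proof eventually_elim
  case (elim n)
  show ?case
  proof (intro allI impI)
    fix A assume A: "A \<subseteq> {1..n}"
    show "rig.prob n (\<lambda>f. \<not> rig.stable n f A \<and> card (rig.boundary n f A) \<le> m) \<le> unstable_bound n (card A) m"
    proof -
      have "rig.prob n (\<lambda>f. \<not> rig.stable n f A \<and> card (rig.boundary n f A) \<le> m) \<le>
          rig.prob n (\<lambda>f. card (rig.objects n f A) < lo n (card A)) +
          (real (card A))\<^sup>2 * (c n / real n) * low_count (n - card A) (p n) (lo n (card A)) m"
        using rig.prob_unstable_sparse_boundary_le[OF A, of m "lo n (card A)"] P_p_squared[OF elim(2)] by simp
      moreover have "rig.prob n (\<lambda>f. card (rig.objects n f A) < lo n (card A)) \<le> exp (- ((\<epsilon> n)\<^sup>2 * (real (card A) * \<mu> n)))"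
        using elim(1) A by blast
      ultimately show ?thesis unfolding unstable_bound_def by linarith
    qed
  qed
qed

lemma prob_low_degrees_le:
  "\<forall>\<^sub>F n in sequentially. \<forall>A\<subseteq>{1..n}. card A = j \<longrightarrow> rig.prob n (\<lambda>f. \<forall>v\<in>A. rig.degree n f v \<le> m) \<le>
    real j * exp (- ((\<epsilon> n)\<^sup>2 * \<mu> n)) + low_count (n - j) (p n) (lo n 1) m ^ j + unstable_bound n j (j * m)"
  using prob_few_objects_le prob_unstable_le[of "j * m"]
proof eventually_elim
  case (elim n)
  show ?case
  proof (intro allI impI)
    fix A assume A: "A \<subseteq> {1..n}" and j: "card A = j"
    have fin: "finite A" using A finite_subset by blast
    have "rig.prob n (\<lambda>f. \<exists>v\<in>A. card (rig.objects n f {v}) < lo n 1) \<le>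
        (\<Sum>v\<in>A. rig.prob n (\<lambda>f. card (rig.objects n f {v}) < lo n 1))"
      using fin by (intro measure_pmf_prob_le_sum) auto
    also have "\<dots> \<le> (\<Sum>v\<in>A. exp (- ((\<epsilon> n)\<^sup>2 * \<mu> n)))"
    proof (intro sum_mono)
      fix v assume "v \<in> A"
      then have "{v} \<subseteq> {1..n}" using A by auto
      then have "rig.prob n (\<lambda>f. card (rig.objects n f {v}) < lo n (card {v})) \<le> exp (- ((\<epsilon> n)\<^sup>2 * (real (card {v}) * \<mu> n)))"
        using elim(1) by blast
      then show "rig.prob n (\<lambda>f. card (rig.objects n f {v}) < lo n 1) \<le> exp (- ((\<epsilon> n)\<^sup>2 * \<mu> n))" by simp
    qed
    finally have 1: "rig.prob n (\<lambda>f. \<exists>v\<in>A. card (rig.objects n f {v}) < lo n 1) \<le> real j * exp (- ((\<epsilon> n)\<^sup>2 * \<mu> n))"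
      using j by simp
    have 2: "rig.prob n (\<lambda>f. \<not> rig.stable n f A \<and> card (rig.boundary n f A) \<le> j * m) \<le> unstable_bound n j (j * m)"
      using elim(2) A j by blast
    have "rig.prob n (\<lambda>f. \<forall>v\<in>A. rig.degree n f v \<le> m) \<le>
        rig.prob n (\<lambda>f. \<exists>v\<in>A. card (rig.objects n f {v}) < lo n 1) + low_count (n - j) (p n) (lo n 1) m ^ j +
        rig.prob n (\<lambda>f. \<not> rig.stable n f A \<and> card (rig.boundary n f A) \<le> j * m)"
      using rig.prob_all_degrees_le[OF A, of m "lo n 1"] unfolding j card_atLeastAtMost by simp
    with 1 2 show "rig.prob n (\<lambda>f. \<forall>v\<in>A. rig.degree n f v \<le> m) \<le>
      real j * exp (- ((\<epsilon> n)\<^sup>2 * \<mu> n)) + low_count (n - j) (p n) (lo n 1) m ^ j + unstable_bound n j (j * m)"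
      by linarith
  qed
qed

text \<open>The first factor bounds from below the probability that \<open>A\<close> is stable and
  none of its object sets exceeds \<open>hi n\<close>.\<close>

lemma prob_low_degrees_ge:
  "\<forall>\<^sub>F n in sequentially. \<forall>A\<subseteq>{1..n}. card A = j \<longrightarrow>
    (1 - (real j)\<^sup>2 * (c n / real n) - real j * exp (- ((\<epsilon> n)\<^sup>2 * \<mu> n))) *
      low_count (n - j) (p n) (hi n) m ^ j \<le> rig.prob n (\<lambda>f. \<forall>v\<in>A. rig.degree n f v \<le> m)"
  using \<epsilon>_pos \<epsilon>_le[of 1, simplified] eventually_gt_at_top[of 0]
proof eventually_elim
  case (elim n)
  show ?case
  proof (intro allI impI)
    fix A assume A: "A \<subseteq> {1..n}" and j: "card A = j"
    have fin: "finite A" using A finite_subset by blast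
    let ?Q = "\<lambda>f. rig.stable n f A \<and> (\<forall>v\<in>A. card (rig.objects n f {v}) \<le> hi n)"
    have "rig.prob n (\<lambda>f. \<exists>v\<in>A. hi n < card (rig.objects n f {v})) \<le>
        (\<Sum>v\<in>A. rig.prob n (\<lambda>f. hi n < card (rig.objects n f {v})))"
      using fin by (intro measure_pmf_prob_le_sum) auto
    also have "\<dots> \<le> (\<Sum>v\<in>A. exp (- ((\<epsilon> n)\<^sup>2 * \<mu> n)))"
    proof (intro sum_mono)
      fix v assume "v \<in> A"
      then have v: "{v} \<subseteq> {1..n}" using A by auto
      have "rig.prob n (\<lambda>f. hi n < card (rig.objects n f {v})) = measure_pmf.prob (binomial_pmf (P n) (p n)) {x. hi n < x}"
        using rig.card_objects_binomial[OF v, of "\<lambda>x. hi n < x"] by simp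
      also have "\<dots> \<le> measure_pmf.prob (binomial_pmf (P n) (p n)) {x. (1 + 2 * \<epsilon> n) * (p n * real (P n)) < real x}"
        using elim by (intro measure_pmf_prob_mono) (simp add: hi_def \<mu>_def, linarith)
      also have "\<dots> \<le> exp (- ((\<epsilon> n)\<^sup>2 * \<mu> n))"
        unfolding \<mu>_def using elim p by (intro binomial_upper_tail) auto
      finally show "rig.prob n (\<lambda>f. hi n < card (rig.objects n f {v})) \<le> exp (- ((\<epsilon> n)\<^sup>2 * \<mu> n))" .
    qed
    finally have 1: "rig.prob n (\<lambda>f. \<exists>v\<in>A. hi n < card (rig.objects n f {v})) \<le> real j * exp (- ((\<epsilon> n)\<^sup>2 * \<mu> n))"
      using j by simp
    have 2: "rig.prob n (\<lambda>f. \<not> rig.stable n f A) \<le> (real j)\<^sup>2 * (c n / real n)"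
      using rig.prob_not_stable_le[OF A] P_p_squared[OF elim(3)] j by simp
    have "rig.prob n (\<lambda>f. True) \<le> rig.prob n ?Q + rig.prob n (\<lambda>f. \<not> ?Q f)"
      by (rule measure_pmf_prob_le_add) auto
    moreover have "rig.prob n (\<lambda>f. \<not> ?Q f) \<le> rig.prob n (\<lambda>f. \<not> rig.stable n f A) +
        rig.prob n (\<lambda>f. \<exists>v\<in>A. hi n < card (rig.objects n f {v}))"
      by (rule measure_pmf_prob_le_add) (auto simp: not_le)
    moreover have "rig.prob n (\<lambda>f. True) = 1" by simp
    ultimately have "1 - (real j)\<^sup>2 * (c n / real n) - real j * exp (- ((\<epsilon> n)\<^sup>2 * \<mu> n)) \<le> rig.prob n ?Q"
      using 1 2 by linarith
    then have "(1 - (real j)\<^sup>2 * (c n / real n) - real j * exp (- ((\<epsilon> n)\<^sup>2 * \<mu> n))) * low_count (n - j) (p n) (hi n) m ^ j \<le>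
        rig.prob n ?Q * low_count (n - j) (p n) (hi n) m ^ j"
      by (intro mult_right_mono) (auto simp: low_count_nonneg)
    also have "\<dots> \<le> rig.prob n (\<lambda>f. \<forall>v\<in>A. rig.degree n f v \<le> m)"
      using rig.prob_all_degrees_ge[OF A, of "hi n" m] unfolding j card_atLeastAtMost by simp
    finally show "(1 - (real j)\<^sup>2 * (c n / real n) - real j * exp (- ((\<epsilon> n)\<^sup>2 * \<mu> n))) *
      low_count (n - j) (p n) (hi n) m ^ j \<le> rig.prob n (\<lambda>f. \<forall>v\<in>A. rig.degree n f v \<le> m)" .
  qed
qed

lemma n_power_exp_\<epsilon>: "(\<lambda>n. real n ^ j * exp (- ((\<epsilon> n)\<^sup>2 * \<mu> n))) \<longlonglongrightarrow> 0"
proof (rule tendsto_sandwich[OF _ _ tendsto_const])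
  show "\<forall>\<^sub>F n in sequentially. real n ^ j * exp (- ((\<epsilon> n)\<^sup>2 * \<mu> n)) \<le> 1 / real n"
    using n_exp_\<epsilon>[of "Suc j"] eventually_gt_at_top[of 0]
  proof eventually_elim
    case (elim n)
    have "real n ^ j * exp (- ((\<epsilon> n)\<^sup>2 * \<mu> n)) \<le> real n ^ j * (1 / real n) ^ Suc j"
      using elim by (intro mult_left_mono) auto
    also have "\<dots> = 1 / real n" using elim by (simp add: power_divide)
    finally show ?case .
  qed
  show "(\<lambda>n. 1 / real n) \<longlonglongrightarrow> 0" by real_asymp
qed simp

text \<open>For fixed \<open>j\<close> the loss \<open>c j\<^sup>2 / n\<close> is bounded and so is
  \<open>n ^ j * exp (- j c)\<close>; the edge still contributes the vanishing factor
  \<open>c / n\<close>.\<close>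

lemma n_power_unstable_bound: "(\<lambda>n. real n ^ j * unstable_bound n j m) \<longlonglongrightarrow> 0" if j: "1 \<le> j"
proof (rule tendsto_sandwich[OF _ _ tendsto_const])
  define B where "B = (exp (- a) + 1) ^ j"
  define C where "C = (real j)\<^sup>2 * ((real m + 1) * real j ^ m) * B * exp (real j + (real j)\<^sup>2)"
  show "\<forall>\<^sub>F n in sequentially. 0 \<le> real n ^ j * unstable_bound n j m"
    by (intro always_eventually allI) (auto simp: unstable_bound_def low_count_nonneg c_nonneg)
  have "\<forall>\<^sub>F n in sequentially. c n ^ 1 / real n < 1"
    by (rule order_tendstoD[OF c_power_over]) simp
  then show "\<forall>\<^sub>F n in sequentially. real n ^ j * unstable_bound n j m \<le>
      real n ^ j * exp (- ((\<epsilon> n)\<^sup>2 * \<mu> n)) + C * (c n / real n * (1 + c n) ^ m)"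
    using low_count_lo_le[of m] n_exp_minus_c_le eventually_ge_at_top[of "2 * j"] eventually_gt_at_top[of 0]
  proof eventually_elim
    case (elim n)
    have "1 * ((\<epsilon> n)\<^sup>2 * \<mu> n) \<le> real j * ((\<epsilon> n)\<^sup>2 * \<mu> n)"
      using j \<mu>_nonneg[of n] by (intro mult_right_mono) auto
    then have 1: "real n ^ j * exp (- ((\<epsilon> n)\<^sup>2 * (real j * \<mu> n))) \<le> real n ^ j * exp (- ((\<epsilon> n)\<^sup>2 * \<mu> n))"
      by (intro mult_left_mono) (auto simp: algebra_simps)
    have "low_count (n - j) (p n) (lo n j) m \<le>
      (real m + 1) * (real j * (1 + c n)) ^ m * exp (- (real j * c n) + real j + c n * (real j)\<^sup>2 / real n)"
      using elim j by blast
    also have "\<dots> \<le> (real m + 1) * (real j * (1 + c n)) ^ m * exp (- (real j * c n) + (real j + (real j)\<^sup>2))"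
    proof -
      have "c n / real n * (real j)\<^sup>2 \<le> 1 * (real j)\<^sup>2" using elim by (intro mult_right_mono) auto
      then show ?thesis using c_nonneg[of n] by (intro mult_left_mono) auto
    qed
    finally have low: "low_count (n - j) (p n) (lo n j) m \<le>
        (real m + 1) * (real j * (1 + c n)) ^ m * exp (- (real j * c n) + (real j + (real j)\<^sup>2))" .
    have "real n ^ j * ((real j)\<^sup>2 * (c n / real n) * low_count (n - j) (p n) (lo n j) m) \<le>
        real n ^ j * ((real j)\<^sup>2 * (c n / real n) * ((real m + 1) * (real j * (1 + c n)) ^ m * exp (- (real j * c n) + (real j + (real j)\<^sup>2))))"
      using low c_nonneg[of n] by (intro mult_left_mono) auto
    also have "\<dots> = (real j)\<^sup>2 * ((real m + 1) * real j ^ m) * (real n * exp (- c n)) ^ j * exp (real j + (real j)\<^sup>2) *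
        (c n / real n * (1 + c n) ^ m)"
    proof -
      have "exp (- (real j * c n) + (real j + (real j)\<^sup>2)) = exp (- c n) ^ j * exp (real j + (real j)\<^sup>2)"
        by (simp add: exp_of_nat_mult[symmetric] exp_add[symmetric])
      then show ?thesis unfolding power_mult_distrib by (simp add: ac_simps)
    qed
    also have "\<dots> \<le> C * (c n / real n * (1 + c n) ^ m)"
      unfolding C_def B_def using elim c_nonneg[of n] by (intro mult_right_mono mult_left_mono power_mono) auto
    finally show ?case using 1 by (simp add: unstable_bound_def distrib_left)
  qed
  have "(\<lambda>n. real n ^ j * exp (- ((\<epsilon> n)\<^sup>2 * \<mu> n)) + C * (c n / real n * (1 + c n) ^ m)) \<longlonglongrightarrow> 0 + C * 0"
    by (intro tendsto_intros n_power_exp_\<epsilon> polylog_over)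
  then show "(\<lambda>n. real n ^ j * exp (- ((\<epsilon> n)\<^sup>2 * \<mu> n)) + C * (c n / real n * (1 + c n) ^ m)) \<longlonglongrightarrow> 0" by simp
qed

definition lam :: real where "lam = exp (- a) / fact (k - 1)"

text \<open>There are about \<open>n ^ j / j!\<close> sets of \<open>j\<close> nodes, and the
  probability that all degrees in one of them are low is \<open>(lam / n) ^ j\<close> up to terms
  that are negligible even after multiplication by \<open>n ^ j\<close>.\<close>

lemma factorial_moments:
  "(\<lambda>n. measure_pmf.expectation (rig.M n) (\<lambda>f. real (card {v \<in> {1..n}. rig.degree n f v \<le> k - 1} choose j)))
    \<longlonglongrightarrow> lam ^ j / fact j"
proof (cases "j = 0")
  case False
  then have j: "1 \<le> j" by simp
  define up where "up n = real j * exp (- ((\<epsilon> n)\<^sup>2 * \<mu> n)) + low_count (n - j) (p n) (lo n 1) (k - 1) ^ j +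
    unstable_bound n j (j * (k - 1))" for n
  define dn where "dn n = (1 - (real j)\<^sup>2 * (c n / real n) - real j * exp (- ((\<epsilon> n)\<^sup>2 * \<mu> n))) *
      low_count (n - j) (p n) (hi n) (k - 1) ^ j" for n
  let ?E = "\<lambda>n. measure_pmf.expectation (rig.M n) (\<lambda>f. real (card {v \<in> {1..n}. rig.degree n f v \<le> k - 1} choose j))"
  have card_sets: "card {A. A \<subseteq> {1..n} \<and> card A = j} = n choose j" for n
    by (subst n_subsets) auto
  have "(\<lambda>n. real j * (real n ^ j * exp (- ((\<epsilon> n)\<^sup>2 * \<mu> n))) + (real n * low_count (n - j) (p n) (lo n 1) (k - 1)) ^ j +
      real n ^ j * unstable_bound n j (j * (k - 1))) \<longlonglongrightarrow> real j * 0 + lam ^ j + 0"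
    unfolding lam_def by (intro tendsto_intros n_power_exp_\<epsilon> n_low_count_lo n_power_unstable_bound j)
  then have "(\<lambda>n. real n ^ j * up n) \<longlonglongrightarrow> lam ^ j"
    by (simp add: up_def power_mult_distrib algebra_simps)
  from tendsto_mult[OF binomial_over_power_tendsto[of 0 j] this]
  have "(\<lambda>n. real (n choose j) / real n ^ j * (real n ^ j * up n)) \<longlonglongrightarrow> lam ^ j / fact j" by simp
  moreover have "\<forall>\<^sub>F n in sequentially. real (n choose j) / real n ^ j * (real n ^ j * up n) = real (n choose j) * up n"
    using eventually_gt_at_top[of 0] by eventually_elim simp
  ultimately have up: "(\<lambda>n. real (n choose j) * up n) \<longlonglongrightarrow> lam ^ j / fact j" by (rule Lim_transform_eventually)
  have "(\<lambda>n. (1 - (real j)\<^sup>2 * (c n ^ 1 / real n) - real j * (real n ^ 0 * exp (- ((\<epsilon> n)\<^sup>2 * \<mu> n)))) *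
      (real n * low_count (n - j) (p n) (hi n) (k - 1)) ^ j) \<longlonglongrightarrow> (1 - (real j)\<^sup>2 * 0 - real j * 0) * lam ^ j"
    unfolding lam_def by (intro tendsto_intros n_power_exp_\<epsilon> n_low_count_hi c_power_over)
  then have "(\<lambda>n. real n ^ j * dn n) \<longlonglongrightarrow> lam ^ j"
    by (simp add: dn_def power_mult_distrib ac_simps)
  from tendsto_mult[OF binomial_over_power_tendsto[of 0 j] this]
  have "(\<lambda>n. real (n choose j) / real n ^ j * (real n ^ j * dn n)) \<longlonglongrightarrow> lam ^ j / fact j" by simp
  moreover have "\<forall>\<^sub>F n in sequentially. real (n choose j) / real n ^ j * (real n ^ j * dn n) = real (n choose j) * dn n"
    using eventually_gt_at_top[of 0] by eventually_elim simp
  ultimately have dn: "(\<lambda>n. real (n choose j) * dn n) \<longlonglongrightarrow> lam ^ j / fact j" by (rule Lim_transform_eventually)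
  show ?thesis
  proof (rule tendsto_sandwich[OF _ _ dn up])
    show "\<forall>\<^sub>F n in sequentially. real (n choose j) * dn n \<le> ?E n"
      using prob_low_degrees_ge[of j "k - 1"]
    proof eventually_elim
      case (elim n)
      have "real (n choose j) * dn n = (\<Sum>A | A \<subseteq> {1..n} \<and> card A = j. dn n)"
        by (simp only: sum_constant card_sets)
      also have "\<dots> \<le> (\<Sum>A | A \<subseteq> {1..n} \<and> card A = j. rig.prob n (\<lambda>f. \<forall>v\<in>A. rig.degree n f v \<le> k - 1))"
        using elim unfolding dn_def by (intro sum_mono) blast
      finally show ?case unfolding rig.expectation_choose_low_degrees .
    qed
    show "\<forall>\<^sub>F n in sequentially. ?E n \<le> real (n choose j) * up n"
      using prob_low_degrees_le[of j "k - 1"]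
    proof eventually_elim
      case (elim n)
      have "(\<Sum>A | A \<subseteq> {1..n} \<and> card A = j. rig.prob n (\<lambda>f. \<forall>v\<in>A. rig.degree n f v \<le> k - 1)) \<le>
          (\<Sum>A | A \<subseteq> {1..n} \<and> card A = j. up n)"
        using elim unfolding up_def by (intro sum_mono) blast
      also have "\<dots> = real (n choose j) * up n"
        by (simp only: sum_constant card_sets)
      finally show ?case unfolding rig.expectation_choose_low_degrees .
    qed
  qed
qed simp

lemma prob_eq: "measure_pmf.prob (binomial_intersection_graph n (P n) (p n)) {G. Q G} = rig.prob n (\<lambda>f. Q (rig.graph n f))"
  unfolding binomial_intersection_graph_def rig.map_graph_M[symmetric] by (simp add: vimage_def)

lemma min_degree_limit:
  "(\<lambda>n. measure_pmf.prob (binomial_intersection_graph n (P n) (p n)) {G. k \<le> min_node_degree G})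
    \<longlonglongrightarrow> exp (- (exp (- a) / fact (k - 1)))"
proof -
  have "(\<lambda>n. rig.prob n (\<lambda>f. card {v \<in> {1..n}. rig.degree n f v \<le> k - 1} = 0)) \<longlonglongrightarrow> exp (- lam)"
    by (rule poisson_limit_of_factorial_moments[OF rig.finite_set_M factorial_moments])
  moreover have "\<forall>\<^sub>F n in sequentially. rig.prob n (\<lambda>f. card {v \<in> {1..n}. rig.degree n f v \<le> k - 1} = 0) =
      measure_pmf.prob (binomial_intersection_graph n (P n) (p n)) {G. k \<le> min_node_degree G}"
    using eventually_gt_at_top[of 0]
  proof eventually_elim
    case (elim n)
    show ?case unfolding prob_eq
    proof (rule measure_pmf_prob_cong)
      fix f assume f: "f \<in> set_pmf (rig.M n)"
      have "k \<le> min_node_degree (rig.graph n f) \<longleftrightarrow> (\<forall>v\<in>{1..n}. k \<le> rig.degree n f v)"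
        using elim by (intro rig.min_node_degree_graph[OF f]) auto
      also have "\<dots> \<longleftrightarrow> (\<forall>v\<in>{1..n}. \<not> rig.degree n f v \<le> k - 1)"
        using k_pos by (intro ball_cong) auto
      also have "\<dots> \<longleftrightarrow> card {v \<in> {1..n}. rig.degree n f v \<le> k - 1} = 0" by (subst card_0_eq) auto
      finally show "(card {v \<in> {1..n}. rig.degree n f v \<le> k - 1} = 0) = (k \<le> min_node_degree (rig.graph n f))" by simp
    qed
  qed
  ultimately show ?thesis unfolding lam_def by (rule Lim_transform_eventually)
qed

text \<open>Connectivity implies the degree condition, and the probability that only the latter
  holds is at most the union bound of \<open>sum_unstable_bound\<close>. The sizes start at 2
  because the sets contain an edge.\<close>

lemma connectivity_limit:
  "(\<lambda>n. measure_pmf.prob (binomial_intersection_graph n (P n) (p n)) {G. k_connected k G})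
    \<longlonglongrightarrow> exp (- (exp (- a) / fact (k - 1)))"
proof (rule tendsto_sandwich[OF _ _ _ min_degree_limit])
  let ?mindeg = "\<lambda>n. measure_pmf.prob (binomial_intersection_graph n (P n) (p n)) {G. k \<le> min_node_degree G}"
  let ?S = "\<lambda>n. \<Sum>r\<in>{2..n div 2}. real (n choose r) * unstable_bound n r (k - 1)"
  show "\<forall>\<^sub>F n in sequentially. measure_pmf.prob (binomial_intersection_graph n (P n) (p n)) {G. k_connected k G} \<le> ?mindeg n"
    using eventually_ge_at_top[of 2]
  proof eventually_elim
    case (elim n)
    show ?case unfolding prob_eq
    proof (intro measure_pmf_prob_mono k_connected_imp_min_node_degree)
      fix f show "finite (nodes (rig.graph n f))" unfolding rig.nodes_graph by simp
      show "2 \<le> card (nodes (rig.graph n f))" unfolding rig.nodes_graph using elim by simp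
    qed
  qed
  have "(\<lambda>n. ?mindeg n - ?S n) \<longlonglongrightarrow> exp (- (exp (- a) / fact (k - 1))) - 0"
    by (intro tendsto_diff min_degree_limit sum_unstable_bound)
  then show "(\<lambda>n. ?mindeg n - ?S n) \<longlonglongrightarrow> exp (- (exp (- a) / fact (k - 1)))" by simp
  show "\<forall>\<^sub>F n in sequentially. ?mindeg n - ?S n \<le> measure_pmf.prob (binomial_intersection_graph n (P n) (p n)) {G. k_connected k G}"
    using prob_unstable_le[of "k - 1"] eventually_gt_at_top[of 0]
  proof eventually_elim
    case (elim n)
    let ?bad = "\<lambda>A f. \<not> rig.stable n f A \<and> card (rig.boundary n f A) \<le> k - 1"
    have "?mindeg n \<le> rig.prob n (\<lambda>f. k_connected k (rig.graph n f)) +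
        rig.prob n (\<lambda>f. \<exists>r\<in>{2..n div 2}. \<exists>A\<in>{A. A \<subseteq> {1..n} \<and> card A = r}. ?bad A f)"
      unfolding prob_eq
    proof (rule measure_pmf_prob_le_add)
      fix f assume f: "f \<in> set_pmf (rig.M n)" and deg: "k \<le> min_node_degree (rig.graph n f)"
      have deg: "\<forall>v\<in>{1..n}. k \<le> rig.degree n f v"
        using rig.min_node_degree_graph[OF f] deg elim by simp
      have "\<exists>r\<in>{2..n div 2}. \<exists>A\<in>{A. A \<subseteq> {1..n} \<and> card A = r}. ?bad A f"
        if not_con: "\<not> k_connected k (rig.graph n f)"
      proof -
        from rig.not_k_connected_imp_sparse_boundary[OF f deg not_con]
        obtain A where "A \<subseteq> {1..n}" "2 \<le> card A" "2 * card A \<le> card {1..n}" "\<not> rig.stable n f A"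
          "card (rig.boundary n f A) < k" by blast
        then show ?thesis
          by (intro bexI[of _ "card A"] bexI[of _ A]) auto
      qed
      then show "k_connected k (rig.graph n f) \<or> (\<exists>r\<in>{2..n div 2}. \<exists>A\<in>{A. A \<subseteq> {1..n} \<and> card A = r}. ?bad A f)"
        by blast
    qed
    also have "rig.prob n (\<lambda>f. \<exists>r\<in>{2..n div 2}. \<exists>A\<in>{A. A \<subseteq> {1..n} \<and> card A = r}. ?bad A f) \<le>
        (\<Sum>r\<in>{2..n div 2}. rig.prob n (\<lambda>f. \<exists>A\<in>{A. A \<subseteq> {1..n} \<and> card A = r}. ?bad A f))"
      by (rule measure_pmf_prob_le_sum) auto
    also have "\<dots> \<le> ?S n"
    proof (rule sum_mono)
      fix r
      have "rig.prob n (\<lambda>f. \<exists>A\<in>{A. A \<subseteq> {1..n} \<and> card A = r}. ?bad A f) \<le>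
          (\<Sum>A\<in>{A. A \<subseteq> {1..n} \<and> card A = r}. rig.prob n (?bad A))"
        by (rule measure_pmf_prob_le_sum) auto
      also have "\<dots> \<le> (\<Sum>A\<in>{A. A \<subseteq> {1..n} \<and> card A = r}. unstable_bound n r (k - 1))"
        using elim(1) by (intro sum_mono) blast
      also have "\<dots> = real (n choose r) * unstable_bound n r (k - 1)"
        by (simp only: sum_constant n_subsets[OF finite_atLeastAtMost] card_atLeastAtMost) simp
      finally show "rig.prob n (\<lambda>f. \<exists>A\<in>{A. A \<subseteq> {1..n} \<and> card A = r}. ?bad A f) \<le>
        real (n choose r) * unstable_bound n r (k - 1)" .
    qed
    finally show ?case unfolding prob_eq by simp
  qed
qed

end

section \<open>Monotonicity in the inclusion probability\<close>

text \<open>Keep each success of the larger probability with probability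
  \<open>p / p'\<close>.\<close>

lemma bernoulli_pmf_thinning:
  assumes "0 \<le> p" "p \<le> p'" "p' \<le> 1" "0 < p'"
  shows "bernoulli_pmf p = bind_pmf (bernoulli_pmf p') (\<lambda>b. if b then bernoulli_pmf (p / p') else return_pmf False)"
    (is "_ = ?B")
proof -
  have "pmf ?B True = p"
    using assms by (simp add: pmf_bind integral_measure_pmf_real[where A = UNIV] UNIV_bool)
  moreover have "sum (pmf ?B) UNIV = 1" by (rule sum_pmf_eq_1) auto
  ultimately have "pmf ?B True = p" "pmf ?B False = 1 - p" by (auto simp: UNIV_bool)
  then show ?thesis
    using assms by (intro pmf_eqI) (case_tac i; simp)
qed

text \<open>Thin a sample for \<open>p'\<close> to one for \<open>p\<close>: the thinned family lies
  below the original, so it can satisfy \<open>Q\<close> only if the original does.\<close>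

lemma prob_Pi_pmf_bernoulli_mono:
  assumes "finite I" "0 \<le> p" "p \<le> p'" "p' \<le> 1"
    and mono: "\<And>f g. (\<And>x. f x \<Longrightarrow> g x) \<Longrightarrow> Q f \<Longrightarrow> Q g"
  shows "measure_pmf.prob (Pi_pmf I False (\<lambda>_. bernoulli_pmf p)) {f. Q f} \<le>
    measure_pmf.prob (Pi_pmf I False (\<lambda>_. bernoulli_pmf p')) {f. Q f}"
proof (cases "p' = 0")
  case False
  let ?q = "\<lambda>b. if b then bernoulli_pmf (p / p') else return_pmf False"
  have "Pi_pmf I False (\<lambda>_. bernoulli_pmf p) =
      bind_pmf (Pi_pmf I False (\<lambda>_. bernoulli_pmf p')) (\<lambda>f. Pi_pmf I False (\<lambda>x. ?q (f x)))"
    using assms False by (subst bernoulli_pmf_thinning[of p p']) (auto intro: Pi_pmf_bind)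
  then have "emeasure (Pi_pmf I False (\<lambda>_. bernoulli_pmf p)) {f. Q f} =
      (\<integral>\<^sup>+f. emeasure (Pi_pmf I False (\<lambda>x. ?q (f x))) {g. Q g} \<partial>Pi_pmf I False (\<lambda>_. bernoulli_pmf p'))"
    by simp
  also have "\<dots> \<le> (\<integral>\<^sup>+f. indicator {f. Q f} f \<partial>Pi_pmf I False (\<lambda>_. bernoulli_pmf p'))"
  proof (rule nn_integral_mono)
    fix f :: "'a \<Rightarrow> bool"
    show "emeasure (Pi_pmf I False (\<lambda>x. ?q (f x))) {g. Q g} \<le> indicator {f. Q f} f"
    proof (cases "Q f")
      case True
      then show ?thesis by (simp add: measure_pmf.emeasure_eq_measure)
    next
      case False
      have "\<not> Q g" if "g \<in> set_pmf (Pi_pmf I False (\<lambda>x. ?q (f x)))" for g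
      proof
        assume "Q g"
        have "g x \<Longrightarrow> f x" for x
          using that set_Pi_pmf_subset'[OF assms(1), of False "\<lambda>x. ?q (f x)"]
          by (cases "x \<in> I") (auto simp: PiE_dflt_def split: if_splits)
        with \<open>Q g\<close> False mono show False by blast
      qed
      then have "measure_pmf.prob (Pi_pmf I False (\<lambda>x. ?q (f x))) {g. Q g} = measure_pmf.prob (Pi_pmf I False (\<lambda>x. ?q (f x))) {g. False}"
        by (intro measure_pmf_prob_cong) auto
      then show ?thesis by (simp add: measure_pmf.emeasure_eq_measure)
    qed
  qed
  finally show ?thesis by (simp add: measure_pmf.emeasure_eq_measure)
qed (use assms in auto)

lemma path_between_mono:
  assumes "path_between G u v xs" "nodes G = nodes H" "edges G \<subseteq> edges H"
  shows "path_between H u v xs"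
  using assms unfolding path_between_def by auto

lemma k_connected_mono:
  assumes "k_connected k G" "nodes G = nodes H" "edges G \<subseteq> edges H"
  shows "k_connected k H"
  using assms(1) path_between_mono[OF _ assms(2,3)] unfolding k_connected_def assms(2) by meson

lemma min_node_degree_mono:
  assumes "finite (nodes G)" "nodes G = nodes H" "edges G \<subseteq> edges H"
  shows "min_node_degree G \<le> min_node_degree H"
proof (cases "nodes G = {}")
  case True
  then show ?thesis using assms by (simp add: min_node_degree_def)
next
  case False
  have "node_degree G v \<le> node_degree H v" for v
    unfolding node_degree_def using assms by (intro card_mono) auto
  then show ?thesis
    using assms False unfolding min_node_degree_def
    by (subst Min_ge_iff) (auto intro: order.trans[OF Min_le])
qed

lemma prob_binomial_intersection_graph_mono:
  assumes p: "0 \<le> p" "p \<le> p'" "p' \<le> 1"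
    and mono: "\<And>G H :: nat ugraph. Q G \<Longrightarrow> finite (nodes G) \<Longrightarrow> nodes G = nodes H \<Longrightarrow> edges G \<subseteq> edges H \<Longrightarrow> Q H"
  shows "measure_pmf.prob (binomial_intersection_graph n N p) {G. Q G} \<le>
    measure_pmf.prob (binomial_intersection_graph n N p') {G. Q G}"
proof -
  interpret A: incidence "{1..n}" "{1..N}" p by unfold_locales (use p in auto)
  interpret B: incidence "{1..n}" "{1..N}" p' by unfold_locales (use p in auto)
  have "Q (A.graph g)" if le: "\<And>x. f x \<Longrightarrow> g x" and "Q (A.graph f)" for f g
  proof (rule mono[OF that(2)])
    show "edges (A.graph f) \<subseteq> edges (A.graph g)"
      using le unfolding A.graph_def intersection_graph_def by fastforce
    show "finite (nodes (A.graph f))" "nodes (A.graph f) = nodes (A.graph g)"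
      unfolding A.nodes_graph by simp_all
  qed
  then have "A.prob (\<lambda>f. Q (A.graph f)) \<le> B.prob (\<lambda>f. Q (A.graph f))"
    using p by (intro prob_Pi_pmf_bernoulli_mono) auto
  then show ?thesis
    unfolding binomial_intersection_graph_def A.map_graph_M[symmetric] B.map_graph_M[symmetric]
    by (simp add: vimage_def)
qed

text \<open>The inclusion probability for the constant sequence \<open>\<alpha>\<^sub>n = b\<close>; clipping affects only finitely many \<open>n\<close>.\<close>

definition critical_prob :: "nat \<Rightarrow> (nat \<Rightarrow> nat) \<Rightarrow> real \<Rightarrow> nat \<Rightarrow> real" where
  "critical_prob k P b n =
     sqrt (max 0 (min 1 ((ln (real n) + (real k - 1) * ln (ln (real n)) + b) / (real n * real (P n)))))"

lemma critical_prob_range: "critical_prob k P b n \<in> {0..1}"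
  by (auto simp: critical_prob_def)

lemma critical_prob_squared:
  assumes "\<forall>n\<ge>1. 1 \<le> P n"
  shows "\<forall>\<^sub>F n in sequentially. (critical_prob k P b n)\<^sup>2 =
    (ln (real n) + (real k - 1) * ln (ln (real n)) + b) / (real n * real (P n))"
proof -
  have "\<forall>\<^sub>F n in sequentially. 0 \<le> ln (real n) + (real k - 1) * ln (ln (real n)) + b" by real_asymp
  moreover have "\<forall>\<^sub>F n in sequentially. ln (real n) + (real k - 1) * ln (ln (real n)) + b \<le> real n" by real_asymp
  ultimately show ?thesis
    using eventually_ge_at_top[of 1]
  proof eventually_elim
    case (elim n)
    have "1 \<le> P n" using assms elim by simp
    then have "real n * 1 \<le> real n * real (P n)" "0 < real n * real (P n)"
      using elim by (auto simp del: mult_le_cancel_left1 intro!: mult_left_mono)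
    then have "(ln (real n) + (real k - 1) * ln (ln (real n)) + b) / (real n * real (P n)) \<in> {0..1}"
      using elim by (simp add: order.trans)
    then show ?case by (simp add: critical_prob_def)
  qed
qed

lemma threshold_critical_prob:
  assumes "1 \<le> k" "\<forall>n\<ge>1. 1 \<le> P n" "(\<lambda>n. real (P n)) \<in> \<omega>(\<lambda>n. real n * ln (real n) ^ 5)"
  shows "threshold k P (critical_prob k P b) b"
proof
  have "\<forall>\<^sub>F n in sequentially. b = real n * ((critical_prob k P b n)\<^sup>2 * real (P n)) - ln (real n) - (real k - 1) * ln (ln (real n))"
    using critical_prob_squared[of P k b, OF assms(2)] eventually_ge_at_top[of 1]
    by eventually_elim (use assms(2) in \<open>force simp: field_simps\<close>)
  with tendsto_const
  show "(\<lambda>n. real n * ((critical_prob k P b n)\<^sup>2 * real (P n)) - ln (real n) - (real k - 1) * ln (ln (real n))) \<longlonglongrightarrow> b"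
    by (rule Lim_transform_eventually)
qed (use assms critical_prob_range in auto)

text \<open>As \<open>Q\<close> is increasing, an eventual bound of \<open>\<alpha>\<close> by a
  constant \<open>b\<close> compares \<open>F p\<close> with \<open>F\<close> at
  \<open>critical_prob k P b\<close>, whose limit is known. Sending \<open>b\<close> to either
  infinity settles the infinite limits; the finite one is an instance of
  \<open>limit\<close>.\<close>

lemma monotone_property_limits:
  fixes k :: nat and P :: "nat \<Rightarrow> nat" and p \<alpha> :: "nat \<Rightarrow> real" and Q :: "nat ugraph \<Rightarrow> bool"
  defines "F \<equiv> \<lambda>p n. measure_pmf.prob (binomial_intersection_graph n (P n) (p n)) {G. Q G}"
  assumes k_pos: "k \<ge> 1"
    and P_pos: "\<And>n. n \<ge> 1 \<Longrightarrow> P n \<ge> 1"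
    and p_range: "\<And>n. n \<ge> 1 \<Longrightarrow> p n \<in> {0..1}"
    and alpha: "\<And>n. n \<ge> 2 \<Longrightarrow>
      (p n)\<^sup>2 * real (P n) = (ln (real n) + (real k - 1) * ln (ln (real n)) + \<alpha> n) / real n"
    and P_growth: "(\<lambda>n. real (P n)) \<in> \<omega>(\<lambda>n. real n * ln (real n) ^ 5)"
    and mono: "\<And>G H :: nat ugraph. Q G \<Longrightarrow> finite (nodes G) \<Longrightarrow> nodes G = nodes H \<Longrightarrow> edges G \<subseteq> edges H \<Longrightarrow> Q H"
    and limit: "\<And>p b. threshold k P p b \<Longrightarrow> F p \<longlonglongrightarrow> exp (- (exp (- b) / fact (k - 1)))"
  shows "filterlim \<alpha> at_bot sequentially \<Longrightarrow> F p \<longlonglongrightarrow> 0"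
    and "filterlim \<alpha> at_top sequentially \<Longrightarrow> F p \<longlonglongrightarrow> 1"
    and "\<alpha> \<longlonglongrightarrow> a \<Longrightarrow> F p \<longlonglongrightarrow> exp (- (exp (- a) / fact (k - 1)))"
proof -
  let ?g = "\<lambda>b::real. exp (- (exp (- b) / fact (k - 1)))"
  have P1: "\<forall>n\<ge>1. 1 \<le> P n" using P_pos by simp
  have crit: "F (critical_prob k P b) \<longlonglongrightarrow> ?g b" for b
    by (intro limit threshold_critical_prob k_pos P1 P_growth)
  have squares: "\<forall>\<^sub>F n in sequentially. 2 \<le> n \<and> (p n)\<^sup>2 = (ln (real n) + (real k - 1) * ln (ln (real n)) + \<alpha> n) / (real n * real (P n))"
    using eventually_ge_at_top[of 2]
  proof eventually_elim
    case (elim n)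
    then show ?case using alpha[of n] P_pos[of n] by (simp add: field_simps)
  qed
  have below: "\<forall>\<^sub>F n in sequentially. F p n \<le> F (critical_prob k P b) n" if "\<forall>\<^sub>F n in sequentially. \<alpha> n \<le> b" for b
    using that squares critical_prob_squared[of P k b, OF P1]
  proof eventually_elim
    case (elim n)
    have "(p n)\<^sup>2 \<le> (critical_prob k P b n)\<^sup>2" using elim by (simp add: divide_right_mono)
    then have "p n \<le> critical_prob k P b n"
      using critical_prob_range[of k P b n] by (auto intro: power2_le_imp_le)
    then show ?case unfolding F_def
      using p_range[of n] elim critical_prob_range[of k P b n] mono by (intro prob_binomial_intersection_graph_mono) auto
  qed
  have above: "\<forall>\<^sub>F n in sequentially. F (critical_prob k P b) n \<le> F p n" if "\<forall>\<^sub>F n in sequentially. b \<le> \<alpha> n" for b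
    using that squares critical_prob_squared[of P k b, OF P1]
  proof eventually_elim
    case (elim n)
    have "(critical_prob k P b n)\<^sup>2 \<le> (p n)\<^sup>2" using elim by (simp add: divide_right_mono)
    then have "critical_prob k P b n \<le> p n"
      using p_range[of n] elim by (auto intro: power2_le_imp_le)
    then show ?case unfolding F_def
      using p_range[of n] elim critical_prob_range[of k P b n] mono by (intro prob_binomial_intersection_graph_mono) auto
  qed
  have bounds: "0 \<le> F p n" "F p n \<le> 1" for n by (auto simp: F_def)
  show "F p \<longlonglongrightarrow> 0" if "filterlim \<alpha> at_bot sequentially"
  proof (rule order_tendstoI)
    fix e :: real assume "0 < e"
    have "(?g \<longlongrightarrow> 0) at_bot" by real_asymp
    then have "\<forall>\<^sub>F b in at_bot. ?g b < e" using \<open>0 < e\<close> by (rule order_tendstoD)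
    then obtain b where "?g b < e" by (auto dest: eventually_happens simp: trivial_limit_at_bot_linorder)
    have "\<forall>\<^sub>F n in sequentially. \<alpha> n \<le> b" using that by (simp add: filterlim_at_bot)
    from below[OF this] order_tendstoD(2)[OF crit \<open>?g b < e\<close>]
    show "\<forall>\<^sub>F n in sequentially. F p n < e" by eventually_elim simp
  qed (use bounds in \<open>auto intro!: always_eventually intro: less_le_trans\<close>)
  show "F p \<longlonglongrightarrow> 1" if "filterlim \<alpha> at_top sequentially"
  proof (rule order_tendstoI)
    fix e :: real assume "e < 1"
    have "(?g \<longlongrightarrow> 1) at_top" by real_asymp
    then have "\<forall>\<^sub>F b in at_top. e < ?g b" using \<open>e < 1\<close> by (rule order_tendstoD)
    then obtain b where "e < ?g b" by (auto dest: eventually_happens simp: trivial_limit_at_top_linorder)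
    have "\<forall>\<^sub>F n in sequentially. b \<le> \<alpha> n" using that by (simp add: filterlim_at_top)
    from above[OF this] order_tendstoD(1)[OF crit \<open>e < ?g b\<close>]
    show "\<forall>\<^sub>F n in sequentially. e < F p n" by eventually_elim simp
  qed (use bounds in \<open>auto intro!: always_eventually intro: le_less_trans\<close>)
  show "F p \<longlonglongrightarrow> ?g a" if "\<alpha> \<longlonglongrightarrow> a"
  proof -
    \<comment> \<open>The locale demands a probability also at \<open>n = 0\<close>, where nothing
      is known about \<open>p\<close>; changing one value does not affect the limit.\<close>
    define p' where "p' n = (if n = 0 then 0 else p n)" for n
    have "threshold k P p' a"
    proof
      have "\<forall>\<^sub>F n in sequentially. \<alpha> n = real n * ((p' n)\<^sup>2 * real (P n)) - ln (real n) - (real k - 1) * ln (ln (real n))"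
        using eventually_ge_at_top[of 2]
        by eventually_elim (simp add: p'_def alpha)
      with that show "(\<lambda>n. real n * ((p' n)\<^sup>2 * real (P n)) - ln (real n) - (real k - 1) * ln (ln (real n))) \<longlonglongrightarrow> a"
        by (rule Lim_transform_eventually)
    qed (use k_pos P_growth p_range in \<open>auto simp: p'_def\<close>)
    from limit[OF this] have "F p' \<longlonglongrightarrow> ?g a" .
    moreover have "\<forall>\<^sub>F n in sequentially. F p' n = F p n"
      using eventually_gt_at_top[of 0] by eventually_elim (simp add: F_def p'_def)
    ultimately show ?thesis by (rule Lim_transform_eventually)
  qed
qed

theorem theorem1:
  fixes k :: nat and P :: "nat \<Rightarrow> nat" and p :: "nat \<Rightarrow> real" and \<alpha> :: "nat \<Rightarrow> real"
  assumes k_pos: "k \<ge> 1"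
    and P_pos: "\<And>n. n \<ge> 1 \<Longrightarrow> P n \<ge> 1"
    and p_range: "\<And>n. n \<ge> 1 \<Longrightarrow> p n \<in> {0..1}"
    and alpha: "\<And>n. n \<ge> 2 \<Longrightarrow>
      (p n)\<^sup>2 * real (P n) = (ln (real n) + (real k - 1) * ln (ln (real n)) + \<alpha> n) / real n"
    and P_growth: "(\<lambda>n. real (P n)) \<in> \<omega>(\<lambda>n. real n * ln (real n) ^ 5)"
  shows
    "(filterlim \<alpha> at_bot sequentially \<longrightarrow>
        (\<lambda>n. measure_pmf.prob (binomial_intersection_graph n (P n) (p n))
               {G. k_connected k G}) \<longlonglongrightarrow> 0) \<and>
     (filterlim \<alpha> at_top sequentially \<longrightarrow>
        (\<lambda>n. measure_pmf.prob (binomial_intersection_graph n (P n) (p n))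
               {G. k_connected k G}) \<longlonglongrightarrow> 1) \<and>
     (\<forall>a::real. \<alpha> \<longlonglongrightarrow> a \<longrightarrow>
        (\<lambda>n. measure_pmf.prob (binomial_intersection_graph n (P n) (p n))
               {G. k_connected k G}) \<longlonglongrightarrow> exp (- (exp (- a) / fact (k - 1)))) \<and>
     (filterlim \<alpha> at_bot sequentially \<longrightarrow>
        (\<lambda>n. measure_pmf.prob (binomial_intersection_graph n (P n) (p n))
               {G. min_node_degree G \<ge> k}) \<longlonglongrightarrow> 0) \<and>
     (filterlim \<alpha> at_top sequentially \<longrightarrow>
        (\<lambda>n. measure_pmf.prob (binomial_intersection_graph n (P n) (p n))
               {G. min_node_degree G \<ge> k}) \<longlonglongrightarrow> 1) \<and>
     (\<forall>a::real. \<alpha> \<longlonglongrightarrow> a \<longrightarrow>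
        (\<lambda>n. measure_pmf.prob (binomial_intersection_graph n (P n) (p n))
               {G. min_node_degree G \<ge> k}) \<longlonglongrightarrow> exp (- (exp (- a) / fact (k - 1))))"
  proof (intro conjI impI allI)
  note hyps = k_pos P_pos p_range alpha P_growth
  note con = monotone_property_limits[of k P p \<alpha> "k_connected k", OF hyps
      k_connected_mono threshold.connectivity_limit]
  note deg = monotone_property_limits[of k P p \<alpha> "\<lambda>G. k \<le> min_node_degree G", OF hyps
      order.trans[OF _ min_node_degree_mono] threshold.min_degree_limit]
  show "(\<lambda>n. measure_pmf.prob (binomial_intersection_graph n (P n) (p n)) {G. k_connected k G})
      \<longlonglongrightarrow> 0" if "filterlim \<alpha> at_bot sequentially"
    using that by (intro con(1))
  show "(\<lambda>n. measure_pmf.prob (binomial_intersection_graph n (P n) (p n)) {G. k_connected k G})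
      \<longlonglongrightarrow> 1" if "filterlim \<alpha> at_top sequentially"
    using that by (intro con(2))
  show "(\<lambda>n. measure_pmf.prob (binomial_intersection_graph n (P n) (p n)) {G. k_connected k G})
      \<longlonglongrightarrow> exp (- (exp (- a) / fact (k - 1)))" if "\<alpha> \<longlonglongrightarrow> a" for a
    using that by (intro con(3))
  show "(\<lambda>n. measure_pmf.prob (binomial_intersection_graph n (P n) (p n)) {G. k \<le> min_node_degree G})
      \<longlonglongrightarrow> 0" if "filterlim \<alpha> at_bot sequentially"
    using that by (intro deg(1))
  show "(\<lambda>n. measure_pmf.prob (binomial_intersection_graph n (P n) (p n)) {G. k \<le> min_node_degree G})
      \<longlonglongrightarrow> 1" if "filterlim \<alpha> at_top sequentially"
    using that by (intro deg(2))
  show "(\<lambda>n. measure_pmf.prob (binomial_intersection_graph n (P n) (p n)) {G. k \<le> min_node_degree G})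
      \<longlonglongrightarrow> exp (- (exp (- a) / fact (k - 1)))" if "\<alpha> \<longlonglongrightarrow> a" for a
    using that by (intro deg(3))
qed

end
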